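(* Let $p\in[2,\infty)$, $\sigma\in(0,1)$, and let $g\colon[0,T]\to\mathbb{R}$ be an element of $W^{1+\sigma,p}(0,T)$ (identified with its continuous representative). Let $\theta \in [0,1]$. Then, for all $N\in\mathbb{N}$ with $\frac{T}{N} = h$ it holds true that $$\big\| I[g] - Q^{\mathrm{Trap}}_N[g]\big\|_{L^p(\Omega)} \le C_p \big(2p(p-1)\big)^{\frac12}\, T^{\frac{p-2}{2p}}\, h^{1+\sigma}\, \|g\|_{W^{1+\sigma,p}(0,T)}.$$
   Context: Let $T\in(0,\infty)$, let $(\Omega_W,\mathcal{F}^W,(\mathcal{F}^W_t)_{t\in[0,T]},\mathbb{P}_W)$ be a filtered probability space satisfying the usual conditions, and let $W\colon[0,T]\times\Omega_W\to\mathbb{R}$ be a standard real-valued $(\mathcal{F}^W_t)_{t\in[0,T]}$-Wiener process. $(\Omega,\mathcal{F},\mathbb{P})$ is the product of $(\Omega_W,\mathcal{F}^W,\mathbb{P}_W)$ with another probability space $(\Omega_\Theta,\mathcal{F}^\Theta,\mathbb{P}_\Theta)$; random variables on $\Omega_W$ are regarded as random variables on $\Omega$, so for them the $L^p(\Omega)$-norm coincides with the $L^p(\Omega_W)$-norm. For $p\in[1,\infty)$ and $\sigma\in(0,1)$ the space $W^{1+\sigma,p}(0,T)$ consists of all $v\in L^p(0,T)$ with weak derivative $\dot v$ such that $$\|v\|_{W^{1+\sigma,p}(0,T)} = \Big(\int_0^T|v(t)|^p\,\mathrm{d}t + \int_0^T|\dot v(t)|^p\,\mathrm{d}t + \int_0^T\int_0^T\frac{|\dot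 v(t)-\dot v(s)|^p}{|t-s|^{1+\sigma p}}\,\mathrm{d}t\,\mathrm{d}s\Big)^{\frac1p}<\infty .$$ The Itô integral is $I[g]=\int_0^T g(s)\,\mathrm{d}W(s)$. For $N\in\mathbb{N}$, $h=T/N$, put $t_j=jh$ for $j\in\{0,\dots,N\}$, and for $j \in\{1,\dots,N\}$ put $t_{j-\frac12}=\frac12(t_{j-1}+t_j)$, $\theta_j=t_{j-1}+\theta h$, $\hat\theta_j=t_{j-1}+(1-\theta)h$. The quadrature rule is $$Q^{\mathrm{Trap}}_N[g]=\sum_{j=1}^N\frac12\big(g(\theta_j)+g(\hat\theta_j)\big)\big(W(t_j)-W(t_{j-1})\big)+\sum_{j=1}^N\frac1h\big(g(t_j)-g(t_{j-1})\big)\int_{t_{j-1}}^{t_j}(t-t_{j-\frac12})\,\mathrm{d}W(t).$$ $C_p\in(0,\infty)$ denotes the constant in the upper discrete-time Burkholder–Davis–Gundy inequality, i.e. a constant depending only on $p$ such that for every discrete time martingale $(X_n)_{n\in\mathbb{N}}$ and every $n\in\mathbb{N}$, $$\Big\|\max_{i\in\{1,\dots,n\}}|X_i|\Big\|_{L^p}\le C_p\Big\|[X]_n^{\frac12}\Big\|_{L^p},\qquad [X]_n=|X_1|^2+\sum_{i=1}^{n-1}|X_{i+1}-X_i|^2 .$$ *)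

theory Defs
  imports "HOL-Probability.Probability"
begin

section \<open>Lebesgue norms\<close>

text \<open>Norms take values in \<open>[0, \<infinity>]\<close>, so that an inequality between norms also asserts finiteness
  of the smaller side whenever the larger one is finite.\<close>

definition ennreal_root :: "real \<Rightarrow> ennreal \<Rightarrow> ennreal" where
  "ennreal_root p x = (if x = \<top> then \<top> else ennreal (enn2real x powr (1 / p)))"

definition Lp_norm :: "real \<Rightarrow> 'a measure \<Rightarrow> ('a \<Rightarrow> real) \<Rightarrow> ennreal" where
  "Lp_norm p M X = ennreal_root p (\<integral>\<^sup>+\<omega>. ennreal (\<bar>X \<omega>\<bar> powr p) \<partial>M)"

section \<open>Fractional Sobolev spaces on an interval\<close>

definition test_function :: "real \<Rightarrow> (real \<Rightarrow> real) \<Rightarrow> bool" where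
  "test_function T \<phi> \<longleftrightarrow>
     (\<forall>k x. (deriv ^^ k) \<phi> field_differentiable at x) \<and>
     (\<exists>a b. 0 < a \<and> b < T \<and> (\<forall>x. x \<notin> {a..b} \<longrightarrow> \<phi> x = 0))"

definition locally_integrable :: "real \<Rightarrow> (real \<Rightarrow> real) \<Rightarrow> bool" where
  "locally_integrable T v \<longleftrightarrow>
     set_borel_measurable lborel {0<..<T} v \<and>
     (\<forall>a b. 0 < a \<and> b < T \<longrightarrow> set_integrable lborel {a..b} v)"

definition has_weak_derivative :: "real \<Rightarrow> (real \<Rightarrow> real) \<Rightarrow> (real \<Rightarrow> real) \<Rightarrow> bool" where
  "has_weak_derivative T v w \<longleftrightarrow>
     locally_integrable T v \<and> locally_integrable T w \<and>
     (\<forall>\<phi>. test_function T \<phi> \<longrightarrow>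
        (LINT t:{0<..<T}|lborel. v t * deriv \<phi> t) = - (LINT t:{0<..<T}|lborel. w t * \<phi> t))"

text \<open>Weak derivatives are unique up to null sets, and the norm below does not depend on the choice.\<close>

definition weak_derivative :: "real \<Rightarrow> (real \<Rightarrow> real) \<Rightarrow> real \<Rightarrow> real" where
  "weak_derivative T v = (SOME w. has_weak_derivative T v w)"

text \<open>The norm of \<open>W\<^sup>1\<^sup>+\<^sup>\<sigma>\<^sup>,\<^sup>p(0, T)\<close>. On the diagonal \<open>t = s\<close>, a null set, the quotient is \<open>0 / 0 = 0\<close>.\<close>

definition sobolev_norm :: "real \<Rightarrow> real \<Rightarrow> real \<Rightarrow> (real \<Rightarrow> real) \<Rightarrow> ennreal" where
  "sobolev_norm T \<sigma> p v =
     (let w = weak_derivative T v in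
      ennreal_root p
        ((\<integral>\<^sup>+t\<in>{0<..<T}. ennreal (\<bar>v t\<bar> powr p) \<partial>lborel)
         + (\<integral>\<^sup>+t\<in>{0<..<T}. ennreal (\<bar>w t\<bar> powr p) \<partial>lborel)
         + (\<integral>\<^sup>+s\<in>{0<..<T}. (\<integral>\<^sup>+t\<in>{0<..<T}.
              ennreal (\<bar>w t - w s\<bar> powr p / \<bar>t - s\<bar> powr (1 + \<sigma> * p)) \<partial>lborel) \<partial>lborel)))"

definition sobolev_space :: "real \<Rightarrow> real \<Rightarrow> real \<Rightarrow> (real \<Rightarrow> real) set" where
  "sobolev_space T \<sigma> p =
     {v. set_borel_measurable lborel {0<..<T} v \<and> (\<exists>w. has_weak_derivative T v w) \<and>
         sobolev_norm T \<sigma> p v < \<infinity>}"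

section \<open>Filtered probability spaces and Wiener processes\<close>

text \<open>Only the values \<open>F t\<close> and \<open>W t\<close> with \<open>t \<in> {0..T}\<close> are meaningful.\<close>

locale usual_filtered_prob_space = prob_space M + complete_measure M
  for M :: "'a measure" +
  fixes F :: "real \<Rightarrow> 'a measure" and T :: real
  assumes subalgebra_F: "t \<in> {0..T} \<Longrightarrow> subalgebra M (F t)"
    and mono_F: "0 \<le> s \<Longrightarrow> s \<le> t \<Longrightarrow> t \<le> T \<Longrightarrow> sets (F s) \<subseteq> sets (F t)"
    and null_sets_F: "null_sets M \<subseteq> sets (F 0)"
    and right_continuous_F: "0 \<le> t \<Longrightarrow> t < T \<Longrightarrow> sets (F t) = (\<Inter>s\<in>{t<..T}. sets (F s))"

locale wiener_process = usual_filtered_prob_space M F T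
  for M :: "'a measure" and F :: "real \<Rightarrow> 'a measure" and T :: real +
  fixes W :: "real \<Rightarrow> 'a \<Rightarrow> real"
  assumes adapted_W: "t \<in> {0..T} \<Longrightarrow> W t \<in> borel_measurable (F t)"
    and W_0: "AE \<omega> in M. W 0 \<omega> = 0"
    and continuous_W: "AE \<omega> in M. continuous_on {0..T} (\<lambda>t. W t \<omega>)"
    and normal_increments_W: "0 \<le> s \<Longrightarrow> s < t \<Longrightarrow> t \<le> T \<Longrightarrow>
      distributed M lborel (\<lambda>\<omega>. W t \<omega> - W s \<omega>) (normal_density 0 (sqrt (t - s)))"
    and indep_increments_W: "0 \<le> s \<Longrightarrow> s < t \<Longrightarrow> t \<le> T \<Longrightarrow>
      indep_set (sets (F s)) {(\<lambda>\<omega>. W t \<omega> - W s \<omega>) -` B \<inter> space M |B. B \<in> sets borel}"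

section \<open>The Ito integral\<close>

text \<open>A list entry \<open>(r, s, \<xi>)\<close> stands for the process \<open>\<xi> 1\<^bsub>(r, s]\<^esub>\<close>, with \<open>\<xi>\<close> bounded and
  \<open>F r\<close>-measurable. The intervals of a list may overlap.\<close>

type_synonym 'a elementary = "(real \<times> real \<times> ('a \<Rightarrow> real)) list"

definition elementary :: "'a measure \<Rightarrow> (real \<Rightarrow> 'a measure) \<Rightarrow> real \<Rightarrow> real \<Rightarrow> 'a elementary \<Rightarrow> bool" where
  "elementary M F a b H \<longleftrightarrow>
     (\<forall>(r, s, \<xi>) \<in> set H. a \<le> r \<and> r \<le> s \<and> s \<le> b \<and>
        \<xi> \<in> borel_measurable (F r) \<and> bounded (\<xi> ` space M))"

definition elementary_process :: "'a elementary \<Rightarrow> real \<Rightarrow> 'a \<Rightarrow> real" where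
  "elementary_process H t \<omega> = (\<Sum>(r, s, \<xi>)\<leftarrow>H. \<xi> \<omega> * indicator {r<..s} t)"

definition elementary_integral :: "(real \<Rightarrow> 'a \<Rightarrow> real) \<Rightarrow> 'a elementary \<Rightarrow> 'a \<Rightarrow> real" where
  "elementary_integral W H \<omega> = (\<Sum>(r, s, \<xi>)\<leftarrow>H. \<xi> \<omega> * (W s \<omega> - W r \<omega>))"

text \<open>\<open>Y\<close> is a version of the integral of \<open>X\<close> over \<open>[a, b]\<close> against \<open>W\<close>: the \<open>L\<^sup>2\<close>-limit of the
  integrals of elementary processes that approximate \<open>X\<close> in \<open>L\<^sup>2([a, b] \<times> \<Omega>)\<close>.\<close>

definition has_ito_integral ::
  "'a measure \<Rightarrow> (real \<Rightarrow> 'a measure) \<Rightarrow> (real \<Rightarrow> 'a \<Rightarrow> real) \<Rightarrow> real \<Rightarrow> real \<Rightarrow>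
   (real \<Rightarrow> 'a \<Rightarrow> real) \<Rightarrow> ('a \<Rightarrow> real) \<Rightarrow> bool" where
  "has_ito_integral M F W a b X Y \<longleftrightarrow>
     (\<lambda>(\<omega>, t). X t \<omega>) \<in> borel_measurable (M \<Otimes>\<^sub>M restrict_space lborel {a..b}) \<and>
     Y \<in> borel_measurable M \<and>
     (\<exists>H. (\<forall>n. elementary M F a b (H n)) \<and>
        (\<lambda>n. \<integral>\<^sup>+\<omega>. (\<integral>\<^sup>+t\<in>{a..b}. ennreal ((elementary_process (H n) t \<omega> - X t \<omega>)\<^sup>2) \<partial>lborel) \<partial>M)
          \<longlonglongrightarrow> 0 \<and>
        (\<lambda>n. \<integral>\<^sup>+\<omega>. ennreal ((elementary_integral W (H n) \<omega> - Y \<omega>)\<^sup>2) \<partial>M) \<longlonglongrightarrow> 0)"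

definition ito_integral ::
  "'a measure \<Rightarrow> (real \<Rightarrow> 'a measure) \<Rightarrow> (real \<Rightarrow> 'a \<Rightarrow> real) \<Rightarrow> real \<Rightarrow> real \<Rightarrow>
   (real \<Rightarrow> 'a \<Rightarrow> real) \<Rightarrow> 'a \<Rightarrow> real" where
  "ito_integral M F W a b X = (SOME Y. has_ito_integral M F W a b X Y)"

section \<open>The stochastic trapezoidal rule\<close>

definition trapezoidal_rule ::
  "'a measure \<Rightarrow> (real \<Rightarrow> 'a measure) \<Rightarrow> (real \<Rightarrow> 'a \<Rightarrow> real) \<Rightarrow> real \<Rightarrow> real \<Rightarrow> nat \<Rightarrow>
   (real \<Rightarrow> real) \<Rightarrow> 'a \<Rightarrow> real" where
  "trapezoidal_rule M F W T \<theta> N g \<omega> =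
     (let h = T / real N;
          t = (\<lambda>j::nat. real j * h);
          tmid = (\<lambda>j. (t (j - 1) + t j) / 2);
          \<theta>1 = (\<lambda>j. t (j - 1) + \<theta> * h);
          \<theta>2 = (\<lambda>j. t (j - 1) + (1 - \<theta>) * h)
      in (\<Sum>j=1..N. 1 / 2 * (g (\<theta>1 j) + g (\<theta>2 j)) * (W (t j) \<omega> - W (t (j - 1)) \<omega>))
       + (\<Sum>j=1..N. 1 / h * (g (t j) - g (t (j - 1)))
            * ito_integral M F W (t (j - 1)) (t j) (\<lambda>s _. s - tmid j) \<omega>))"

section \<open>The discrete-time Burkholder--Davis--Gundy inequality\<close>

text \<open>Martingales are indexed by \<open>n \<ge> 1\<close>; the index \<open>0\<close> of the filtration carries no information.\<close>

definition discrete_martingale ::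
  "'a measure \<Rightarrow> (nat \<Rightarrow> 'a measure) \<Rightarrow> (nat \<Rightarrow> 'a \<Rightarrow> real) \<Rightarrow> bool" where
  "discrete_martingale M F X \<longleftrightarrow>
     filtration (space M) F \<and> (\<forall>n. subalgebra M (F n)) \<and>
     (\<forall>n\<ge>1. X n \<in> borel_measurable (F n) \<and> integrable M (X n) \<and>
        (AE \<omega> in M. real_cond_exp M (F n) (X (Suc n)) \<omega> = X n \<omega>))"

definition quadratic_variation :: "(nat \<Rightarrow> 'a \<Rightarrow> real) \<Rightarrow> nat \<Rightarrow> 'a \<Rightarrow> real" where
  "quadratic_variation X n \<omega> = \<bar>X 1 \<omega>\<bar>\<^sup>2 + (\<Sum>i=1..n-1. \<bar>X (i + 1) \<omega> - X i \<omega>\<bar>\<^sup>2)"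

text \<open>HOL cannot quantify over the type of sample points inside a formula. Both sides of the
  inequality depend only on the law of the martingale, and a martingale remains one for its natural
  filtration, so every discrete-time martingale can be realised on the sequence space
  \<open>nat \<Rightarrow> real\<close>; hence the quantification over all probability measures there loses no generality.\<close>

definition bdg_constant :: "real \<Rightarrow> real \<Rightarrow> bool" where
  "bdg_constant p C \<longleftrightarrow> 0 < C \<and>
     (\<forall>(M :: (nat \<Rightarrow> real) measure) F X. prob_space M \<and> discrete_martingale M F X \<longrightarrow>
        (\<forall>n\<ge>1. Lp_norm p M (\<lambda>\<omega>. Max ((\<lambda>i. \<bar>X i \<omega>\<bar>) ` {1..n}))
              \<le> ennreal C * Lp_norm p M (\<lambda>\<omega>. sqrt (quadratic_variation X n \<omega>))))"

end

theory Submission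
  imports Defs "HOL-Computational_Algebra.Polynomial"
begin

text \<open>
  On the cell from \<open>a\<close> to \<open>b\<close> the trapezoidal rule integrates exactly the affine function whose slope is
  that of the chord of \<open>g\<close> and whose value at the midpoint is the mean of \<open>g\<close> at the two evaluation
  points. So \<open>I[g] - Q[g]\<close> is the Wiener integral of the deterministic function that equals
  \<open>cell_error\<close> on each cell: a centred Gaussian variable, whose \<open>p\<close>-th moment is governed by its
  variance.

  The probabilistic half is that a centred Gaussian variable of variance \<open>v\<close> has \<open>p\<close>-th moment
  at most \<open>((p + 1) v)\<^sup>p\<^sup>/\<^sup>2\<close> (\<open>normal_moment_powr_le\<close>). Since \<open>p + 1 \<le> 2 p (p - 1)\<close>, and since the
  Burkholder--Davis--Gundy inequality for the constant martingale \<open>1\<close> forces \<open>C \<ge> 1\<close>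
  (\<open>bdg_constant_ge_1\<close>), the constant of the theorem dominates. The Ito integral is only given as
  some mean-square limit of integrals of elementary processes, so Gaussianity is not read off the
  definition. The isometry (\<open>ito_isometry\<close>) shows that for a continuous integrand every such limit is
  also the limit of the Riemann sums with left end points (\<open>riemann_sum_tendsto_ito_integral\<close>). The
  error is thus a limit of sums of independent Gaussian increments, and Fatou's lemma carries the
  moment bound over (\<open>nn_integral_powr_le_of_mean_square_limit\<close>).

  The analytic half bounds the integrand. Testing the weak derivative \<open>w\<close> of \<open>g\<close> against smoothed
  indicators of intervals shows that the increments of \<open>g\<close> are integrals of \<open>w\<close>
  (\<open>weak_derivative_increment\<close>). The chord slope \<open>m\<close> of a cell is then the mean of \<open>w\<close>, and the cell
  error is an average of two integrals of \<open>w - m\<close> over parts of the cell. Hence it is at most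
  \<open>\<integral> \<bar>w - m\<bar> \<le> 1/h \<integral>\<integral> \<bar>w(t) - w(s)\<bar> ds dt\<close>, and a power mean together with \<open>\<bar>t - s\<bar> \<le> h\<close> bounds
  this by \<open>h\<^sup>1\<^sup>+\<^sup>\<sigma>\<^sup>-\<^sup>1\<^sup>/\<^sup>p S\<^sup>1\<^sup>/\<^sup>p\<close> with \<open>S\<close> the part of the fractional seminorm that comes from the
  cell (\<open>mean_oscillation_le\<close>). A power mean over the \<open>N = T/h\<close> cells then turns the sum of the
  squared bounds into the claimed power of \<open>T\<close>.
\<close>

section \<open>Power means and mean-square convergence\<close>

text \<open>The right-hand side is the tangent at \<open>l\<^sup>q\<close> of the concave function \<open>y \<mapsto> y\<^sup>1\<^sup>/\<^sup>q\<close>, taken at \<open>x\<^sup>q\<close>; as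
  a function of \<open>x\<^sup>q\<close> it is affine, so it can be integrated.\<close>

lemma powr_tangent_le:
  fixes x l q :: real
  assumes "0 \<le> x" "0 < l" "1 \<le> q"
  shows "x \<le> x powr q * (l powr (1 - q) / q) + (1 - 1 / q) * l"
proof (cases "x = 0")
  case True
  then show ?thesis using assms by simp
next
  case False
  with assms have x: "0 < x" by simp
  define a where "a = x powr q * l powr (1 - q)"
  have "a powr (1 / q) * l powr (1 - 1 / q) \<le> 1 / q * a + (1 - 1 / q) * l"
    by (rule Youngs_inequality_0) (use assms x in \<open>auto simp: a_def\<close>)
  moreover have "a powr (1 / q) = x * l powr (1 / q - 1)"
    using assms x by (simp add: a_def powr_mult powr_powr diff_divide_distrib)
  moreover have "l powr (1 / q - 1) * l powr (1 - 1 / q) = 1"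
    using assms by (simp flip: powr_add)
  ultimately show ?thesis by (simp add: a_def mult.assoc)
qed

text \<open>Integrating the tangent bound at the level \<open>l\<close> gives Jensen's inequality for \<open>x \<mapsto> x\<^sup>q\<close> on a space
  of mass at most \<open>c\<close>. It serves for the mean oscillation on a cell, for the sum over the cells, and for
  Gaussian moments.\<close>

lemma nn_integral_power_mean:
  fixes f :: "'a \<Rightarrow> real"
  assumes [measurable]: "f \<in> borel_measurable M"
    and f: "\<And>x. 0 \<le> f x" and q: "1 \<le> q" and l: "0 \<le> l" and c: "0 \<le> c"
    and space: "emeasure M (space M) \<le> ennreal c"
    and le: "(\<integral>\<^sup>+x. ennreal (f x powr q) \<partial>M) \<le> ennreal (c * l powr q)"
  shows "(\<integral>\<^sup>+x. ennreal (f x) \<partial>M) \<le> ennreal (c * l)"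
proof -
  have pos: "(\<integral>\<^sup>+x. ennreal (f x) \<partial>M) \<le> ennreal (c * k)"
    if k: "0 < k" and le: "(\<integral>\<^sup>+x. ennreal (f x powr q) \<partial>M) \<le> ennreal (c * k powr q)" for k
  proof -
    define a b where "a = k powr (1 - q) / q" and "b = (1 - 1 / q) * k"
    have ab: "0 \<le> a" "0 \<le> b" using q k by (auto simp: a_def b_def)
    have "(\<integral>\<^sup>+x. ennreal (f x) \<partial>M) \<le> (\<integral>\<^sup>+x. ennreal (f x powr q) * ennreal a + ennreal b \<partial>M)"
    proof (rule nn_integral_mono)
      fix x
      have "ennreal (f x) \<le> ennreal (f x powr q * a + b)"
        using powr_tangent_le[OF f k q, folded a_def b_def] by (rule ennreal_leI)
      also have "\<dots> = ennreal (f x powr q) * ennreal a + ennreal b"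
        using ab by (subst ennreal_plus) (auto simp: ennreal_mult)
      finally show "ennreal (f x) \<le> \<dots>" .
    qed
    also have "\<dots> = (\<integral>\<^sup>+x. ennreal (f x powr q) \<partial>M) * ennreal a + ennreal b * emeasure M (space M)"
      by (subst nn_integral_add) (auto simp: nn_integral_multc)
    also have "\<dots> \<le> ennreal (c * k powr q) * ennreal a + ennreal b * ennreal c"
      by (intro add_mono mult_mono le space) auto
    also have "\<dots> = ennreal (c * k powr q * a + b * c)"
      using ab c by (subst ennreal_plus) (auto simp: ennreal_mult)
    also have "c * k powr q * a + b * c = c * k"
    proof -
      have "k powr q * k powr (1 - q) = k" using k by (simp flip: powr_add)
      then have "c * k powr q * a = c * k / q" by (metis a_def mult.assoc times_divide_eq_right)
      moreover have "b * c = c * k - c * k / q" by (simp add: b_def algebra_simps)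
      ultimately show ?thesis by simp
    qed
    finally show ?thesis .
  qed
  show ?thesis
  proof (cases "l = 0")
    case False
    with l le pos show ?thesis by simp
  next
    case True
    \<comment> \<open>Every positive level is admissible, so the integral lies below every positive number.\<close>
    have "(\<integral>\<^sup>+x. ennreal (f x) \<partial>M) \<le> 0 + ennreal e" if "0 < e" for e :: real
    proof -
      have "(\<integral>\<^sup>+x. ennreal (f x) \<partial>M) \<le> ennreal (c * (e / (c + 1)))"
      proof (rule pos)
        show "0 < e / (c + 1)" using \<open>0 < e\<close> c by simp
        have "(\<integral>\<^sup>+x. ennreal (f x powr q) \<partial>M) \<le> 0" using le True q by simp
        also have "\<dots> \<le> ennreal (c * (e / (c + 1)) powr q)" by simp
        finally show "(\<integral>\<^sup>+x. ennreal (f x powr q) \<partial>M) \<le> \<dots>" .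
      qed
      also have "\<dots> \<le> ennreal e"
        using c \<open>0 < e\<close> by (intro ennreal_leI) (simp add: pos_divide_le_eq algebra_simps)
      finally show ?thesis by simp
    qed
    then have "(\<integral>\<^sup>+x. ennreal (f x) \<partial>M) \<le> 0" by (rule ennreal_le_epsilon)
    then show ?thesis by simp
  qed
qed

definition mean_square :: "'a measure \<Rightarrow> ('a \<Rightarrow> real) \<Rightarrow> ennreal" where
  "mean_square M X = (\<integral>\<^sup>+\<omega>. ennreal ((X \<omega>)\<^sup>2) \<partial>M)"

lemma sum_squared_le: "(x + y)\<^sup>2 \<le> 2 * x\<^sup>2 + 2 * (y::real)\<^sup>2"
  using zero_le_power2[of "x - y"] by (simp add: power2_eq_square algebra_simps)

lemma mean_square_add_le:
  assumes [measurable]: "X \<in> borel_measurable M" "Y \<in> borel_measurable M"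
  shows "mean_square M (\<lambda>\<omega>. X \<omega> + Y \<omega>) \<le> 2 * mean_square M X + 2 * mean_square M Y"
proof -
  have "ennreal ((x + y)\<^sup>2) \<le> 2 * ennreal (x\<^sup>2) + 2 * ennreal (y\<^sup>2)" for x y :: real
  proof -
    have "ennreal ((x + y)\<^sup>2) \<le> ennreal (2 * x\<^sup>2 + 2 * y\<^sup>2)"
      by (rule ennreal_leI) (rule sum_squared_le)
    also have "\<dots> = ennreal (2 * x\<^sup>2) + ennreal (2 * y\<^sup>2)" by (rule ennreal_plus) auto
    also have "\<dots> = 2 * ennreal (x\<^sup>2) + 2 * ennreal (y\<^sup>2)" by (simp add: ennreal_mult')
    finally show ?thesis .
  qed
  then have "mean_square M (\<lambda>\<omega>. X \<omega> + Y \<omega>) \<le> (\<integral>\<^sup>+\<omega>. 2 * ennreal ((X \<omega>)\<^sup>2) + 2 * ennreal ((Y \<omega>)\<^sup>2) \<partial>M)"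
    unfolding mean_square_def by (intro nn_integral_mono)
  also have "\<dots> = 2 * mean_square M X + 2 * mean_square M Y"
    unfolding mean_square_def by (subst nn_integral_add) (auto simp: nn_integral_cmult)
  finally show ?thesis .
qed

lemma mean_square_scale:
  assumes [measurable]: "X \<in> borel_measurable M"
  shows "mean_square M (\<lambda>\<omega>. c * X \<omega>) = ennreal (c\<^sup>2) * mean_square M X"
  unfolding mean_square_def
  by (simp add: power_mult_distrib ennreal_mult nn_integral_cmult)

lemma mean_square_triangle_le:
  assumes [measurable]: "X \<in> borel_measurable M" "Y \<in> borel_measurable M" "Z \<in> borel_measurable M"
  shows "mean_square M (\<lambda>\<omega>. X \<omega> - Z \<omega>) \<le> 2 * mean_square M (\<lambda>\<omega>. X \<omega> - Y \<omega>) + 2 * mean_square M (\<lambda>\<omega>. Y \<omega> - Z \<omega>)"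
  using mean_square_add_le[of "\<lambda>\<omega>. X \<omega> - Y \<omega>" M "\<lambda>\<omega>. Y \<omega> - Z \<omega>"] by simp

lemma mean_square_diff_commute:
  "mean_square M (\<lambda>\<omega>. X \<omega> - Y \<omega>) = mean_square M (\<lambda>\<omega>. Y \<omega> - X \<omega>)"
  by (simp add: mean_square_def power2_commute[of "X _" "Y _"])

lemma tendsto_mean_square_add:
  assumes "\<And>n. X n \<in> borel_measurable M" "\<And>n. Y n \<in> borel_measurable M"
    and X: "(\<lambda>n. mean_square M (X n)) \<longlonglongrightarrow> 0" and Y: "(\<lambda>n. mean_square M (Y n)) \<longlonglongrightarrow> 0"
  shows "(\<lambda>n. mean_square M (\<lambda>\<omega>. X n \<omega> + Y n \<omega>)) \<longlonglongrightarrow> 0"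
proof (rule tendsto_sandwich[where f = "\<lambda>_. 0"])
  show "(\<lambda>n. 2 * mean_square M (X n) + 2 * mean_square M (Y n)) \<longlonglongrightarrow> 0"
    using tendsto_add[OF ennreal_tendsto_cmult[OF _ X, of 2] ennreal_tendsto_cmult[OF _ Y, of 2]] by simp
  show "\<forall>\<^sub>F n in sequentially. mean_square M (\<lambda>\<omega>. X n \<omega> + Y n \<omega>) \<le> 2 * mean_square M (X n) + 2 * mean_square M (Y n)"
    using assms(1,2) by (intro always_eventually allI mean_square_add_le)
qed simp_all

lemma tendsto_mean_square_scale:
  assumes "\<And>n. X n \<in> borel_measurable M" and X: "(\<lambda>n. mean_square M (X n)) \<longlonglongrightarrow> 0"
  shows "(\<lambda>n. mean_square M (\<lambda>\<omega>. c * X n \<omega>)) \<longlonglongrightarrow> 0"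
  using ennreal_tendsto_cmult[OF _ X, of "ennreal (c\<^sup>2)"] assms(1) by (simp add: mean_square_scale)

lemma tendsto_mean_square_sum:
  assumes "finite I" "\<And>i n. i \<in> I \<Longrightarrow> X i n \<in> borel_measurable M"
    and "\<And>i. i \<in> I \<Longrightarrow> (\<lambda>n. mean_square M (X i n)) \<longlonglongrightarrow> 0"
  shows "(\<lambda>n. mean_square M (\<lambda>\<omega>. \<Sum>i\<in>I. X i n \<omega>)) \<longlonglongrightarrow> 0"
  using assms
proof (induction rule: finite_induct)
  case empty
  then show ?case by (simp add: mean_square_def)
next
  case (insert i I)
  have "(\<lambda>n. mean_square M (\<lambda>\<omega>. X i n \<omega> + (\<Sum>i\<in>I. X i n \<omega>))) \<longlonglongrightarrow> 0"
    by (intro tendsto_mean_square_add insert borel_measurable_sum) (use insert in auto)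
  then show ?case using insert by simp
qed

lemma (in prob_space) nn_integral_abs_le_mean_square:
  assumes [measurable]: "X \<in> borel_measurable M" and "0 < e" "mean_square M X \<le> ennreal (e\<^sup>2)"
  shows "(\<integral>\<^sup>+\<omega>. ennreal \<bar>X \<omega>\<bar> \<partial>M) \<le> ennreal e"
  using nn_integral_power_mean[of "\<lambda>\<omega>. \<bar>X \<omega>\<bar>" M 2 e 1] assms
  by (simp add: emeasure_space_1 mean_square_def)

lemma tendsto_0_ennrealI:
  fixes f :: "nat \<Rightarrow> ennreal"
  assumes "\<And>e. 0 < e \<Longrightarrow> \<forall>\<^sub>F n in sequentially. f n \<le> ennreal e"
  shows "f \<longlonglongrightarrow> 0"
proof (rule order_tendstoI)
  fix a :: ennreal assume "0 < a"
  then obtain b where b: "0 < b" "b < a" using dense by blast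
  then have "b \<noteq> \<top>" by (auto simp: top_unique)
  then obtain e where e: "b = ennreal e" "0 \<le> e" by (cases b) auto
  with b have "0 < e" by auto
  from assms[OF this] show "\<forall>\<^sub>F n in sequentially. f n < a"
    by eventually_elim (use b e in auto)
qed simp

text \<open>A subsequence whose successive distances are at most \<open>2\<^sup>-\<^sup>j\<close> has absolutely summable increments almost
  surely. Fatou's lemma identifies its pointwise limit as the mean-square limit.\<close>

lemma (in prob_space) mean_square_complete:
  fixes X :: "nat \<Rightarrow> 'a \<Rightarrow> real"
  assumes [measurable]: "\<And>n. X n \<in> borel_measurable M"
    and Cauchy: "\<And>e. 0 < e \<Longrightarrow> \<exists>k. \<forall>m\<ge>k. \<forall>n\<ge>k. mean_square M (\<lambda>\<omega>. X m \<omega> - X n \<omega>) \<le> ennreal e"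
  obtains Y where "Y \<in> borel_measurable M" "(\<lambda>n. mean_square M (\<lambda>\<omega>. X n \<omega> - Y \<omega>)) \<longlonglongrightarrow> 0"
proof -
  have "\<forall>j. \<exists>k. \<forall>m\<ge>k. \<forall>n\<ge>k. mean_square M (\<lambda>\<omega>. X m \<omega> - X n \<omega>) \<le> ennreal (((1/2) ^ j)\<^sup>2)"
    using Cauchy by simp
  then obtain K where K: "\<And>j m n. K j \<le> m \<Longrightarrow> K j \<le> n \<Longrightarrow>
      mean_square M (\<lambda>\<omega>. X m \<omega> - X n \<omega>) \<le> ennreal (((1/2) ^ j)\<^sup>2)"
    by metis
  define r where "r j = (\<Sum>i\<le>j. K i) + j" for j
  have r_ge: "K j \<le> r j" "r j \<le> r (Suc j)" for j
    by (auto simp: r_def intro: order_trans[OF member_le_sum[of j "{..j}" K]])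
  have r_ge': "j \<le> r j" for j by (simp add: r_def)
  have "AE \<omega> in M. summable (\<lambda>j. \<bar>X (r (Suc j)) \<omega> - X (r j) \<omega>\<bar>)"
  proof -
    have "(\<integral>\<^sup>+\<omega>. (\<Sum>j. ennreal \<bar>X (r (Suc j)) \<omega> - X (r j) \<omega>\<bar>) \<partial>M)
        = (\<Sum>j. \<integral>\<^sup>+\<omega>. ennreal \<bar>X (r (Suc j)) \<omega> - X (r j) \<omega>\<bar> \<partial>M)"
      by (rule nn_integral_suminf) auto
    also have "\<dots> \<le> (\<Sum>j. ennreal ((1/2) ^ j))"
      by (intro suminf_le allI nn_integral_abs_le_mean_square K)
        (use r_ge in \<open>auto intro: order_trans\<close>)
    also have "\<dots> = ennreal (\<Sum>j. (1/2) ^ j)"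
      by (rule suminf_ennreal2) (auto intro: summable_geometric)
    finally have "(\<integral>\<^sup>+\<omega>. (\<Sum>j. ennreal \<bar>X (r (Suc j)) \<omega> - X (r j) \<omega>\<bar>) \<partial>M) \<noteq> \<infinity>"
      by (auto simp: top_unique)
    then have "AE \<omega> in M. (\<Sum>j. ennreal \<bar>X (r (Suc j)) \<omega> - X (r j) \<omega>\<bar>) \<noteq> \<infinity>"
      by (intro nn_integral_PInf_AE) auto
    then show ?thesis
      by eventually_elim (auto intro!: summable_suminf_not_top)
  qed
  then have conv: "AE \<omega> in M. (\<lambda>j. X (r j) \<omega>) \<longlonglongrightarrow> lim (\<lambda>j. X (r j) \<omega>)"
  proof eventually_elim
    case (elim \<omega>)
    then have "summable (\<lambda>j. X (r (Suc j)) \<omega> - X (r j) \<omega>)" by (rule summable_rabs_cancel)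
    then have "convergent (\<lambda>n. \<Sum>j<n. X (r (Suc j)) \<omega> - X (r j) \<omega>)"
      by (simp add: summable_iff_convergent)
    then have "convergent (\<lambda>n. X (r n) \<omega> - X (r 0) \<omega>)"
      by (simp only: sum_lessThan_telescope[of "\<lambda>j. X (r j) \<omega>"])
    from convergent_add[OF this convergent_const[of "X (r 0) \<omega>"]]
    have "convergent (\<lambda>n. X (r n) \<omega>)" by simp
    then show ?case by (simp add: convergent_LIMSEQ_iff)
  qed
  define Y where "Y \<omega> = lim (\<lambda>j. X (r j) \<omega>)" for \<omega>
  have Y[measurable]: "Y \<in> borel_measurable M"
    unfolding Y_def by measurable
  have "(\<lambda>n. mean_square M (\<lambda>\<omega>. X n \<omega> - Y \<omega>)) \<longlonglongrightarrow> 0"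
  proof (rule tendsto_0_ennrealI)
    fix e :: real assume "0 < e"
    then obtain k where k: "\<And>m n. k \<le> m \<Longrightarrow> k \<le> n \<Longrightarrow> mean_square M (\<lambda>\<omega>. X m \<omega> - X n \<omega>) \<le> ennreal e"
      using Cauchy by blast
    have "mean_square M (\<lambda>\<omega>. X n \<omega> - Y \<omega>) \<le> ennreal e" if n: "k \<le> n" for n
    proof -
      have "AE \<omega> in M. ennreal ((X n \<omega> - Y \<omega>)\<^sup>2) = liminf (\<lambda>j. ennreal ((X n \<omega> - X (r j) \<omega>)\<^sup>2))"
        using conv
      proof eventually_elim
        case (elim \<omega>)
        then have "(\<lambda>j. ennreal ((X n \<omega> - X (r j) \<omega>)\<^sup>2)) \<longlonglongrightarrow> ennreal ((X n \<omega> - Y \<omega>)\<^sup>2)"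
          unfolding Y_def by (intro tendsto_intros tendsto_ennrealI)
        then show ?case by (intro lim_imp_Liminf[symmetric]) auto
      qed
      then have "mean_square M (\<lambda>\<omega>. X n \<omega> - Y \<omega>) = (\<integral>\<^sup>+\<omega>. liminf (\<lambda>j. ennreal ((X n \<omega> - X (r j) \<omega>)\<^sup>2)) \<partial>M)"
        unfolding mean_square_def by (rule nn_integral_cong_AE)
      also have "\<dots> \<le> liminf (\<lambda>j. mean_square M (\<lambda>\<omega>. X n \<omega> - X (r j) \<omega>))"
        unfolding mean_square_def by (rule nn_integral_liminf) auto
      also have "\<dots> \<le> liminf (\<lambda>j. ennreal e)"
      proof (rule Liminf_mono)
        show "\<forall>\<^sub>F j in sequentially. mean_square M (\<lambda>\<omega>. X n \<omega> - X (r j) \<omega>) \<le> ennreal e"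
          using eventually_ge_at_top[of k] by eventually_elim (use k n r_ge' le_trans in blast)
      qed
      finally show ?thesis by (simp add: Liminf_const)
    qed
    then show "\<forall>\<^sub>F n in sequentially. mean_square M (\<lambda>\<omega>. X n \<omega> - Y \<omega>) \<le> ennreal e"
      by (auto simp: eventually_sequentially)
  qed
  with Y show ?thesis by (rule that)
qed

text \<open>Mean-square convergence gives almost sure convergence along a subsequence, where Fatou's lemma
  applies.\<close>

lemma nn_integral_powr_le_of_mean_square_limit:
  fixes X :: "nat \<Rightarrow> 'a \<Rightarrow> real"
  assumes [measurable]: "\<And>n. X n \<in> borel_measurable M" "Y \<in> borel_measurable M"
    and lim: "(\<lambda>n. mean_square M (\<lambda>\<omega>. X n \<omega> - Y \<omega>)) \<longlonglongrightarrow> 0"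
    and le: "\<And>n. (\<integral>\<^sup>+\<omega>. ennreal (\<bar>X n \<omega>\<bar> powr p) \<partial>M) \<le> K" and p: "0 < p"
  shows "(\<integral>\<^sup>+\<omega>. ennreal (\<bar>Y \<omega>\<bar> powr p) \<partial>M) \<le> K"
proof -
  \<comment> \<open>From some index on the mean-square distance is finite, which makes the squares integrable.\<close>
  have "\<forall>\<^sub>F n in sequentially. mean_square M (\<lambda>\<omega>. X n \<omega> - Y \<omega>) < 1"
    using lim by (rule order_tendstoD) simp
  then obtain k where k: "\<And>n. k \<le> n \<Longrightarrow> mean_square M (\<lambda>\<omega>. X n \<omega> - Y \<omega>) < 1"
    by (auto simp: eventually_sequentially)
  define u where "u n \<omega> = (X (n + k) \<omega> - Y \<omega>)\<^sup>2" for n \<omega>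
  have int: "integrable M (u n)" for n
  proof (rule integrableI_bounded)
    have "(\<integral>\<^sup>+\<omega>. ennreal (norm (u n \<omega>)) \<partial>M) < 1"
      using k[of "n + k"] by (simp add: u_def mean_square_def)
    then show "(\<integral>\<^sup>+\<omega>. ennreal (norm (u n \<omega>)) \<partial>M) < \<infinity>"
      by (rule less_trans) simp
  qed (unfold u_def, measurable)
  have "(\<lambda>n. ennreal (\<integral>\<omega>. norm (u n \<omega>) \<partial>M)) \<longlonglongrightarrow> ennreal 0"
  proof -
    have "ennreal (\<integral>\<omega>. norm (u n \<omega>) \<partial>M) = mean_square M (\<lambda>\<omega>. X (n + k) \<omega> - Y \<omega>)" for n
      unfolding mean_square_def
      by (subst nn_integral_eq_integral[symmetric]) (use int[of n] in \<open>auto simp: u_def[abs_def]\<close>)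
    then show ?thesis using LIMSEQ_ignore_initial_segment[OF lim, of k] by simp
  qed
  then have "(\<lambda>n. \<integral>\<omega>. norm (u n \<omega>) \<partial>M) \<longlonglongrightarrow> 0"
    by (subst (asm) tendsto_ennreal_iff) auto
  then obtain r where r: "strict_mono r" "AE \<omega> in M. (\<lambda>n. u (r n) \<omega>) \<longlonglongrightarrow> 0"
    using tendsto_L1_AE_subseq[of M u, OF int] by blast
  have "AE \<omega> in M. ennreal (\<bar>Y \<omega>\<bar> powr p) = liminf (\<lambda>n. ennreal (\<bar>X (r n + k) \<omega>\<bar> powr p))"
    using r(2)
  proof eventually_elim
    case (elim \<omega>)
    then have "(\<lambda>n. sqrt (u (r n) \<omega>)) \<longlonglongrightarrow> sqrt 0" by (rule tendsto_real_sqrt)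
    then have "(\<lambda>n. \<bar>X (r n + k) \<omega> - Y \<omega>\<bar>) \<longlonglongrightarrow> 0" by (simp add: u_def)
    then have "(\<lambda>n. X (r n + k) \<omega> - Y \<omega>) \<longlonglongrightarrow> 0" by (rule tendsto_rabs_zero_cancel)
    then have "(\<lambda>n. X (r n + k) \<omega>) \<longlonglongrightarrow> Y \<omega>" by (rule LIM_zero_cancel)
    then have "(\<lambda>n. \<bar>X (r n + k) \<omega>\<bar> powr p) \<longlonglongrightarrow> \<bar>Y \<omega>\<bar> powr p"
      using p by (intro tendsto_powr' tendsto_intros) auto
    then show ?case by (intro lim_imp_Liminf[symmetric] tendsto_ennrealI) auto
  qed
  then have "(\<integral>\<^sup>+\<omega>. ennreal (\<bar>Y \<omega>\<bar> powr p) \<partial>M) = (\<integral>\<^sup>+\<omega>. liminf (\<lambda>n. ennreal (\<bar>X (r n + k) \<omega>\<bar> powr p)) \<partial>M)"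
    by (rule nn_integral_cong_AE)
  also have "\<dots> \<le> liminf (\<lambda>n. \<integral>\<^sup>+\<omega>. ennreal (\<bar>X (r n + k) \<omega>\<bar> powr p) \<partial>M)"
    by (rule nn_integral_liminf) auto
  also have "\<dots> \<le> liminf (\<lambda>n. K)"
    by (intro Liminf_mono always_eventually allI le)
  finally show ?thesis by (simp add: Liminf_const)
qed

section \<open>Increments of the Wiener process and the Ito isometry\<close>

context wiener_process
begin

lemma subalgebra_filtration:
  assumes "0 \<le> s" "s \<le> t" "t \<le> T"
  shows "subalgebra (F t) (F s)"
  using subalgebra_F[of s] subalgebra_F[of t] mono_F[OF assms] assms by (auto simp: subalgebra_def)

lemma measurable_later:
  assumes "X \<in> borel_measurable (F s)" "0 \<le> s" "s \<le> t" "t \<le> T"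
  shows "X \<in> borel_measurable (F t)"
  using measurable_from_subalg[OF subalgebra_filtration[OF assms(2-)] assms(1)] .

lemma measurable_ambient:
  assumes "X \<in> borel_measurable (F s)" "0 \<le> s" "s \<le> T"
  shows "X \<in> borel_measurable M"
  using measurable_from_subalg[OF subalgebra_F assms(1)] assms by auto

lemma measurable_W:
  assumes "0 \<le> s" "s \<le> t" "t \<le> T"
  shows "W s \<in> borel_measurable (F t)"
  using measurable_later[OF adapted_W assms(1-3)] assms by auto

lemma borel_measurable_W:
  assumes "0 \<le> t" "t \<le> T"
  shows "W t \<in> borel_measurable M"
  using measurable_ambient[OF adapted_W] assms by auto

text \<open>Independence is assumed for the generating sets; both systems are stable under intersection, so it
  extends to the generated \<open>\<sigma>\<close>-algebras.\<close>

lemma indep_var_increment: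
  assumes st: "0 \<le> s" "s < t" "t \<le> T" and Z: "Z \<in> borel_measurable (F s)"
  shows "indep_var borel Z borel (\<lambda>\<omega>. W t \<omega> - W s \<omega>)"
proof -
  let ?D = "\<lambda>\<omega>. W t \<omega> - W s \<omega>"
  let ?E = "{?D -` B \<inter> space M |B. B \<in> sets borel}"
  have space: "space (F s) = space M"
    using subalgebra_F[of s] st by (auto simp: subalgebra_def)
  have "Int_stable ?E"
  proof (rule Int_stableI)
    fix A B assume "A \<in> ?E" "B \<in> ?E"
    then obtain A' B' where "A = ?D -` A' \<inter> space M" "B = ?D -` B' \<inter> space M"
      "A' \<in> sets borel" "B' \<in> sets borel" by auto
    then show "A \<inter> B \<in> ?E" by (auto intro!: exI[of _ "A' \<inter> B'"])
  qed
  then have indep: "indep_set (sigma_sets (space M) (sets (F s))) (sigma_sets (space M) ?E)"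
    using indep_increments_W[OF st] sets.Int_stable by (intro indep_set_sigma_sets)
  have "sigma_sets (space M) {Z -` A \<inter> space M |A. A \<in> sets borel} \<subseteq> sigma_sets (space M) (sets (F s))"
    using measurable_sets[OF Z] space by (intro sigma_sets_mono') auto
  with indep have "indep_set (sigma_sets (space M) {Z -` A \<inter> space M |A. A \<in> sets borel}) (sigma_sets (space M) ?E)"
    unfolding indep_sets2_eq by blast
  moreover have "Z \<in> borel_measurable M" "?D \<in> borel_measurable M"
    using st by (auto intro!: measurable_ambient[OF Z] borel_measurable_diff borel_measurable_W)
  ultimately show ?thesis by (simp add: indep_var_eq)
qed

lemma
  assumes st: "0 \<le> s" "s \<le> t" "t \<le> T"
  shows integrable_increment: "integrable M (\<lambda>\<omega>. W t \<omega> - W s \<omega>)"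
    and expectation_increment: "expectation (\<lambda>\<omega>. W t \<omega> - W s \<omega>) = 0"
    and integrable_increment_squared: "integrable M (\<lambda>\<omega>. (W t \<omega> - W s \<omega>)\<^sup>2)"
    and expectation_increment_squared: "expectation (\<lambda>\<omega>. (W t \<omega> - W s \<omega>)\<^sup>2) = t - s"
proof -
  let ?D = "\<lambda>\<omega>. W t \<omega> - W s \<omega>" and ?\<sigma> = "sqrt (t - s)"
  have "integrable M ?D \<and> expectation ?D = 0 \<and> integrable M (\<lambda>\<omega>. (?D \<omega>)\<^sup>2) \<and> expectation (\<lambda>\<omega>. (?D \<omega>)\<^sup>2) = t - s"
  proof (cases "s = t")
    case False
    with st have lt: "s < t" "0 < ?\<sigma>" by auto
    note D = normal_increments_W[OF st(1) lt(1) st(3)]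
    have mean: "expectation ?D = 0" using normal_distributed_expectation[OF lt(2) D] .
    have var: "expectation (\<lambda>\<omega>. (?D \<omega>)\<^sup>2) = t - s"
      using normal_distributed_variance[OF lt(2) D] mean lt by simp
    have "integrable M ?D" "integrable M (\<lambda>\<omega>. (?D \<omega>)\<^sup>2)"
      using distributed_integrable[OF D, of "\<lambda>x. x"] distributed_integrable[OF D, of "\<lambda>x. x\<^sup>2"]
        integrable_normal_moment[OF lt(2), of 0 1] integrable_normal_moment[OF lt(2), of 0 2] by auto
    with mean var show ?thesis by blast
  qed auto
  then show "integrable M ?D" "expectation ?D = 0" "integrable M (\<lambda>\<omega>. (?D \<omega>)\<^sup>2)"
    "expectation (\<lambda>\<omega>. (?D \<omega>)\<^sup>2) = t - s" by auto
qed

lemma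
  assumes st: "0 \<le> s" "s \<le> t" "t \<le> T" and Z: "Z \<in> borel_measurable (F s)" "integrable M Z"
  shows integrable_mult_increment: "integrable M (\<lambda>\<omega>. Z \<omega> * (W t \<omega> - W s \<omega>))"
    and expectation_mult_increment: "expectation (\<lambda>\<omega>. Z \<omega> * (W t \<omega> - W s \<omega>)) = 0"
    and integrable_mult_increment_squared: "integrable M (\<lambda>\<omega>. Z \<omega> * (W t \<omega> - W s \<omega>)\<^sup>2)"
    and expectation_mult_increment_squared:
      "expectation (\<lambda>\<omega>. Z \<omega> * (W t \<omega> - W s \<omega>)\<^sup>2) = expectation Z * (t - s)"
proof -
  let ?D = "\<lambda>\<omega>. W t \<omega> - W s \<omega>"
  have "integrable M (\<lambda>\<omega>. Z \<omega> * ?D \<omega>) \<and> expectation (\<lambda>\<omega>. Z \<omega> * ?D \<omega>) = 0 \<and>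
    integrable M (\<lambda>\<omega>. Z \<omega> * (?D \<omega>)\<^sup>2) \<and> expectation (\<lambda>\<omega>. Z \<omega> * (?D \<omega>)\<^sup>2) = expectation Z * (t - s)"
  proof (cases "s = t")
    case False
    with st have "s < t" by auto
    note indep = indep_var_increment[OF st(1) this st(3) Z(1)]
    from indep_var_compose[OF this, of "\<lambda>x. x" borel "\<lambda>x. x\<^sup>2" borel]
    have indep2: "indep_var borel Z borel (\<lambda>\<omega>. (?D \<omega>)\<^sup>2)" by (simp add: o_def)
    show ?thesis
      using indep_var_integrable[OF indep Z(2) integrable_increment[OF st]]
        indep_var_lebesgue_integral[OF indep Z(2) integrable_increment[OF st]]
        indep_var_integrable[OF indep2 Z(2) integrable_increment_squared[OF st]]
        indep_var_lebesgue_integral[OF indep2 Z(2) integrable_increment_squared[OF st]]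
        expectation_increment[OF st] expectation_increment_squared[OF st] by simp
  qed auto
  then show "integrable M (\<lambda>\<omega>. Z \<omega> * ?D \<omega>)" "expectation (\<lambda>\<omega>. Z \<omega> * ?D \<omega>) = 0"
    "integrable M (\<lambda>\<omega>. Z \<omega> * (?D \<omega>)\<^sup>2)" "expectation (\<lambda>\<omega>. Z \<omega> * (?D \<omega>)\<^sup>2) = expectation Z * (t - s)" by auto
qed

text \<open>\<open>Z\<close> stands for the product of the two bounded coefficients of a pair of elementary integrands
  that start at \<open>r\<close> and \<open>r'\<close>. Splitting both increments at the end points of the overlap leaves one
  square; every other product has a factor that is centred and independent of the rest.\<close>

lemma increments_covariance:
  assumes r: "0 \<le> r" "r \<le> r'" "r \<le> s" "s \<le> T" "r' \<le> s'" "s' \<le> T"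
    and Z: "Z \<in> borel_measurable (F r')" "\<And>\<omega>. \<omega> \<in> space M \<Longrightarrow> \<bar>Z \<omega>\<bar> \<le> B"
  shows "has_bochner_integral M (\<lambda>\<omega>. Z \<omega> * ((W s \<omega> - W r \<omega>) * (W s' \<omega> - W r' \<omega>)))
    (expectation Z * max 0 (min s s' - max r r'))"
proof -
  have ZM: "Z \<in> borel_measurable M"
    using r by (intro measurable_ambient[OF Z(1)]) auto
  have intZ: "integrable M Z"
    using Z(2) ZM by (intro integrable_const_bound[where B = B]) auto
  have int_Z_increment: "integrable M (\<lambda>\<omega>. Z \<omega> * (W t \<omega> - W u \<omega>))" if "0 \<le> u" "u \<le> t" "t \<le> T" for t u
  proof (rule Bochner_Integration.integrable_bound)
    show "integrable M (\<lambda>\<omega>. B * (W t \<omega> - W u \<omega>))" using integrable_increment that by auto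
    show "AE \<omega> in M. norm (Z \<omega> * (W t \<omega> - W u \<omega>)) \<le> norm (B * (W t \<omega> - W u \<omega>))"
      using Z(2) by (auto simp: abs_mult intro!: mult_right_mono order_trans[OF Z(2)])
    show "(\<lambda>\<omega>. Z \<omega> * (W t \<omega> - W u \<omega>)) \<in> borel_measurable M"
      using that ZM by (auto intro!: borel_measurable_times borel_measurable_diff borel_measurable_W)
  qed
  show ?thesis
  proof (cases "s \<le> r'")
    case True
    define Y where "Y \<omega> = Z \<omega> * (W s \<omega> - W r \<omega>)" for \<omega>
    have Y: "Y \<in> borel_measurable (F r')" "integrable M Y"
      unfolding Y_def using r True Z
      by (auto intro!: borel_measurable_times borel_measurable_diff measurable_W int_Z_increment)
    have r': "0 \<le> r'" using r by auto
    have "(\<lambda>\<omega>. Z \<omega> * ((W s \<omega> - W r \<omega>) * (W s' \<omega> - W r' \<omega>))) = (\<lambda>\<omega>. Y \<omega> * (W s' \<omega> - W r' \<omega>))"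
      by (auto simp: Y_def algebra_simps)
    moreover have "max 0 (min s s' - max r r') = 0" using True r by auto
    ultimately show ?thesis
      using integrable_mult_increment[OF r' r(5,6) Y] expectation_mult_increment[OF r' r(5,6) Y]
      by (auto simp: has_bochner_integral_iff)
  next
    case False
    define u v where "u = min s s'" and "v = max s s'"
    have uv: "r' \<le> u" "u \<le> v" "v \<le> T" "0 \<le> r'" "0 \<le> u" "u \<le> T" using r False by (auto simp: u_def v_def)
    define Y1 Y2 where "Y1 \<omega> = Z \<omega> * (W r' \<omega> - W r \<omega>)" and "Y2 \<omega> = Z \<omega> * (W u \<omega> - W r' \<omega>)" for \<omega>
    have Y1: "Y1 \<in> borel_measurable (F r')" "integrable M Y1"
      unfolding Y1_def using r uv Z
      by (auto intro!: borel_measurable_times borel_measurable_diff measurable_W int_Z_increment)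
    have Y2: "Y2 \<in> borel_measurable (F u)" "integrable M Y2"
      unfolding Y2_def using r uv measurable_later[OF Z(1) uv(4,1,6)]
      by (auto intro!: borel_measurable_times borel_measurable_diff measurable_W int_Z_increment)
    have split: "(\<lambda>\<omega>. Z \<omega> * ((W s \<omega> - W r \<omega>) * (W s' \<omega> - W r' \<omega>))) =
      (\<lambda>\<omega>. Y1 \<omega> * (W s' \<omega> - W r' \<omega>) + (Y2 \<omega> * (W v \<omega> - W u \<omega>) + Z \<omega> * (W u \<omega> - W r' \<omega>)\<^sup>2))"
    proof
      fix \<omega>
      have "(W s \<omega> - W r' \<omega>) * (W s' \<omega> - W r' \<omega>) = (W u \<omega> - W r' \<omega>) * (W v \<omega> - W r' \<omega>)"
        by (cases "s \<le> s'") (auto simp: u_def v_def)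
      then have "Z \<omega> * ((W s \<omega> - W r' \<omega>) * (W s' \<omega> - W r' \<omega>)) =
          Z \<omega> * ((W u \<omega> - W r' \<omega>) * (W v \<omega> - W r' \<omega>))"
        by (simp only:)
      then have "Z \<omega> * ((W s \<omega> - W r' \<omega>) * (W s' \<omega> - W r' \<omega>)) =
          Y2 \<omega> * (W v \<omega> - W u \<omega>) + Z \<omega> * (W u \<omega> - W r' \<omega>)\<^sup>2"
        unfolding Y2_def by (simp only:) (simp add: power2_eq_square algebra_simps)
      moreover have "Z \<omega> * ((W s \<omega> - W r \<omega>) * (W s' \<omega> - W r' \<omega>)) =
          Y1 \<omega> * (W s' \<omega> - W r' \<omega>) + Z \<omega> * ((W s \<omega> - W r' \<omega>) * (W s' \<omega> - W r' \<omega>))"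
        by (simp add: Y1_def algebra_simps)
      ultimately show "Z \<omega> * ((W s \<omega> - W r \<omega>) * (W s' \<omega> - W r' \<omega>)) =
          Y1 \<omega> * (W s' \<omega> - W r' \<omega>) + (Y2 \<omega> * (W v \<omega> - W u \<omega>) + Z \<omega> * (W u \<omega> - W r' \<omega>)\<^sup>2)" by simp
    qed
    have "max 0 (min s s' - max r r') = u - r'" using False r by (auto simp: u_def)
    moreover have "has_bochner_integral M
      (\<lambda>\<omega>. Y1 \<omega> * (W s' \<omega> - W r' \<omega>) + (Y2 \<omega> * (W v \<omega> - W u \<omega>) + Z \<omega> * (W u \<omega> - W r' \<omega>)\<^sup>2))
      (0 + (0 + expectation Z * (u - r')))"
      using integrable_mult_increment[OF uv(4) r(5,6) Y1] expectation_mult_increment[OF uv(4) r(5,6) Y1]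
        integrable_mult_increment[OF uv(5,2,3) Y2] expectation_mult_increment[OF uv(5,2,3) Y2]
        integrable_mult_increment_squared[OF uv(4,1,6) Z(1) intZ]
        expectation_mult_increment_squared[OF uv(4,1,6) Z(1) intZ]
      by (intro has_bochner_integral_add) (auto simp: has_bochner_integral_iff)
    ultimately show ?thesis by (simp only: split) simp
  qed
qed

end

text \<open>The length of the overlap is also the factor in the covariance of two increments. This is why
  the isometry can be checked pair by pair, even though the intervals of an elementary process may
  overlap.\<close>

lemma integral_indicator_overlap:
  fixes r s r' s' a b :: real
  assumes "a \<le> r" "r \<le> s" "s \<le> b" "r' \<le> s'"
  shows "has_bochner_integral lborel (\<lambda>t. indicator {r<..s} t * indicator {r'<..s'} t * indicator {a..b} t :: real)
    (max 0 (min s s' - max r r'))"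
proof -
  have "(\<lambda>t. indicator {r<..s} t * indicator {r'<..s'} t * indicator {a..b} t :: real) =
      indicator {max r r'<..min s s'}"
    using assms by (auto simp: indicator_def fun_eq_iff)
  moreover have "measure lborel {max r r'<..min s s'} = max 0 (min s s' - max r r')"
    by (cases "max r r' \<le> min s s'") (auto simp: max_def)
  moreover have "has_bochner_integral lborel (indicator {max r r'<..min s s'}) (measure lborel {max r r'<..min s s'})"
  proof (rule has_bochner_integral_real_indicator)
    have "bounded {max r r'<..min s s'}"
      by (rule bounded_subset[OF bounded_closed_interval[of "max r r'" "min s s'"]]) auto
    then show "emeasure lborel {max r r'<..min s s'} < \<infinity>" by (rule emeasure_bounded_finite)
  qed auto
  ultimately show ?thesis by simp
qed

definition process_square :: "'a measure \<Rightarrow> real \<Rightarrow> real \<Rightarrow> (real \<Rightarrow> 'a \<Rightarrow> real) \<Rightarrow> ennreal" where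
  "process_square M a b X = (\<integral>\<^sup>+\<omega>. (\<integral>\<^sup>+t\<in>{a..b}. ennreal ((X t \<omega>)\<^sup>2) \<partial>lborel) \<partial>M)"

text \<open>Both sides expand to the same double sum over the entries of the list: the covariances of the
  increments on the left, the overlaps of the intervals on the right.\<close>

theorem (in wiener_process) ito_isometry:
  assumes H: "elementary M F a b H" and ab: "0 \<le> a" "b \<le> T"
  shows "mean_square M (elementary_integral W H) = process_square M a b (elementary_process H)"
proof -
  define n r s x where "n = length H" and "r i = fst (H ! i)" and "s i = fst (snd (H ! i))"
    and "x i = snd (snd (H ! i))" for i
  have H_eq: "H = map (\<lambda>i. (r i, s i, x i)) [0..<n]"
    by (intro nth_equalityI) (auto simp: n_def r_def s_def x_def)
  have H_i: "a \<le> r i \<and> r i \<le> s i \<and> s i \<le> b \<and> x i \<in> borel_measurable (F (r i)) \<and> bounded (x i ` space M)"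
    if "i < n" for i
  proof -
    have "(r i, s i, x i) \<in> set H" using that nth_mem[of i H] by (simp add: n_def r_def s_def x_def)
    with H show ?thesis unfolding elementary_def by blast
  qed
  have rs: "a \<le> r i" "r i \<le> s i" "s i \<le> b" "0 \<le> r i" "s i \<le> T" and x: "x i \<in> borel_measurable (F (r i))"
    and bdd: "bounded (x i ` space M)" if "i < n" for i
    using H_i[OF that] ab by (simp_all only: order_trans[OF ab(1)] order_trans[OF _ ab(2)])
  have int_eq: "elementary_integral W H \<omega> = (\<Sum>i<n. x i \<omega> * (W (s i) \<omega> - W (r i) \<omega>))" for \<omega>
    unfolding elementary_integral_def
    by (subst H_eq) (simp add: comp_def interv_sum_list_conv_sum_set_nat atLeast0LessThan)
  have proc_eq: "elementary_process H t \<omega> = (\<Sum>i<n. x i \<omega> * indicator {r i<..s i} t)" for t \<omega>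
    unfolding elementary_process_def
    by (subst H_eq) (simp add: comp_def interv_sum_list_conv_sum_set_nat atLeast0LessThan)
  define c where "c i j = max 0 (min (s i) (s j) - max (r i) (r j))" for i j
  have xM: "x i \<in> borel_measurable M" if "i < n" for i
    using that rs[OF that] by (intro measurable_ambient[OF x]) auto
  have "\<exists>B. \<forall>\<omega>\<in>space M. \<bar>x i \<omega>\<bar> \<le> B" if "i < n" for i
    using bdd[OF that] by (auto simp: bounded_iff)
  then obtain B where B: "\<And>i \<omega>. i < n \<Longrightarrow> \<omega> \<in> space M \<Longrightarrow> \<bar>x i \<omega>\<bar> \<le> B i" by metis
  have B_prod: "\<bar>x i \<omega> * x j \<omega>\<bar> \<le> B i * B j" if "i < n" "j < n" "\<omega> \<in> space M" for i j \<omega>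
    unfolding abs_mult using that by (intro mult_mono B order_trans[OF _ B[of i \<omega>]]) auto
  have int_x: "integrable M (\<lambda>\<omega>. x i \<omega> * x j \<omega>)" if "i < n" "j < n" for i j
    using that B_prod xM by (intro integrable_const_bound[where B = "B i * B j"]) auto
  have cov: "has_bochner_integral M
      (\<lambda>\<omega>. (x i \<omega> * (W (s i) \<omega> - W (r i) \<omega>)) * (x j \<omega> * (W (s j) \<omega> - W (r j) \<omega>)))
      (expectation (\<lambda>\<omega>. x i \<omega> * x j \<omega>) * c i j)" if ij: "i < n" "j < n" for i j
  proof -
    have *: "has_bochner_integral M
      (\<lambda>\<omega>. (x i \<omega> * (W (s i) \<omega> - W (r i) \<omega>)) * (x j \<omega> * (W (s j) \<omega> - W (r j) \<omega>)))
      (expectation (\<lambda>\<omega>. x i \<omega> * x j \<omega>) * c i j)" if ij: "i < n" "j < n" "r i \<le> r j" for i j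
    proof -
      have "x i \<in> borel_measurable (F (r j))"
        using rs[OF ij(1)] rs[OF ij(2)] ij by (intro measurable_later[OF x]) auto
      then have "(\<lambda>\<omega>. x i \<omega> * x j \<omega>) \<in> borel_measurable (F (r j))"
        using x ij by auto
      from increments_covariance[of "r i" "r j" "s i" "s j", OF _ ij(3) _ _ _ _ this B_prod]
      show ?thesis
        using rs[OF ij(1)] rs[OF ij(2)] ij by (simp add: c_def mult_ac)
    qed
    show ?thesis
    proof (cases "r i \<le> r j")
      case False
      then show ?thesis
        using *[of j i] ij by (simp add: c_def mult_ac max.commute min.commute)
    qed (use * ij in auto)
  qed
  define v where "v = (\<Sum>i<n. \<Sum>j<n. expectation (\<lambda>\<omega>. x i \<omega> * x j \<omega>) * c i j)"
  have "has_bochner_integral M (\<lambda>\<omega>. \<Sum>i<n. \<Sum>j<n.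
      (x i \<omega> * (W (s i) \<omega> - W (r i) \<omega>)) * (x j \<omega> * (W (s j) \<omega> - W (r j) \<omega>))) v"
    unfolding v_def by (intro has_bochner_integral_sum cov) auto
  then have "has_bochner_integral M (\<lambda>\<omega>. (elementary_integral W H \<omega>)\<^sup>2) v"
    by (simp add: int_eq power2_eq_square sum_product)
  then have lhs: "mean_square M (elementary_integral W H) = ennreal v"
    unfolding mean_square_def by (subst nn_integral_eq_integral) (auto simp: has_bochner_integral_iff)
  define q where "q \<omega> = (\<Sum>i<n. \<Sum>j<n. x i \<omega> * x j \<omega> * c i j)" for \<omega>
  have inner: "(\<integral>\<^sup>+t\<in>{a..b}. ennreal ((elementary_process H t \<omega>)\<^sup>2) \<partial>lborel) = ennreal (q \<omega>)"
    and q_nonneg: "0 \<le> q \<omega>" for \<omega>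
  proof -
    have "has_bochner_integral lborel (\<lambda>t. \<Sum>i<n. \<Sum>j<n. x i \<omega> * x j \<omega> *
        (indicator {r i<..s i} t * indicator {r j<..s j} t * indicator {a..b} t)) (q \<omega>)"
      unfolding q_def c_def
      by (intro has_bochner_integral_sum has_bochner_integral_mult_right integral_indicator_overlap)
        (use rs in auto)
    moreover have "(\<Sum>i<n. \<Sum>j<n. x i \<omega> * x j \<omega> *
        (indicator {r i<..s i} t * indicator {r j<..s j} t * indicator {a..b} t)) =
        (elementary_process H t \<omega>)\<^sup>2 * indicator {a..b} t" for t
      unfolding proc_eq power2_eq_square
      unfolding sum_product
      unfolding sum_distrib_right
      by (intro sum.cong refl) (simp only: mult_ac)
    ultimately have *: "has_bochner_integral lborel (\<lambda>t. (elementary_process H t \<omega>)\<^sup>2 * indicator {a..b} t) (q \<omega>)"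
      by simp
    have "(\<integral>\<^sup>+t\<in>{a..b}. ennreal ((elementary_process H t \<omega>)\<^sup>2) \<partial>lborel) =
        (\<integral>\<^sup>+t. ennreal ((elementary_process H t \<omega>)\<^sup>2 * indicator {a..b} t) \<partial>lborel)"
      by (intro nn_integral_cong) (simp add: indicator_def)
    also have "\<dots> = ennreal (q \<omega>)"
      using * by (subst nn_integral_eq_integral) (auto simp: has_bochner_integral_iff)
    finally show "(\<integral>\<^sup>+t\<in>{a..b}. ennreal ((elementary_process H t \<omega>)\<^sup>2) \<partial>lborel) = ennreal (q \<omega>)" .
    show "0 \<le> q \<omega>"
      unfolding has_bochner_integral_integral_eq[OF *, symmetric]
      by (rule Bochner_Integration.integral_nonneg) auto
  qed
  have "has_bochner_integral M q v"
    unfolding q_def v_def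
    by (intro has_bochner_integral_sum has_bochner_integral_mult_left)
      (use int_x in \<open>auto simp: has_bochner_integral_iff\<close>)
  then have "(\<integral>\<^sup>+\<omega>. ennreal (q \<omega>) \<partial>M) = ennreal v"
    using q_nonneg by (subst nn_integral_eq_integral) (auto simp: has_bochner_integral_iff)
  then show ?thesis by (simp add: lhs inner process_square_def)
qed

section \<open>Ito integrals of continuous functions as limits of Riemann sums\<close>

text \<open>Seen on the product of \<open>M\<close> with the time interval, this is an ordinary mean square, so the triangle
  inequality carries over.\<close>

lemma process_square_eq_mean_square:
  fixes M :: "'a measure"
  assumes "(\<lambda>(\<omega>, t). X t \<omega>) \<in> borel_measurable (M \<Otimes>\<^sub>M restrict_space lborel {a..b})"
  shows "process_square M a b X = mean_square (M \<Otimes>\<^sub>M restrict_space lborel {a..b}) (\<lambda>(\<omega>, t). X t \<omega>)"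
proof -
  let ?L = "restrict_space lborel {a..b} :: real measure"
  interpret L: finite_measure ?L
    by (rule finite_measureI)
      (simp add: emeasure_restrict_space space_restrict_space emeasure_lborel_Icc_eq)
  have "process_square M a b X = (\<integral>\<^sup>+\<omega>. \<integral>\<^sup>+t. ennreal ((X t \<omega>)\<^sup>2) \<partial>?L \<partial>M)"
    unfolding process_square_def by (simp add: nn_integral_restrict_space)
  also have "\<dots> = (\<integral>\<^sup>+z. ennreal (((\<lambda>(\<omega>, t). X t \<omega>) z)\<^sup>2) \<partial>(M \<Otimes>\<^sub>M ?L))"
    using L.nn_integral_fst[of "\<lambda>z. ennreal (((\<lambda>(\<omega>, t). X t \<omega>) z)\<^sup>2)" M] assms by simp
  finally show ?thesis by (simp add: mean_square_def)
qed

lemma process_square_triangle_le: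
  assumes "(\<lambda>(\<omega>, t). X t \<omega>) \<in> borel_measurable (M \<Otimes>\<^sub>M restrict_space lborel {a..b})"
    and "(\<lambda>(\<omega>, t). Y t \<omega>) \<in> borel_measurable (M \<Otimes>\<^sub>M restrict_space lborel {a..b})"
    and "(\<lambda>(\<omega>, t). Z t \<omega>) \<in> borel_measurable (M \<Otimes>\<^sub>M restrict_space lborel {a..b})"
  shows "process_square M a b (\<lambda>t \<omega>. X t \<omega> - Y t \<omega>) \<le>
    2 * process_square M a b (\<lambda>t \<omega>. X t \<omega> - Z t \<omega>) + 2 * process_square M a b (\<lambda>t \<omega>. Y t \<omega> - Z t \<omega>)"
proof -
  let ?N = "M \<Otimes>\<^sub>M restrict_space lborel {a..b}"
  have eq: "process_square M a b (\<lambda>t \<omega>. U t \<omega> - V t \<omega>) =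
      mean_square ?N (\<lambda>z. (\<lambda>(\<omega>, t). U t \<omega>) z - (\<lambda>(\<omega>, t). V t \<omega>) z)"
    if "(\<lambda>(\<omega>, t). U t \<omega>) \<in> borel_measurable ?N" "(\<lambda>(\<omega>, t). V t \<omega>) \<in> borel_measurable ?N" for U V
    using borel_measurable_diff[OF that]
    by (subst process_square_eq_mean_square) (simp_all add: case_prod_unfold)
  show ?thesis
    unfolding eq[OF assms(1,2)] eq[OF assms(1,3)] eq[OF assms(2,3)]
    using mean_square_triangle_le[OF assms(1,3,2)]
    by (simp only: mean_square_diff_commute[of _ "\<lambda>(\<omega>, t). Z t \<omega>"])
qed

definition node :: "real \<Rightarrow> real \<Rightarrow> nat \<Rightarrow> nat \<Rightarrow> real" where
  "node a b m i = a + real i * (b - a) / real m"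

definition riemann_integrand :: "(real \<Rightarrow> real) \<Rightarrow> real \<Rightarrow> real \<Rightarrow> nat \<Rightarrow> 'a elementary" where
  "riemann_integrand f a b m = map (\<lambda>i. (node a b m i, node a b m (Suc i), \<lambda>_. f (node a b m i))) [0..<m]"

definition riemann_sum :: "(real \<Rightarrow> 'a \<Rightarrow> real) \<Rightarrow> (real \<Rightarrow> real) \<Rightarrow> real \<Rightarrow> real \<Rightarrow> nat \<Rightarrow> 'a \<Rightarrow> real" where
  "riemann_sum W f a b m \<omega> =
     (\<Sum>i<m. f (node a b m i) * (W (node a b m (Suc i)) \<omega> - W (node a b m i) \<omega>))"

lemma node_mono: "a \<le> b \<Longrightarrow> i \<le> j \<Longrightarrow> node a b m i \<le> node a b m j"
  by (auto simp: node_def intro!: divide_right_mono mult_right_mono)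

lemma node_0 [simp]: "node a b m 0 = a"
  by (simp add: node_def)

lemma node_last [simp]: "0 < m \<Longrightarrow> node a b m m = b"
  by (simp add: node_def)

lemma node_bounds:
  assumes "a \<le> b" "i \<le> m"
  shows "a \<le> node a b m i" "node a b m i \<le> b"
proof -
  show "a \<le> node a b m i" using node_mono[OF assms(1), of 0 i m] by simp
  show "node a b m i \<le> b"
  proof (cases "m = 0")
    case False
    then show ?thesis using node_mono[OF assms, of m] by simp
  qed (use assms in simp)
qed

lemma node_Suc: "node a b m (Suc i) = node a b m i + (b - a) / real m"
  by (simp add: node_def distrib_right add_divide_distrib)

lemma elementary_riemann_integrand:
  assumes "a \<le> b"
  shows "elementary M F a b (riemann_integrand f a b m)"
  using assms by (auto simp: elementary_def riemann_integrand_def node_mono node_bounds image_constant_conv)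

lemma elementary_integral_riemann_integrand:
  "elementary_integral W (riemann_integrand f a b m) = riemann_sum W f a b m"
  by (auto simp: elementary_integral_def riemann_integrand_def riemann_sum_def fun_eq_iff
      interv_sum_list_conv_sum_set_nat atLeast0LessThan comp_def)

lemma riemann_integrand_near:
  assumes ab: "a < b" and f: "continuous_on {a..b} f" and e: "0 < e"
  obtains k where "\<And>m t \<omega>. k \<le> m \<Longrightarrow> t \<in> {a<..b} \<Longrightarrow>
    \<bar>elementary_process (riemann_integrand f a b m) t \<omega> - f t\<bar> \<le> e"
proof -
  have "uniformly_continuous_on {a..b} f"
    using f by (rule compact_uniformly_continuous) simp
  then obtain d where d: "0 < d" "\<And>x y. x \<in> {a..b} \<Longrightarrow> y \<in> {a..b} \<Longrightarrow> dist y x < d \<Longrightarrow> dist (f y) (f x) < e"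
    using e unfolding uniformly_continuous_on_def by metis
  obtain k where k: "(b - a) / d < real k" using reals_Archimedean2 by blast
  have "\<bar>elementary_process (riemann_integrand f a b m) t \<omega> - f t\<bar> \<le> e"
    if m: "k \<le> m" and t: "t \<in> {a<..b}" for m t and \<omega> :: 'a
  proof -
    have "0 < (b - a) / d" using ab d by simp
    with k m have m_pos: "0 < m" and m_gt: "(b - a) / d < real m" by auto
    \<comment> \<open>The half-open cells \<open>(node i, node (i + 1)]\<close> cover \<open>(a, b]\<close>; \<open>i\<close> is the one that contains \<open>t\<close>.\<close>
    define i where "i = (GREATEST i. i \<le> m \<and> node a b m i < t)"
    have ex: "0 \<le> m \<and> node a b m 0 < t" using t by simp
    have i: "i \<le> m" "node a b m i < t"
      using GreatestI_nat[where P = "\<lambda>i. i \<le> m \<and> node a b m i < t" and b = m, OF ex] by (auto simp: i_def)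
    have i_max: "j \<le> i" if "j \<le> m" "node a b m j < t" for j
      using Greatest_le_nat[where P = "\<lambda>i. i \<le> m \<and> node a b m i < t" and b = m and k = j] that by (auto simp: i_def)
    have "i \<noteq> m" using i t m_pos by auto
    with i have lt: "i < m" by simp
    have upper: "t \<le> node a b m (Suc i)" using i_max[of "Suc i"] lt by fastforce
    have ind: "indicator {node a b m j<..node a b m (Suc j)} t = (if j = i then 1 else 0 :: real)" if "j < m" for j
    proof (cases j i rule: linorder_cases)
      case less
      then have "node a b m (Suc j) \<le> node a b m i" using ab by (intro node_mono) auto
      with i less show ?thesis by auto
    next
      case greater
      then have "node a b m (Suc i) \<le> node a b m j" using ab by (intro node_mono) auto
      with upper greater show ?thesis by auto
    qed (use i upper in auto)
    have "elementary_process (riemann_integrand f a b m) t \<omega> =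
        (\<Sum>j<m. f (node a b m j) * indicator {node a b m j<..node a b m (Suc j)} t)"
      by (simp add: elementary_process_def riemann_integrand_def
          interv_sum_list_conv_sum_set_nat atLeast0LessThan comp_def)
    also have "\<dots> = (\<Sum>j<m. if j = i then f (node a b m j) else 0)"
      by (intro sum.cong refl) (simp add: ind)
    also have "\<dots> = f (node a b m i)" using lt by simp
    finally have proc: "elementary_process (riemann_integrand f a b m) t \<omega> = f (node a b m i)" .
    have "(b - a) / real m < d" using m_gt m_pos d by (simp add: field_simps)
    then have "dist (node a b m i) t < d"
      using i upper by (auto simp: dist_real_def node_Suc)
    moreover have "node a b m i \<in> {a..b}" "t \<in> {a..b}" using node_bounds[of a b i m] ab i t by auto
    ultimately have "dist (f (node a b m i)) (f t) < e" using d(2) by blast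
    then show ?thesis by (simp add: proc dist_real_def)
  qed
  then show ?thesis by (rule that)
qed

lemma (in prob_space) tendsto_process_square_riemann_integrand:
  assumes ab: "a < b" and f: "continuous_on {a..b} f"
  shows "(\<lambda>m. process_square M a b (\<lambda>t \<omega>. elementary_process (riemann_integrand f a b (Suc m)) t \<omega> - f t)) \<longlonglongrightarrow> 0"
proof (rule tendsto_0_ennrealI)
  fix e :: real assume "0 < e"
  define d where "d = sqrt (e / (b - a))"
  have d: "0 < d" "d\<^sup>2 * (b - a) = e" using \<open>0 < e\<close> ab by (auto simp: d_def)
  obtain k where k: "\<And>m t \<omega>. k \<le> m \<Longrightarrow> t \<in> {a<..b} \<Longrightarrow>
      \<bar>elementary_process (riemann_integrand f a b m) t (\<omega> :: 'a) - f t\<bar> \<le> d"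
    using riemann_integrand_near[OF ab f d(1)] by metis
  have "process_square M a b (\<lambda>t \<omega>. elementary_process (riemann_integrand f a b (Suc m)) t \<omega> - f t) \<le> ennreal e"
    if "k \<le> m" for m
  proof -
    have "(\<integral>\<^sup>+t\<in>{a..b}. ennreal ((elementary_process (riemann_integrand f a b (Suc m)) t \<omega> - f t)\<^sup>2) \<partial>lborel) \<le> ennreal e"
      for \<omega> :: 'a
    proof -
      have "(\<integral>\<^sup>+t\<in>{a..b}. ennreal ((elementary_process (riemann_integrand f a b (Suc m)) t \<omega> - f t)\<^sup>2) \<partial>lborel) \<le>
          (\<integral>\<^sup>+t. ennreal (d\<^sup>2) * indicator {a..b} t \<partial>lborel)"
      proof (rule nn_integral_mono_AE)
        show "AE t in lborel. ennreal ((elementary_process (riemann_integrand f a b (Suc m)) t \<omega> - f t)\<^sup>2) * indicator {a..b} t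
            \<le> ennreal (d\<^sup>2) * indicator {a..b} t"
          \<comment> \<open>At \<open>t = a\<close> the elementary process vanishes, so this point has to be left out.\<close>
          using AE_lborel_singleton[of a]
        proof eventually_elim
          case (elim t)
          show ?case
          proof (cases "t \<in> {a..b}")
            case True
            with elim have "\<bar>elementary_process (riemann_integrand f a b (Suc m)) t \<omega> - f t\<bar> \<le> d"
              using \<open>k \<le> m\<close> by (intro k) auto
            then have "(elementary_process (riemann_integrand f a b (Suc m)) t \<omega> - f t)\<^sup>2 \<le> d\<^sup>2"
              using d by (metis abs_le_square_iff abs_of_pos)
            then show ?thesis by (intro mult_right_mono ennreal_leI) auto
          qed simp
        qed
      qed
      also have "\<dots> = ennreal (d\<^sup>2) * ennreal (b - a)"
        using ab by (simp add: nn_integral_cmult_indicator)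
      also have "\<dots> = ennreal e" using ab d by (simp flip: ennreal_mult)
      finally show ?thesis .
    qed
    then have "process_square M a b (\<lambda>t \<omega>. elementary_process (riemann_integrand f a b (Suc m)) t \<omega> - f t) \<le>
        (\<integral>\<^sup>+\<omega>. ennreal e \<partial>M)"
      unfolding process_square_def by (intro nn_integral_mono) auto
    then show ?thesis by (simp add: emeasure_space_1)
  qed
  then show "\<forall>\<^sub>F m in sequentially. process_square M a b
      (\<lambda>t \<omega>. elementary_process (riemann_integrand f a b (Suc m)) t \<omega> - f t) \<le> ennreal e"
    by (auto simp: eventually_sequentially)
qed

context wiener_process
begin

lemma borel_measurable_elementary_integral:
  assumes "elementary M F a b H" "0 \<le> a" "b \<le> T"
  shows "elementary_integral W H \<in> borel_measurable M"
  using assms(1)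
proof (induction H)
  case Nil
  then show ?case by (simp add: elementary_integral_def[abs_def])
next
  case (Cons h H)
  obtain r s x where h: "h = (r, s, x)" by (metis prod_cases3)
  from Cons.prems have h': "a \<le> r" "r \<le> s" "s \<le> b" "x \<in> borel_measurable (F r)" and H: "elementary M F a b H"
    by (auto simp: elementary_def h)
  have meas: "x \<in> borel_measurable M" "W r \<in> borel_measurable M" "W s \<in> borel_measurable M"
    using h' assms(2,3) by (auto intro!: measurable_ambient[OF h'(4)] borel_measurable_W)
  have "elementary_integral W (h # H) = (\<lambda>\<omega>. x \<omega> * (W s \<omega> - W r \<omega>) + elementary_integral W H \<omega>)"
    by (simp add: elementary_integral_def h fun_eq_iff)
  with Cons.IH[OF H] meas show ?case by simp
qed

lemma borel_measurable_elementary_process: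
  assumes "elementary M F a b H" "0 \<le> a" "b \<le> T"
  shows "(\<lambda>(\<omega>, t). elementary_process H t \<omega>) \<in> borel_measurable (M \<Otimes>\<^sub>M restrict_space lborel {a..b})"
  using assms(1)
proof (induction H)
  case Nil
  then show ?case by (simp add: elementary_process_def)
next
  case (Cons h H)
  let ?N = "M \<Otimes>\<^sub>M restrict_space lborel {a..b}"
  obtain r s x where h: "h = (r, s, x)" by (metis prod_cases3)
  from Cons.prems have h': "a \<le> r" "r \<le> s" "s \<le> b" "x \<in> borel_measurable (F r)" and H: "elementary M F a b H"
    by (auto simp: elementary_def h)
  have x: "x \<in> borel_measurable M"
    using h' assms(2,3) by (auto intro!: measurable_ambient[OF h'(4)])
  have "(\<lambda>z. x (fst z)) \<in> borel_measurable ?N"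
    using x by (rule measurable_compose[OF measurable_fst])
  moreover have "(\<lambda>z. indicator {r<..s} (snd z) :: real) \<in> borel_measurable ?N"
    by (rule measurable_compose[OF measurable_snd])
      (auto intro!: measurable_restrict_space1)
  moreover have "(\<lambda>(\<omega>, t). elementary_process (h # H) t \<omega>) =
      (\<lambda>z. x (fst z) * indicator {r<..s} (snd z) + (\<lambda>(\<omega>, t). elementary_process H t \<omega>) z)"
    by (auto simp: elementary_process_def h fun_eq_iff)
  ultimately show ?case using Cons.IH[OF H] by simp
qed

text \<open>The difference is again elementary: append the entries of \<open>K\<close> with negated coefficients.\<close>

lemma mean_square_elementary_integral_diff:
  assumes H: "elementary M F a b H" and K: "elementary M F a b K" and ab: "0 \<le> a" "b \<le> T"
  shows "mean_square M (\<lambda>\<omega>. elementary_integral W H \<omega> - elementary_integral W K \<omega>) =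
    process_square M a b (\<lambda>t \<omega>. elementary_process H t \<omega> - elementary_process K t \<omega>)"
proof -
  define K' where "K' = map (\<lambda>(r, s, x). (r, s, \<lambda>\<omega>. - x \<omega>)) K"
  have "(\<Sum>x\<leftarrow>K. - f x) = - (\<Sum>x\<leftarrow>K. f x)" for f :: "real \<times> real \<times> ('a \<Rightarrow> real) \<Rightarrow> real"
    by (simp add: uminus_sum_list_map comp_def)
  note neg = this[symmetric]
  have el: "elementary M F a b (H @ K')"
    using H K by (auto simp: elementary_def K'_def)
  have "elementary_integral W (H @ K') = (\<lambda>\<omega>. elementary_integral W H \<omega> - elementary_integral W K \<omega>)"
    by (simp add: elementary_integral_def K'_def fun_eq_iff comp_def case_prod_unfold neg diff_conv_add_uminus
        del: add_uminus_conv_diff)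
  moreover have "elementary_process (H @ K') = (\<lambda>t \<omega>. elementary_process H t \<omega> - elementary_process K t \<omega>)"
    by (simp add: elementary_process_def K'_def fun_eq_iff comp_def case_prod_unfold neg diff_conv_add_uminus
        del: add_uminus_conv_diff)
  ultimately show ?thesis using ito_isometry[OF el ab] by simp
qed

text \<open>Uniform continuity makes the Riemann integrands converge in \<open>L\<^sup>2([a, b] \<times> \<Omega>)\<close>; by the isometry and
  completeness their integrals converge, which shows that an Ito integral exists. For the integral that is
  actually chosen, with approximations \<open>H\<close> of its own, the isometry applied to the difference of the
  two approximations shows that the Riemann sums have the same limit.\<close>

theorem
  assumes a: "0 \<le> a" "a < b" "b \<le> T" and f: "continuous_on {a..b} f"
  shows borel_measurable_ito_integral: "ito_integral M F W a b (\<lambda>t _. f t) \<in> borel_measurable M"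
    and riemann_sum_tendsto_ito_integral:
      "(\<lambda>m. mean_square M (\<lambda>\<omega>. riemann_sum W f a b (Suc m) \<omega> - ito_integral M F W a b (\<lambda>t _. f t) \<omega>)) \<longlonglongrightarrow> 0"
proof -
  let ?N = "M \<Otimes>\<^sub>M restrict_space lborel {a..b}"
  let ?I = "elementary_integral W"
  define D :: "nat \<Rightarrow> 'a elementary" where "D m = riemann_integrand f a b (Suc m)" for m
  have D: "elementary M F a b (D m)" for m
    unfolding D_def using a by (intro elementary_riemann_integrand) auto
  have "f \<in> borel_measurable (restrict_space lborel {a..b})"
    using borel_measurable_continuous_on_restrict[OF f]
    by (simp cong: measurable_cong_sets sets_restrict_space_cong)
  then have f_meas: "(\<lambda>(\<omega>, t). f t) \<in> borel_measurable ?N"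
    unfolding case_prod_unfold by (rule measurable_compose[OF measurable_snd])
  define P where "P H = process_square M a b (\<lambda>t \<omega>. elementary_process H t \<omega> - f t)" for H
  have PD: "(\<lambda>m. P (D m)) \<longlonglongrightarrow> 0"
    unfolding P_def D_def using a f by (intro tendsto_process_square_riemann_integrand) auto
  have IP: "mean_square M (\<lambda>\<omega>. ?I H \<omega> - ?I K \<omega>) \<le> 2 * P H + 2 * P K"
    if "elementary M F a b H" "elementary M F a b K" for H K
    unfolding P_def mean_square_elementary_integral_diff[OF that a(1,3)]
    using that a by (intro process_square_triangle_le f_meas borel_measurable_elementary_process) auto
  have I_meas: "?I H \<in> borel_measurable M" if "elementary M F a b H" for H
    using that a by (intro borel_measurable_elementary_integral) auto
  obtain Y where Y: "Y \<in> borel_measurable M" "(\<lambda>m. mean_square M (\<lambda>\<omega>. ?I (D m) \<omega> - Y \<omega>)) \<longlonglongrightarrow> 0"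
  proof (rule mean_square_complete[of "\<lambda>m. ?I (D m)"])
    fix e :: real assume "0 < e"
    then have "0 < ennreal (e / 4)" by simp
    with PD have "\<forall>\<^sub>F m in sequentially. P (D m) < ennreal (e / 4)" by (rule order_tendstoD)
    then obtain k where k: "\<And>m. k \<le> m \<Longrightarrow> P (D m) < ennreal (e / 4)" by (auto simp: eventually_sequentially)
    have "mean_square M (\<lambda>\<omega>. ?I (D m) \<omega> - ?I (D n) \<omega>) \<le> ennreal e" if "k \<le> m" "k \<le> n" for m n
    proof -
      have "mean_square M (\<lambda>\<omega>. ?I (D m) \<omega> - ?I (D n) \<omega>) \<le> 2 * ennreal (e / 4) + 2 * ennreal (e / 4)"
        using k that by (intro order_trans[OF IP[OF D D]] add_mono mult_left_mono less_imp_le) auto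
      also have "2 * ennreal (e / 4) = ennreal (e / 2)"
        using \<open>0 < e\<close> by (subst ennreal_numeral[symmetric], subst ennreal_mult[symmetric]) auto
      also have "ennreal (e / 2) + ennreal (e / 2) = ennreal e"
        using \<open>0 < e\<close> by (subst ennreal_plus[symmetric]) auto
      finally show ?thesis .
    qed
    then show "\<exists>k. \<forall>m\<ge>k. \<forall>n\<ge>k. mean_square M (\<lambda>\<omega>. ?I (D m) \<omega> - ?I (D n) \<omega>) \<le> ennreal e" by blast
  qed (use I_meas D in auto)
  have "has_ito_integral M F W a b (\<lambda>t _. f t) Y"
    unfolding has_ito_integral_def
    using D Y PD f_meas by (auto simp: P_def process_square_def mean_square_def intro!: exI[of _ D])
  then have "has_ito_integral M F W a b (\<lambda>t _. f t) (ito_integral M F W a b (\<lambda>t _. f t))"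
    unfolding ito_integral_def by (rule someI[where P = "has_ito_integral M F W a b (\<lambda>t _. f t)"])
  then obtain H where meas: "ito_integral M F W a b (\<lambda>t _. f t) \<in> borel_measurable M"
    and H: "\<And>n. elementary M F a b (H n)" "(\<lambda>n. P (H n)) \<longlonglongrightarrow> 0"
      "(\<lambda>n. mean_square M (\<lambda>\<omega>. ?I (H n) \<omega> - ito_integral M F W a b (\<lambda>t _. f t) \<omega>)) \<longlonglongrightarrow> 0"
    by (auto simp: has_ito_integral_def P_def process_square_def mean_square_def)
  show "ito_integral M F W a b (\<lambda>t _. f t) \<in> borel_measurable M" by fact
  have "(\<lambda>n. mean_square M (\<lambda>\<omega>. ?I (D n) \<omega> - ?I (H n) \<omega>)) \<longlonglongrightarrow> 0"
  proof (rule tendsto_sandwich[where f = "\<lambda>_. 0"])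
    show "(\<lambda>n. 2 * P (D n) + 2 * P (H n)) \<longlonglongrightarrow> 0"
      using tendsto_add[OF ennreal_tendsto_cmult[OF _ PD, of 2] ennreal_tendsto_cmult[OF _ H(2), of 2]] by simp
    show "\<forall>\<^sub>F n in sequentially. mean_square M (\<lambda>\<omega>. ?I (D n) \<omega> - ?I (H n) \<omega>) \<le> 2 * P (D n) + 2 * P (H n)"
      using IP[OF D H(1)] by (intro always_eventually allI)
  qed simp_all
  from tendsto_mean_square_add[OF _ _ this H(3)]
  have "(\<lambda>n. mean_square M (\<lambda>\<omega>. ?I (D n) \<omega> - ito_integral M F W a b (\<lambda>t _. f t) \<omega>)) \<longlonglongrightarrow> 0"
    using I_meas D H(1) meas by simp
  then show "(\<lambda>m. mean_square M (\<lambda>\<omega>. riemann_sum W f a b (Suc m) \<omega> - ito_integral M F W a b (\<lambda>t _. f t) \<omega>)) \<longlonglongrightarrow> 0"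
    by (simp add: D_def elementary_integral_riemann_integrand)
qed

end

section \<open>Moments of Gaussian sums\<close>

text \<open>The moment is the product of the odd numbers \<open>1, 3, \<dots>, 2 k - 1\<close>, each of which is at most \<open>x\<close>.\<close>

lemma std_normal_even_moment_le:
  assumes "2 * real k - 1 \<le> x"
  shows "fact (2 * k) / (2 ^ k * fact k) \<le> x ^ k"
  using assms
proof (induction k)
  case (Suc k)
  have "fact (2 * Suc k) / (2 ^ Suc k * fact (Suc k)) = (2 * real k + 1) * (fact (2 * k) / (2 ^ k * fact k))"
  proof -
    have cancel: "(2 * y) * z * A / (2 * P * (y * B)) = z * (A / (P * B))" if "0 < y" for y z A P B :: real
      using that by simp
    have "fact (2 * Suc k) = (2 * (real k + 1)) * (2 * real k + 1) * fact (2 * k)"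
      by (simp add: algebra_simps)
    moreover have "fact (Suc k) = (real k + 1) * fact k" by (simp add: algebra_simps)
    ultimately show ?thesis using cancel[of "real k + 1"] by (simp only: power_Suc)
  qed
  also have "\<dots> \<le> x * x ^ k"
    using Suc by (intro mult_mono Suc.IH) auto
  finally show ?case by simp
qed simp

text \<open>The even moments of a Gaussian variable are explicit; a power mean passes from the next even
  exponent \<open>2 k < p + 2\<close> to \<open>p\<close>, whence the factor \<open>p + 1\<close>.\<close>

lemma (in prob_space) normal_moment_powr_le:
  assumes p: "2 \<le> p" and v: "0 < v" and X: "distributed M lborel X (normal_density 0 (sqrt v))"
  shows "(\<integral>\<^sup>+\<omega>. ennreal (\<bar>X \<omega>\<bar> powr p) \<partial>M) \<le> ennreal (((p + 1) * v) powr (p / 2))"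
proof -
  define k where "k = nat \<lceil>p / 2\<rceil>"
  have "real k = of_int \<lceil>p / 2\<rceil>" using p by (simp add: k_def)
  with ceiling_correct[of "p / 2"] have k: "p \<le> 2 * real k" "2 * real k - 1 \<le> p + 1"
    by linarith+
  with p have k_pos: "0 < k" by (cases k) auto
  have sv: "0 < sqrt v" using v by simp
  have [measurable]: "X \<in> borel_measurable M" using distributed_measurable[OF X] by simp
  have int: "integrable M (\<lambda>\<omega>. X \<omega> ^ (2 * k))"
    using distributed_integrable[OF X, of "\<lambda>x. x ^ (2 * k)"] integrable_normal_moment[OF sv, of 0 "2 * k"] by simp
  have "expectation (\<lambda>\<omega>. X \<omega> ^ (2 * k)) = fact (2 * k) / ((2 / (sqrt v)\<^sup>2) ^ k * fact k)"
    using distributed_integral[OF X, of "\<lambda>x. x ^ (2 * k)"] integral_normal_moment_even[OF sv, of 0 k] by simp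
  also have "\<dots> = v ^ k * (fact (2 * k) / (2 ^ k * fact k))"
    using v by (simp add: power_divide)
  also have "\<dots> \<le> v ^ k * (p + 1) ^ k"
    using std_normal_even_moment_le[OF k(2)] v by (intro mult_left_mono) auto
  also have "\<dots> = ((p + 1) * v) powr real k"
    using p v by (simp add: powr_realpow power_mult_distrib)
  finally have moment: "(\<integral>\<^sup>+\<omega>. ennreal (X \<omega> ^ (2 * k)) \<partial>M) \<le> ennreal (((p + 1) * v) powr real k)"
    using int by (subst nn_integral_eq_integral) (simp_all add: ennreal_leI)
  have "(\<bar>x\<bar> powr p) powr (2 * real k / p) = x ^ (2 * k)" for x :: real
  proof (cases "x = 0")
    case False
    have "(\<bar>x\<bar> powr p) powr (2 * real k / p) = \<bar>x\<bar> powr real (2 * k)"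
      using p by (simp add: powr_powr)
    also have "\<dots> = \<bar>x\<bar> ^ (2 * k)" using False by (intro powr_realpow) auto
    finally show ?thesis by (simp add: power_even_abs)
  qed (use k_pos p in simp)
  moreover have "(((p + 1) * v) powr (p / 2)) powr (2 * real k / p) = ((p + 1) * v) powr real k"
    using p by (simp add: powr_powr)
  ultimately have "(\<integral>\<^sup>+\<omega>. ennreal ((\<bar>X \<omega>\<bar> powr p) powr (2 * real k / p)) \<partial>M)
      \<le> ennreal (1 * (((p + 1) * v) powr (p / 2)) powr (2 * real k / p))"
    using moment by simp
  then have "(\<integral>\<^sup>+\<omega>. ennreal (\<bar>X \<omega>\<bar> powr p) \<partial>M) \<le> ennreal (1 * ((p + 1) * v) powr (p / 2))"
    by (rule nn_integral_power_mean[rotated -1]) (use k k_pos p in \<open>simp_all add: emeasure_space_1\<close>)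
  then show ?thesis by simp
qed

context wiener_process
begin

text \<open>The first alternative is needed because \<open>normal_density\<close> does not cover variance \<open>0\<close>, which occurs
  when all coefficients vanish. In the induction the new increment is independent of the earlier sum.\<close>

lemma increment_sum_gaussian:
  fixes u c :: "nat \<Rightarrow> real"
  assumes "0 \<le> u 0" "\<And>i. i < n \<Longrightarrow> u i < u (Suc i)" "u n \<le> T"
  defines "R \<equiv> \<lambda>\<omega>. \<Sum>i<n. c i * (W (u (Suc i)) \<omega> - W (u i) \<omega>)"
    and "v \<equiv> \<Sum>i<n. (c i)\<^sup>2 * (u (Suc i) - u i)"
  shows "(\<forall>\<omega>. R \<omega> = 0) \<and> v = 0 \<or> 0 < v \<and> distributed M lborel R (normal_density 0 (sqrt v))"
  using assms(1-3) unfolding R_def v_def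
proof (induction n)
  case (Suc n)
  define R where "R \<omega> = (\<Sum>i<n. c i * (W (u (Suc i)) \<omega> - W (u i) \<omega>))" for \<omega>
  define v where "v = (\<Sum>i<n. (c i)\<^sup>2 * (u (Suc i) - u i))"
  define D where "D \<omega> = c n * (W (u (Suc n)) \<omega> - W (u n) \<omega>)" for \<omega>
  define \<tau> where "\<tau> = \<bar>c n\<bar> * sqrt (u (Suc n) - u n)"
  have mono: "u i \<le> u j" if "i \<le> j" "j \<le> Suc n" for i j
    using that
  proof (induction j)
    case (Suc j)
    then show ?case using Suc.prems Suc.IH \<open>\<And>i. i < Suc n \<Longrightarrow> u i < u (Suc i)\<close>[of j]
      by (cases "i = Suc j") auto
  qed simp
  have bounds: "0 \<le> u i" "u i \<le> T" if "i \<le> Suc n" for i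
    using mono[of 0 i] mono[of i "Suc n"] Suc.prems that by auto
  have lt: "u n < u (Suc n)" using Suc.prems by simp
  have IH: "(\<forall>\<omega>. R \<omega> = 0) \<and> v = 0 \<or> 0 < v \<and> distributed M lborel R (normal_density 0 (sqrt v))"
    unfolding R_def v_def using Suc.prems bounds[of n] by (intro Suc.IH) auto
  have v_nonneg: "0 \<le> v" unfolding v_def using mono by (intro sum_nonneg mult_nonneg_nonneg) auto
  have R_Suc: "(\<Sum>i<Suc n. c i * (W (u (Suc i)) \<omega> - W (u i) \<omega>)) = R \<omega> + D \<omega>" for \<omega>
    by (simp add: R_def D_def)
  have v_Suc: "(\<Sum>i<Suc n. (c i)\<^sup>2 * (u (Suc i) - u i)) = v + \<tau>\<^sup>2"
    using lt by (simp add: v_def \<tau>_def power_mult_distrib)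
  show ?case
  proof (cases "c n = 0")
    case True
    then have "\<tau> = 0" "D \<omega> = 0" for \<omega> by (auto simp: \<tau>_def D_def)
    then show ?thesis using IH unfolding R_Suc v_Suc by simp
  next
    case False
    then have \<tau>: "0 < \<tau>" using lt by (simp add: \<tau>_def)
    then have pos: "0 < v + \<tau>\<^sup>2" using v_nonneg by (simp add: add_nonneg_pos)
    have D: "distributed M lborel D (normal_density 0 \<tau>)"
      using normal_density_affine[OF normal_increments_W[OF _ lt] _ False, of 0] bounds[of n] bounds[of "Suc n"] lt
      by (simp add: D_def[abs_def] \<tau>_def)
    from IH have "distributed M lborel (\<lambda>\<omega>. R \<omega> + D \<omega>) (normal_density 0 (sqrt (v + \<tau>\<^sup>2)))"
    proof
      assume "(\<forall>\<omega>. R \<omega> = 0) \<and> v = 0"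
      then show ?thesis using D \<tau> by simp
    next
      assume R: "0 < v \<and> distributed M lborel R (normal_density 0 (sqrt v))"
      have "R \<in> borel_measurable (F (u n))"
        unfolding R_def using bounds mono
        by (intro borel_measurable_sum borel_measurable_times borel_measurable_diff measurable_W) auto
      from indep_var_increment[OF _ lt _ this]
      have "indep_var borel R borel (\<lambda>\<omega>. W (u (Suc n)) \<omega> - W (u n) \<omega>)" using bounds by auto
      from indep_var_compose[OF this, of "\<lambda>x. x" borel "\<lambda>x. c n * x" borel]
      have "indep_var borel R borel D" by (simp add: D_def[abs_def] o_def)
      from add_indep_normal[OF this _ \<tau> _ D, of "sqrt v" 0] R
      show ?thesis by simp
    qed
    with pos show ?thesis unfolding R_Suc v_Suc by blast
  qed
qed simp

lemma increment_sum_moment_le: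
  fixes u c :: "nat \<Rightarrow> real"
  assumes p: "2 \<le> p" and u: "0 \<le> u 0" "\<And>i. i < n \<Longrightarrow> u i < u (Suc i)" "u n \<le> T"
    and V: "(\<Sum>i<n. (c i)\<^sup>2 * (u (Suc i) - u i)) \<le> V"
  shows "(\<integral>\<^sup>+\<omega>. ennreal (\<bar>\<Sum>i<n. c i * (W (u (Suc i)) \<omega> - W (u i) \<omega>)\<bar> powr p) \<partial>M) \<le>
    ennreal (((p + 1) * V) powr (p / 2))"
  using increment_sum_gaussian[of u n c, OF u]
proof
  assume "(\<forall>\<omega>. (\<Sum>i<n. c i * (W (u (Suc i)) \<omega> - W (u i) \<omega>)) = 0) \<and> (\<Sum>i<n. (c i)\<^sup>2 * (u (Suc i) - u i)) = 0"
  then show ?thesis using p by simp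
next
  assume *: "0 < (\<Sum>i<n. (c i)\<^sup>2 * (u (Suc i) - u i)) \<and>
    distributed M lborel (\<lambda>\<omega>. \<Sum>i<n. c i * (W (u (Suc i)) \<omega> - W (u i) \<omega>))
      (normal_density 0 (sqrt (\<Sum>i<n. (c i)\<^sup>2 * (u (Suc i) - u i))))"
  then have "(\<integral>\<^sup>+\<omega>. ennreal (\<bar>\<Sum>i<n. c i * (W (u (Suc i)) \<omega> - W (u i) \<omega>)\<bar> powr p) \<partial>M) \<le>
      ennreal (((p + 1) * (\<Sum>i<n. (c i)\<^sup>2 * (u (Suc i) - u i))) powr (p / 2))"
    using p by (intro normal_moment_powr_le) auto
  also have "\<dots> \<le> ennreal (((p + 1) * V) powr (p / 2))"
    using p V * by (intro ennreal_leI powr_mono2 mult_left_mono) auto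
  finally show ?thesis .
qed

end

section \<open>Smooth steps with compactly supported derivative\<close>

text \<open>Smoothness of concrete functions is obtained by exhibiting a class of functions that is closed under
  differentiation.\<close>

lemma iterated_deriv_differentiable_in_class:
  fixes f :: "real \<Rightarrow> real"
  assumes "f \<in> \<C>" and closed: "\<And>f. f \<in> \<C> \<Longrightarrow> \<exists>f'\<in>\<C>. \<forall>x. (f has_real_derivative f' x) (at x)"
  shows "(deriv ^^ k) f field_differentiable at x"
proof -
  have "(deriv ^^ k) f \<in> \<C>"
  proof (induction k)
    case (Suc k)
    from closed[OF this] obtain f' where f': "f' \<in> \<C>" "\<And>x. ((deriv ^^ k) f has_real_derivative f' x) (at x)"
      by blast
    then have "deriv ((deriv ^^ k) f) = f'" by (auto simp: fun_eq_iff intro: DERIV_imp_deriv)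
    with f'(1) show ?case by simp
  qed (use assms(1) in simp)
  from closed[OF this] show ?thesis by (auto simp: field_differentiable_def)
qed

text \<open>For \<open>q = 1\<close> this is the smooth function \<open>exp (- 1 / x)\<close> that is flat at \<open>0\<close>. The polynomial factor makes
  the family closed under differentiation.\<close>

definition flat :: "real poly \<Rightarrow> real \<Rightarrow> real" where
  "flat q x = (if 0 < x then poly q (1 / x) * exp (- (1 / x)) else 0)"

lemma flat_tendsto_0: "(flat q \<longlongrightarrow> 0) (at 0)"
proof -
  have "((\<lambda>y. poly q y * exp (- y)) \<longlongrightarrow> (\<Sum>i\<le>degree q. coeff q i * 0)) at_top"
  proof -
    have "((\<lambda>y. \<Sum>i\<le>degree q. coeff q i * (y ^ i / exp y)) \<longlongrightarrow> (\<Sum>i\<le>degree q. coeff q i * 0)) at_top"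
      by (intro tendsto_intros tendsto_power_div_exp_0)
    moreover have "(\<Sum>i\<le>degree q. coeff q i * (y ^ i / exp y)) = poly q y * exp (- y)" for y
      by (simp add: poly_altdef sum_distrib_right exp_minus divide_inverse mult.assoc)
    ultimately show ?thesis by simp
  qed
  from filterlim_compose[OF this filterlim_inverse_at_top_right]
  have "((\<lambda>x. poly q (1 / x) * exp (- (1 / x))) \<longlongrightarrow> 0) (at_right 0)" by (simp add: inverse_eq_divide)
  then have right: "(flat q \<longlongrightarrow> 0) (at_right 0)"
    by (rule Lim_transform_eventually) (auto simp: eventually_at_filter flat_def)
  have "(flat q \<longlongrightarrow> 0) (at_left 0)"
    by (rule Lim_transform_eventually[OF tendsto_const]) (auto simp: eventually_at_filter flat_def)
  with right show ?thesis by (simp add: filterlim_split_at)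
qed

text \<open>At \<open>0\<close> the difference quotient of \<open>flat q\<close> is again a member of the family, with \<open>q\<close> multiplied by the
  variable, and tends to \<open>0\<close>.\<close>

lemma DERIV_flat: "(flat q has_real_derivative flat (pCons 0 (pCons 0 (q - pderiv q))) x) (at x)"
proof (cases x "0 :: real" rule: linorder_cases)
  case less
  have "(flat q has_real_derivative 0) (at x)"
    by (rule has_field_derivative_transform_within_open[of "\<lambda>_. 0" _ _ "{..<0}"])
      (use less in \<open>auto simp: flat_def\<close>)
  with less show ?thesis by (simp add: flat_def)
next
  case equal
  have "((\<lambda>h. flat q h / h) \<longlongrightarrow> 0) (at 0)"
  proof (rule Lim_transform_eventually[OF flat_tendsto_0[of "pCons 0 q"]])
    show "\<forall>\<^sub>F h in at 0. flat (pCons 0 q) h = flat q h / h"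
      by (auto simp: eventually_at_filter flat_def)
  qed
  then show ?thesis using equal by (simp add: DERIV_def flat_def)
next
  case greater
  have "((\<lambda>x. poly q (1 / x) * exp (- (1 / x))) has_real_derivative
      flat (pCons 0 (pCons 0 (q - pderiv q))) x) (at x)"
    using greater
    by (auto intro!: derivative_eq_intros simp: flat_def field_simps power2_eq_square)
  then show ?thesis
    by (rule has_field_derivative_transform_within_open[of _ _ _ "{0<..}"])
      (use greater in \<open>auto simp: flat_def\<close>)
qed

lemma flat_smult: "flat (smult c q) x = c * flat q x"
  by (simp add: flat_def)

lemma flat_uminus: "flat (- q) x = - flat q x"
  by (simp add: flat_def)

lemma flat_1_pos: "0 < x \<Longrightarrow> 0 < flat 1 x"
  by (simp add: flat_def)

lemma flat_1_nonneg: "0 \<le> flat 1 x"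
  by (simp add: flat_def)

lemma flat_nonpos: "x \<le> 0 \<Longrightarrow> flat q x = 0"
  by (simp add: flat_def)

text \<open>The class in which the derivatives of the smooth steps live; the translations and reflections produce
  compact supports.\<close>

inductive_set flat_products :: "(real \<Rightarrow> real) set" where
  product: "(\<lambda>x. flat q (x - s) * flat r (t - x)) \<in> flat_products"
| add: "f \<in> flat_products \<Longrightarrow> g \<in> flat_products \<Longrightarrow> (\<lambda>x. f x + g x) \<in> flat_products"

lemma flat_products_scale:
  assumes "f \<in> flat_products"
  shows "(\<lambda>x. c * f x) \<in> flat_products"
  using assms
proof induction
  case (product q s r t)
  have "(\<lambda>x. c * (flat q (x - s) * flat r (t - x))) = (\<lambda>x. flat (smult c q) (x - s) * flat r (t - x))"
    by (simp add: flat_smult mult_ac)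
  then show ?case by (simp add: flat_products.product)
next
  case (add f g)
  then show ?case using flat_products.add[of "\<lambda>x. c * f x" "\<lambda>x. c * g x"] by (simp add: distrib_left)
qed

lemma flat_products_deriv:
  assumes "f \<in> flat_products"
  shows "\<exists>f'\<in>flat_products. \<forall>x. (f has_real_derivative f' x) (at x)"
  using assms
proof induction
  case (product q s r t)
  define D :: "real poly \<Rightarrow> real poly" where "D q = pCons 0 (pCons 0 (q - pderiv q))" for q
  let ?f' = "\<lambda>x. flat (D q) (x - s) * flat r (t - x) + flat q (x - s) * flat (- D r) (t - x)"
  have D: "(flat p has_real_derivative flat (D p) y) (at y)" for p y
    unfolding D_def by (rule DERIV_flat)
  have "((\<lambda>x. flat q (x - s) * flat r (t - x)) has_real_derivative ?f' x) (at x)" for x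
    by (rule derivative_eq_intros DERIV_chain2[OF D] refl)+ (simp add: flat_uminus)
  then show ?case by (intro bexI[of _ ?f'] allI flat_products.intros)
next
  case (add f g)
  then obtain f' g' where "f' \<in> flat_products" "g' \<in> flat_products"
    "\<And>x. (f has_real_derivative f' x) (at x)" "\<And>x. (g has_real_derivative g' x) (at x)" by blast
  then show ?case
    by (intro bexI[of _ "\<lambda>x. f' x + g' x"] allI DERIV_add flat_products.add)
qed

text \<open>\<open>\<beta>\<close> is the bump \<open>flat 1 (x - s) * flat 1 (s + e - x)\<close>, normalised to mass one, and \<open>\<psi>\<close> its primitive.\<close>

lemma smooth_step:
  fixes s e :: real
  assumes e: "0 < e"
  obtains \<psi> \<beta> where "\<beta> \<in> flat_products" "\<And>x. (\<psi> has_real_derivative \<beta> x) (at x)" "\<And>x. 0 \<le> \<beta> x"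
    "\<And>x. x \<le> s \<Longrightarrow> \<psi> x = 0" "\<And>x. s + e \<le> x \<Longrightarrow> \<psi> x = 1" "\<And>x. x \<notin> {s..s + e} \<Longrightarrow> \<beta> x = 0"
proof -
  define b where "b x = flat 1 (x - s) * flat 1 (s + e - x)" for x
  have b: "b \<in> flat_products" unfolding b_def[abs_def] by (rule flat_products.product)
  have b_nonneg: "0 \<le> b x" for x by (simp add: b_def flat_1_nonneg)
  have b_zero: "b x = 0" if "x \<le> s \<or> s + e \<le> x" for x using that by (auto simp: b_def flat_nonpos)
  obtain b' where "\<And>x. (b has_real_derivative b' x) (at x)" using flat_products_deriv[OF b] by blast
  then have cont: "continuous_on A b" for A by (meson DERIV_continuous_on has_field_derivative_at_within)
  \<comment> \<open>Starting the integral at \<open>s - 1\<close>, to the left of the support, keeps \<open>s\<close> an interior point.\<close>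
  define \<Psi> where "\<Psi> x = integral {s - 1..x} b" for x
  have \<Psi>_zero: "\<Psi> x = 0" if "x \<le> s" for x
  proof -
    have "\<Psi> x = integral {s - 1..x} (\<lambda>_. 0)"
      unfolding \<Psi>_def using that by (intro integral_cong b_zero) auto
    then show ?thesis by simp
  qed
  have D\<Psi>: "(\<Psi> has_real_derivative b x) (at x)" for x
  proof (cases "x < s")
    case True
    have "(\<Psi> has_real_derivative 0) (at x)"
      by (rule has_field_derivative_transform_within_open[of "\<lambda>_. 0" _ _ "{..<s}"])
        (use True \<Psi>_zero in auto)
    with True show ?thesis by (simp add: b_zero)
  next
    case False
    have "(\<Psi> has_real_derivative b x) (at x within {s - 1..x + 1})"
      unfolding \<Psi>_def[abs_def] using False by (intro integral_has_real_derivative cont) auto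
    then show ?thesis using False by (subst (asm) at_within_Icc_at) auto
  qed
  define c where "c = \<Psi> (s + e)"
  have "(b has_integral (\<Psi> (s + e) - \<Psi> s)) {s..s + e}"
    using e by (intro fundamental_theorem_of_calculus)
      (auto intro!: has_field_derivative_at_within D\<Psi> simp flip: has_real_derivative_iff_has_vector_derivative)
  then have int: "(b has_integral c) {s..s + e}" by (simp add: c_def \<Psi>_zero)
  then have "0 \<le> c" by (rule has_integral_nonneg) (rule b_nonneg)
  moreover have "c \<noteq> 0"
  proof
    assume "c = 0"
    with int have "(b has_integral 0) (cbox s (s + e))" by simp
    then have "b (s + e / 2) = 0"
      by (rule has_integral_0_cbox_imp_0[rotated 2]) (use e cont b_nonneg in auto)
    moreover have "0 < b (s + e / 2)" unfolding b_def using e by (intro mult_pos_pos flat_1_pos) auto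
    ultimately show False by simp
  qed
  ultimately have c: "0 < c" by simp
  have \<Psi>_const: "\<Psi> x = c" if "s + e \<le> x" for x
  proof (cases "x = s + e")
    case False
    with that have lt: "s + e < x" by simp
    have "\<Psi> x = \<Psi> (s + e)"
    proof (rule DERIV_isconst_end[OF lt])
      show "continuous_on {s + e..x} \<Psi>" using D\<Psi> by (meson DERIV_continuous_on has_field_derivative_at_within)
      show "(\<Psi> has_real_derivative 0) (at y)" if "s + e < y" "y < x" for y
        using D\<Psi>[of y] b_zero[of y] that by simp
    qed
    then show ?thesis by (simp add: c_def)
  qed (simp add: c_def)
  show ?thesis
  proof
    show "(\<lambda>x. 1 / c * b x) \<in> flat_products" by (rule flat_products_scale[OF b])
    show "((\<lambda>x. 1 / c * \<Psi> x) has_real_derivative 1 / c * b x) (at x)" for x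
      by (intro DERIV_cmult D\<Psi>)
  qed (use c b_nonneg b_zero \<Psi>_zero \<Psi>_const in auto)
qed

text \<open>The difference of the steps at \<open>s\<close> and \<open>t\<close> is the smoothed indicator of \<open>(s, t]\<close> against which the weak
  derivative is tested.\<close>

lemma test_function_step_difference:
  assumes st: "0 < s" "s < t" "t + e < T" and e: "0 < e"
    and \<beta>: "\<beta>s \<in> flat_products" "\<beta>t \<in> flat_products"
    and D: "\<And>x. (\<psi>s has_real_derivative \<beta>s x) (at x)" "\<And>x. (\<psi>t has_real_derivative \<beta>t x) (at x)"
    and zero: "\<And>x. x \<le> s \<Longrightarrow> \<psi>s x = 0" "\<And>x. x \<le> t \<Longrightarrow> \<psi>t x = 0"
    and one: "\<And>x. s + e \<le> x \<Longrightarrow> \<psi>s x = 1" "\<And>x. t + e \<le> x \<Longrightarrow> \<psi>t x = 1"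
  shows "test_function T (\<lambda>x. \<psi>s x - \<psi>t x)" "deriv (\<lambda>x. \<psi>s x - \<psi>t x) = (\<lambda>x. \<beta>s x - \<beta>t x)"
proof -
  let ?\<phi> = "\<lambda>x. \<psi>s x - \<psi>t x"
  have D\<phi>: "(?\<phi> has_real_derivative \<beta>s x - \<beta>t x) (at x)" for x
    by (intro DERIV_diff D)
  then show "deriv ?\<phi> = (\<lambda>x. \<beta>s x - \<beta>t x)" by (auto intro: DERIV_imp_deriv)
  have \<phi>': "(\<lambda>x. \<beta>s x - \<beta>t x) \<in> flat_products"
    using flat_products.add[OF \<beta>(1) flat_products_scale[OF \<beta>(2), of "-1"]] by simp
  have "(deriv ^^ k) ?\<phi> field_differentiable at x" for k x
  proof (rule iterated_deriv_differentiable_in_class)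
    show "?\<phi> \<in> insert ?\<phi> flat_products" by simp
    show "\<exists>f'\<in>insert ?\<phi> flat_products. \<forall>x. (f has_real_derivative f' x) (at x)"
      if "f \<in> insert ?\<phi> flat_products" for f
      using that flat_products_deriv D\<phi> \<phi>' by (metis insert_iff)
  qed
  moreover have "?\<phi> x = 0" if "x \<notin> {s..t + e}" for x
    using that st e zero one by (cases "x < s") auto
  ultimately show "test_function T ?\<phi>"
    unfolding test_function_def using st by blast
qed

section \<open>Increments as integrals of the weak derivative\<close>

text \<open>As the derivative of a step from \<open>0\<close> to \<open>1\<close>, the kernel has mass one, so the difference is the
  pairing of the kernel with \<open>v x - v s\<close>.\<close>

lemma kernel_average:
  fixes v \<beta> \<psi> :: "real \<Rightarrow> real"
  assumes e: "0 < e" "{s..s + e} \<subseteq> {0<..<T}"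
    and v: "continuous_on {s..s + e} v" "\<And>x. x \<in> {s..s + e} \<Longrightarrow> \<bar>v x - v s\<bar> \<le> \<eta>"
    and D: "\<And>x. (\<psi> has_real_derivative \<beta> x) (at x)"
    and \<beta>: "\<And>x. 0 \<le> \<beta> x" "\<And>x. isCont \<beta> x" "\<And>x. x \<notin> {s..s + e} \<Longrightarrow> \<beta> x = 0"
    and \<psi>: "\<psi> s = 0" "\<psi> (s + e) = 1"
  shows "set_integrable lborel {0<..<T} (\<lambda>x. v x * \<beta> x)"
    and "\<bar>(LINT x:{0<..<T}|lborel. v x * \<beta> x) - v s\<bar> \<le> \<eta>"
proof -
  have "has_bochner_integral lborel (\<lambda>x. \<beta> x * indicator {s..s + e} x) (\<psi> (s + e) - \<psi> s)"
    by (rule has_bochner_integral_FTC_Icc_real) (use e D \<beta> in auto)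
  moreover have "(\<lambda>x. \<beta> x * indicator {s..s + e} x) = \<beta>"
    using \<beta>(3) by (auto simp: fun_eq_iff indicator_def)
  ultimately have mass: "has_bochner_integral lborel \<beta> 1" using \<psi> by simp
  then have int_\<beta>: "integrable lborel \<beta>" "integral\<^sup>L lborel \<beta> = 1" by (auto simp: has_bochner_integral_iff)
  have eq: "indicator {0<..<T} x *\<^sub>R (v x * \<beta> x) = indicator {s..s + e} x *\<^sub>R (v x * \<beta> x)" for x
    using \<beta>(3)[of x] e by (auto simp: indicator_def)
  have "set_integrable lborel {s..s + e} (\<lambda>x. v x * \<beta> x)"
    using \<beta>(2) by (intro borel_integrable_atLeastAtMost' continuous_intros v continuous_at_imp_continuous_on) auto
  then show int: "set_integrable lborel {0<..<T} (\<lambda>x. v x * \<beta> x)"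
    by (simp only: set_integrable_def eq)
  have "(LINT x:{0<..<T}|lborel. v x * \<beta> x) - v s = (\<integral>x. indicator {0<..<T} x *\<^sub>R (v x * \<beta> x) - v s * \<beta> x \<partial>lborel)"
    unfolding set_lebesgue_integral_def using int int_\<beta>
    by (subst Bochner_Integration.integral_diff) (auto simp: set_integrable_def)
  also have "\<bar>\<dots>\<bar> \<le> (\<integral>x. \<eta> * \<beta> x \<partial>lborel)"
  proof (rule integral_abs_bound_integral)
    show "integrable lborel (\<lambda>x. indicator {0<..<T} x *\<^sub>R (v x * \<beta> x) - v s * \<beta> x)"
      using int int_\<beta> by (intro Bochner_Integration.integrable_diff) (auto simp: set_integrable_def)
    show "\<bar>indicator {0<..<T} x *\<^sub>R (v x * \<beta> x) - v s * \<beta> x\<bar> \<le> \<eta> * \<beta> x" for x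
    proof (cases "x \<in> {s..s + e}")
      case True
      then have "indicator {0<..<T} x *\<^sub>R (v x * \<beta> x) - v s * \<beta> x = (v x - v s) * \<beta> x"
        using e by (auto simp: left_diff_distrib)
      then show ?thesis using v(2)[OF True] \<beta>(1)[of x] by (simp add: abs_mult mult_right_mono)
    qed (use \<beta>(3) in simp)
  qed (use int_\<beta> in simp)
  finally show "\<bar>(LINT x:{0<..<T}|lborel. v x * \<beta> x) - v s\<bar> \<le> \<eta>" using int_\<beta> by simp
qed

text \<open>Testing the weak derivative against a smoothed indicator of \<open>(s, t]\<close> gives the increment of
  \<open>v\<close> in the limit of vanishing smoothing width: the kernels at \<open>s\<close> and \<open>t\<close> concentrate there, and the
  smoothed indicators converge pointwise under an integrable bound.\<close>

lemma weak_derivative_increment_inner: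
  assumes weak: "has_weak_derivative T v w" and cont: "continuous_on {0<..<T} v"
    and st: "0 < s" "s < t" "t < T"
  shows "v t - v s = (LINT x:{s<..t}|lborel. w x)"
proof -
  define d where "d = (T - t) / 2"
  define e where "e n = d / real (Suc n)" for n :: nat
  have d: "0 < d" "t + d < T" using st by (auto simp: d_def field_simps)
  have e: "0 < e n" "e n \<le> d" for n
    using d divide_left_mono[of 1 "real (Suc n)" d] by (auto simp: e_def)
  have e_lim: "e \<longlonglongrightarrow> 0"
    unfolding e_def by (rule LIMSEQ_Suc[OF lim_const_over_n])
  define P where "P r n \<psi> \<beta> \<longleftrightarrow> \<beta> \<in> flat_products \<and> (\<forall>x. (\<psi> has_real_derivative \<beta> x) (at x)) \<and>
      (\<forall>x. 0 \<le> \<beta> x) \<and> (\<forall>x\<le>r. \<psi> x = 0) \<and> (\<forall>x\<ge>r + e n. \<psi> x = 1) \<and> (\<forall>x. x \<notin> {r..r + e n} \<longrightarrow> \<beta> x = 0)"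
    for r n \<psi> \<beta>
  have "\<exists>\<psi> \<beta>. P r n \<psi> \<beta>" for r n
  proof (rule smooth_step[OF e(1)[of n], of r])
    fix \<psi> \<beta> :: "real \<Rightarrow> real"
    assume "\<beta> \<in> flat_products" "\<And>x. (\<psi> has_real_derivative \<beta> x) (at x)" "\<And>x. 0 \<le> \<beta> x"
      "\<And>x. x \<le> r \<Longrightarrow> \<psi> x = 0" "\<And>x. r + e n \<le> x \<Longrightarrow> \<psi> x = 1" "\<And>x. x \<notin> {r..r + e n} \<Longrightarrow> \<beta> x = 0"
    then have "P r n \<psi> \<beta>" by (simp add: P_def)
    then show ?thesis by blast
  qed
  then obtain \<psi> \<beta> where P: "\<And>r n. P r n (\<psi> r n) (\<beta> r n)" by metis
  have \<beta>: "\<beta> r n \<in> flat_products"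
    and D: "(\<psi> r n has_real_derivative \<beta> r n x) (at x)"
    and \<beta>_nonneg: "0 \<le> \<beta> r n x"
    and zero: "x \<le> r \<Longrightarrow> \<psi> r n x = 0" and one: "r + e n \<le> x \<Longrightarrow> \<psi> r n x = 1"
    and supp: "x \<notin> {r..r + e n} \<Longrightarrow> \<beta> r n x = 0" for r n x
    using P[of r n] by (simp_all add: P_def)
  have mono: "\<psi> r n x \<le> \<psi> r n y" if "x \<le> y" for r n x y
    using D[of r n] \<beta>_nonneg[of r n] by (intro DERIV_nonneg_imp_nondecreasing[OF that]) blast
  have bounds: "0 \<le> \<psi> r n x" "\<psi> r n x \<le> 1" for r n x
    using mono[of r x r n] mono[of x r r n] mono[of x "r + e n" r n] mono[of "r + e n" x r n]
      zero[of r r n] one[of r n "r + e n"] zero[of x r n] one[of r n x] by (cases "x \<le> r"; cases "r + e n \<le> x"; simp)+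
  have \<beta>_cont: "isCont (\<beta> r n) x" for r n x
    using flat_products_deriv[OF \<beta>] DERIV_isCont by blast
  define \<phi> where "\<phi> n x = \<psi> s n x - \<psi> t n x" for n x
  have tst: "test_function T (\<phi> n)" "deriv (\<phi> n) = (\<lambda>x. \<beta> s n x - \<beta> t n x)" for n
    unfolding \<phi>_def[abs_def]
    using test_function_step_difference[where \<psi>s = "\<psi> s n" and \<psi>t = "\<psi> t n" and s = s and t = t and e = "e n" and T = T,
        OF st(1,2) _ e(1)[of n] \<beta> \<beta> D D zero zero one one] e(2)[of n] d by auto
  have avg: "(\<lambda>n. LINT x:{0<..<T}|lborel. v x * \<beta> r n x) \<longlonglongrightarrow> v r" if r: "r \<in> {s, t}" for r
  proof (rule LIMSEQ_I)
    fix \<eta> :: real assume \<eta>: "0 < \<eta>"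
    have "isCont v r" using r st continuous_on_interior[OF cont, of r] by auto
    then obtain \<delta> where \<delta>: "0 < \<delta>" "\<And>x. dist x r < \<delta> \<Longrightarrow> dist (v x) (v r) < \<eta> / 2"
      using \<eta> unfolding continuous_at_eps_delta by (metis half_gt_zero)
    have "\<forall>\<^sub>F n in sequentially. e n < \<delta>" using e_lim \<delta>(1) by (rule order_tendstoD)
    then obtain k where k: "\<And>n. k \<le> n \<Longrightarrow> e n < \<delta>" by (auto simp: eventually_sequentially)
    have "\<bar>(LINT x:{0<..<T}|lborel. v x * \<beta> r n x) - v r\<bar> \<le> \<eta> / 2" if "k \<le> n" for n
    proof (rule kernel_average(2)[where e = "e n" and \<psi> = "\<psi> r n"])
      show sub: "{r..r + e n} \<subseteq> {0<..<T}" using r st d e(2)[of n] by auto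
      show "continuous_on {r..r + e n} v" by (rule continuous_on_subset[OF cont sub])
      show "\<bar>v x - v r\<bar> \<le> \<eta> / 2" if "x \<in> {r..r + e n}" for x
        using \<delta>(2)[of x] k[OF \<open>k \<le> n\<close>] that by (auto simp: dist_real_def)
    qed (use e D \<beta>_nonneg \<beta>_cont supp zero one in auto)
    then show "\<exists>k. \<forall>n\<ge>k. norm ((LINT x:{0<..<T}|lborel. v x * \<beta> r n x) - v r) < \<eta>"
      using \<eta> by (intro exI[of _ k]) fastforce
  qed
  have int_avg: "set_integrable lborel {0<..<T} (\<lambda>x. v x * \<beta> r n x)" if r: "r \<in> {s, t}" for r n
  proof -
    have sub: "{r..r + e n} \<subseteq> {0<..<T}" using r st d e(2)[of n] by auto
    have cont': "continuous_on {r..r + e n} v" by (rule continuous_on_subset[OF cont sub])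
    then have "bounded (v ` {r..r + e n})"
      by (intro compact_imp_bounded compact_continuous_image) auto
    then obtain B where B: "\<And>x. x \<in> {r..r + e n} \<Longrightarrow> \<bar>v x\<bar> \<le> B"
      unfolding bounded_iff real_norm_def by blast
    have "r \<in> {r..r + e n}" using e(1)[of n] by auto
    show ?thesis
    proof (rule kernel_average(1)[where e = "e n" and \<psi> = "\<psi> r n" and \<eta> = "2 * B"])
      show "{r..r + e n} \<subseteq> {0<..<T}" "continuous_on {r..r + e n} v" by fact+
      show "\<bar>v x - v r\<bar> \<le> 2 * B" if "x \<in> {r..r + e n}" for x
        using B[OF that] B[OF \<open>r \<in> {r..r + e n}\<close>] by linarith
    qed (use e D \<beta>_nonneg \<beta>_cont supp zero one in auto)
  qed
  have lhs: "(LINT x:{0<..<T}|lborel. v x * deriv (\<phi> n) x) =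
      (LINT x:{0<..<T}|lborel. v x * \<beta> s n x) - (LINT x:{0<..<T}|lborel. v x * \<beta> t n x)" for n
    unfolding tst(2) right_diff_distrib by (intro set_integral_diff int_avg) auto
  have lhs_lim: "(\<lambda>n. LINT x:{0<..<T}|lborel. v x * deriv (\<phi> n) x) \<longlonglongrightarrow> v s - v t"
    unfolding lhs by (intro tendsto_diff avg) auto
  have w_meas: "(\<lambda>x. indicator {0<..<T} x * w x) \<in> borel_measurable lborel"
    and w_int: "set_integrable lborel {s..t + d} w"
    using weak st d by (auto simp: has_weak_derivative_def locally_integrable_def set_borel_measurable_def)
  have rhs_lim: "(\<lambda>n. LINT x:{0<..<T}|lborel. w x * \<phi> n x) \<longlonglongrightarrow> (LINT x:{s<..t}|lborel. w x)"
    unfolding set_lebesgue_integral_def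
  proof (rule integral_dominated_convergence)
    show "integrable lborel (\<lambda>x. norm (indicator {s..t + d} x *\<^sub>R w x))"
      using w_int unfolding set_integrable_def by (rule integrable_norm)
    have sub: "(\<lambda>x. indicator {s<..t} x *\<^sub>R w x) = (\<lambda>x. indicator {s<..t} x * (indicator {0<..<T} x * w x))"
      using st by (auto simp: fun_eq_iff indicator_def)
    show "(\<lambda>x. indicator {s<..t} x *\<^sub>R w x) \<in> borel_measurable lborel"
      unfolding sub by (intro borel_measurable_times w_meas) auto
    show "(\<lambda>x. indicator {0<..<T} x *\<^sub>R (w x * \<phi> n x)) \<in> borel_measurable lborel" for n
    proof -
      have "\<phi> n \<in> borel_measurable borel"
        unfolding \<phi>_def[abs_def]
        by (intro borel_measurable_continuous_onI continuous_at_imp_continuous_on ballI continuous_diff DERIV_isCont[OF D])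
      then have "(\<lambda>x. (indicator {0<..<T} x * w x) * \<phi> n x) \<in> borel_measurable lborel"
        by (intro borel_measurable_times w_meas) auto
      then show ?thesis by (simp add: mult.assoc)
    qed
    show "AE x in lborel. (\<lambda>n. indicator {0<..<T} x *\<^sub>R (w x * \<phi> n x)) \<longlonglongrightarrow> indicator {s<..t} x *\<^sub>R w x"
    proof (rule AE_I2, rule tendsto_eventually)
      fix x
      have ev: "\<forall>\<^sub>F n in sequentially. r + e n \<le> x" if "r < x" for r
      proof -
        have "\<forall>\<^sub>F n in sequentially. e n < x - r" using e_lim that by (intro order_tendstoD) auto
        then show ?thesis by eventually_elim simp
      qed
      consider "x \<le> s" | "s < x" "x \<le> t" | "t < x" by linarith
      then show "\<forall>\<^sub>F n in sequentially. indicator {0<..<T} x *\<^sub>R (w x * \<phi> n x) = indicator {s<..t} x *\<^sub>R w x"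
      proof cases
        case 1
        then show ?thesis using st by (auto simp: \<phi>_def zero)
      next
        case 2
        from ev[OF 2(1)] show ?thesis
          by eventually_elim (use 2 st in \<open>simp add: \<phi>_def zero one\<close>)
      next
        case 3
        then have "s < x" using st by simp
        from ev[OF this] ev[OF 3] show ?thesis
          by eventually_elim (use 3 st in \<open>simp add: \<phi>_def one\<close>)
      qed
    qed
    show "AE x in lborel. norm (indicator {0<..<T} x *\<^sub>R (w x * \<phi> n x)) \<le> norm (indicator {s..t + d} x *\<^sub>R w x)" for n
    proof (rule AE_I2)
      fix x
      have "\<bar>\<phi> n x\<bar> \<le> indicator {s..t + d} x"
        using bounds[of s n x] bounds[of t n x] zero[of x s n] zero[of x t n] one[of s n x] one[of t n x] e(2)[of n] st
        by (cases "x < s"; cases "t + d < x") (auto simp: \<phi>_def)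
      then have "\<bar>w x\<bar> * \<bar>\<phi> n x\<bar> \<le> \<bar>w x\<bar> * indicator {s..t + d} x" by (intro mult_left_mono) auto
      then show "norm (indicator {0<..<T} x *\<^sub>R (w x * \<phi> n x)) \<le> norm (indicator {s..t + d} x *\<^sub>R w x)"
        by (auto simp: abs_mult indicator_def split: if_splits)
    qed
  qed
  have "(LINT x:{0<..<T}|lborel. v x * deriv (\<phi> n) x) = - (LINT x:{0<..<T}|lborel. w x * \<phi> n x)" for n
    using weak tst(1) by (auto simp: has_weak_derivative_def)
  then have "(\<lambda>n. LINT x:{0<..<T}|lborel. v x * deriv (\<phi> n) x) \<longlonglongrightarrow> - (LINT x:{s<..t}|lborel. w x)"
    using tendsto_minus[OF rhs_lim] by simp
  from LIMSEQ_unique[OF this lhs_lim] show ?thesis by simp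
qed

text \<open>Continuity of \<open>v\<close> up to the boundary and integrability of \<open>w\<close> on the whole interval extend the
  formula to the end points.\<close>

lemma weak_derivative_increment:
  assumes weak: "has_weak_derivative T v w" and cont: "continuous_on {0..T} v"
    and int: "set_integrable lborel {0<..<T} w" and st: "0 \<le> s" "s < t" "t \<le> T"
  shows "v t - v s = (LINT x:{s<..<t}|lborel. w x)"
proof -
  define e where "e n = (t - s) / 3 / real (Suc n)" for n :: nat
  have e: "0 < e n" "e n \<le> (t - s) / 3" for n
    using st divide_left_mono[of 1 "real (Suc n)" "(t - s) / 3"] by (auto simp: e_def)
  have e_lim: "e \<longlonglongrightarrow> 0"
    unfolding e_def by (rule LIMSEQ_Suc[OF lim_const_over_n])
  have inner: "v (t - e n) - v (s + e n) = (LINT x:{s + e n<..t - e n}|lborel. w x)" for n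
    using e(1)[of n] e(2)[of n] st
    by (intro weak_derivative_increment_inner[OF weak] continuous_on_subset[OF cont]) auto
  have v_lim: "(\<lambda>n. v (r n)) \<longlonglongrightarrow> v r'" if "r \<longlonglongrightarrow> r'" "\<And>n. r n \<in> {0..T}" "r' \<in> {0..T}" for r r'
    using continuous_on_tendsto_compose[OF cont that(1,3)] that(2) by auto
  have "(\<lambda>n. v (t - e n) - v (s + e n)) \<longlonglongrightarrow> v t - v s"
  proof (intro tendsto_diff v_lim)
    show "(\<lambda>n. t - e n) \<longlonglongrightarrow> t" "(\<lambda>n. s + e n) \<longlonglongrightarrow> s"
      using tendsto_diff[OF tendsto_const e_lim, of t] tendsto_add[OF tendsto_const e_lim, of s] by auto
    show "t - e n \<in> {0..T}" "s + e n \<in> {0..T}" for n using e(1)[of n] e(2)[of n] st by auto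
  qed (use st in auto)
  moreover have "(\<lambda>n. LINT x:{s + e n<..t - e n}|lborel. w x) \<longlonglongrightarrow> (LINT x:{s<..<t}|lborel. w x)"
    unfolding set_lebesgue_integral_def
  proof (rule integral_dominated_convergence)
    have w_meas: "(\<lambda>x. indicator {0<..<T} x *\<^sub>R w x) \<in> borel_measurable lborel"
      using int unfolding set_integrable_def by (rule borel_measurable_integrable)
    have meas: "(\<lambda>x. indicator A x *\<^sub>R w x) \<in> borel_measurable lborel"
      if "A \<subseteq> {0<..<T}" "A \<in> sets borel" for A
    proof -
      have "(\<lambda>x. indicator A x *\<^sub>R w x) = (\<lambda>x. indicator A x * (indicator {0<..<T} x *\<^sub>R w x))"
        using that by (auto simp: fun_eq_iff indicator_def)
      then show ?thesis using that w_meas by simp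
    qed
    show "integrable lborel (\<lambda>x. norm (indicator {0<..<T} x *\<^sub>R w x))"
      using int unfolding set_integrable_def by (rule integrable_norm)
    show "(\<lambda>x. indicator {s<..<t} x *\<^sub>R w x) \<in> borel_measurable lborel"
      using st by (intro meas) auto
    show "(\<lambda>x. indicator {s + e n<..t - e n} x *\<^sub>R w x) \<in> borel_measurable lborel" for n
      using st e(1)[of n] by (intro meas) auto
    show "AE x in lborel. (\<lambda>n. indicator {s + e n<..t - e n} x *\<^sub>R w x) \<longlonglongrightarrow> indicator {s<..<t} x *\<^sub>R w x"
    proof (rule AE_I2, rule tendsto_eventually)
      fix x
      show "\<forall>\<^sub>F n in sequentially. indicator {s + e n<..t - e n} x *\<^sub>R w x = indicator {s<..<t} x *\<^sub>R w x"
      proof (cases "x \<in> {s<..<t}")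
        case True
        then have "\<forall>\<^sub>F n in sequentially. e n < min (x - s) (t - x)"
          using e_lim by (intro order_tendstoD) auto
        then show ?thesis by eventually_elim (use True in auto)
      next
        case False
        have "x \<notin> {s + e n<..t - e n}" for n using False e(1)[of n] by auto
        with False show ?thesis by simp
      qed
    qed
    show "AE x in lborel. norm (indicator {s + e n<..t - e n} x *\<^sub>R w x) \<le> norm (indicator {0<..<T} x *\<^sub>R w x)" for n
      using st e(1)[of n] by (intro AE_I2) (auto simp: indicator_def)
  qed
  ultimately show ?thesis unfolding inner by (rule LIMSEQ_unique)
qed

section \<open>The quadrature error on one cell\<close>

text \<open>For \<open>y < x\<close> the deviation is the integral of \<open>w - m\<close> over \<open>(y, x)\<close>, and extending the range of
  integration to the whole cell only increases the integral of the modulus.\<close>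

lemma chord_deviation_le:
  fixes v w :: "real \<Rightarrow> real" and a b x y m :: real
  assumes ab: "a < b" and int: "set_integrable lborel {a<..<b} w"
    and incr: "\<And>x y. a \<le> x \<Longrightarrow> x < y \<Longrightarrow> y \<le> b \<Longrightarrow> v y - v x = (LINT r:{x<..<y}|lborel. w r)"
    and xy: "x \<in> {a..b}" "y \<in> {a..b}"
  shows "\<bar>v x - v y - m * (x - y)\<bar> \<le> (LINT r:{a<..<b}|lborel. \<bar>w r - m\<bar>)"
proof -
  have *: "\<bar>v y - v x - m * (y - x)\<bar> \<le> (LINT r:{a<..<b}|lborel. \<bar>w r - m\<bar>)"
    if "a \<le> x" "x < y" "y \<le> b" for x y :: real
  proof -
    have sub: "{x<..<y} \<subseteq> {a<..<b}"
      using that by (simp add: greaterThanLessThan_subseteq_greaterThanLessThan)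
    have const: "set_integrable lborel {c<..<d} (\<lambda>_. m)" for c d :: real
      unfolding set_integrable_def
      by (rule integrable_scaleR_left)
        (cases "c \<le> d", auto intro!: integrable_real_indicator)
    have int_xy: "set_integrable lborel {x<..<y} w"
      by (rule set_integrable_subset[OF int]) (use sub in auto)
    have int_abs: "set_integrable lborel {a<..<b} (\<lambda>r. \<bar>w r - m\<bar>)"
      by (intro set_integrable_abs set_integral_diff int const)
    have "v y - v x - m * (y - x) = (LINT r:{x<..<y}|lborel. w r) - (LINT r:{x<..<y}|lborel. m)"
      using incr[OF that] that by (simp add: set_lebesgue_integral_def)
    also have "\<dots> = (LINT r:{x<..<y}|lborel. w r - m)"
      by (rule set_integral_diff(2)[symmetric]) (intro int_xy const)+
    also have "\<bar>\<dots>\<bar> \<le> (LINT r:{x<..<y}|lborel. \<bar>w r - m\<bar>)"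
      using set_integral_norm_bound[OF set_integral_diff(1)[OF int_xy const]] by simp
    also have "\<dots> \<le> (LINT r:{a<..<b}|lborel. \<bar>w r - m\<bar>)"
      using int_abs set_integrable_subset[OF int_abs _ sub]
      unfolding set_lebesgue_integral_def set_integrable_def
      by (intro integral_mono) (use sub in \<open>auto simp: indicator_def\<close>)
    finally show ?thesis .
  qed
  have nonneg: "0 \<le> (LINT r:{a<..<b}|lborel. \<bar>w r - m\<bar>)"
    unfolding set_lebesgue_integral_def by (rule Bochner_Integration.integral_nonneg) auto
  show ?thesis
  proof (cases x y rule: linorder_cases)
    case less
    then have "\<bar>v y - v x - m * (y - x)\<bar> = \<bar>v x - v y - m * (x - y)\<bar>"
      by (simp add: abs_minus_commute algebra_simps)
    then show ?thesis using *[of x y] less xy by simp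
  qed (use *[of y x] xy nonneg in auto)
qed

text \<open>The deviation from the mean is itself a mean, \<open>w s - (\<integral> w) / h = 1 / h * \<integral> (w s - w t) dt\<close>.\<close>

lemma (in finite_measure) deviation_from_mean_le:
  fixes w :: "'a \<Rightarrow> real"
  assumes w: "integrable M w" and h: "0 < h" "measure M (space M) = h"
  shows "(\<integral>\<^sup>+s. ennreal \<bar>w s - (\<integral>t. w t \<partial>M) / h\<bar> \<partial>M) \<le>
    ennreal (1 / h) * (\<integral>\<^sup>+s. \<integral>\<^sup>+t. ennreal \<bar>w t - w s\<bar> \<partial>M \<partial>M)"
proof -
  have [measurable]: "w \<in> borel_measurable M" using w by simp
  have "ennreal \<bar>w s - (\<integral>t. w t \<partial>M) / h\<bar> \<le> ennreal (1 / h) * (\<integral>\<^sup>+t. ennreal \<bar>w t - w s\<bar> \<partial>M)" for s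
  proof -
    have "(\<integral>t. w t - w s \<partial>M) = (\<integral>t. w t \<partial>M) - h * w s"
      using w h by (subst Bochner_Integration.integral_diff) auto
    then have "\<bar>w s - (\<integral>t. w t \<partial>M) / h\<bar> = 1 / h * \<bar>\<integral>t. w t - w s \<partial>M\<bar>"
      using h by (simp add: abs_div_pos[symmetric] field_simps abs_minus_commute)
    then have "ennreal \<bar>w s - (\<integral>t. w t \<partial>M) / h\<bar> = ennreal (1 / h) * ennreal \<bar>\<integral>t. w t - w s \<partial>M\<bar>"
      using h by (simp add: ennreal_mult[symmetric])
    also have "ennreal \<bar>\<integral>t. w t - w s \<partial>M\<bar> \<le> (\<integral>\<^sup>+t. ennreal \<bar>w t - w s\<bar> \<partial>M)"
      using integral_norm_bound_ennreal[of M "\<lambda>t. w t - w s"] w by simp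
    finally show ?thesis by (simp add: mult_left_mono)
  qed
  then have "(\<integral>\<^sup>+s. ennreal \<bar>w s - (\<integral>t. w t \<partial>M) / h\<bar> \<partial>M) \<le>
      (\<integral>\<^sup>+s. ennreal (1 / h) * (\<integral>\<^sup>+t. ennreal \<bar>w t - w s\<bar> \<partial>M) \<partial>M)"
    by (intro nn_integral_mono)
  also have "\<dots> = ennreal (1 / h) * (\<integral>\<^sup>+s. \<integral>\<^sup>+t. ennreal \<bar>w t - w s\<bar> \<partial>M \<partial>M)"
    by (rule nn_integral_cmult) measurable
  finally show ?thesis .
qed

text \<open>On the cell \<open>\<bar>t - s\<bar> \<le> b - a\<close>, so the double integral of \<open>\<bar>w t - w s\<bar>\<^sup>p\<close> costs a factor
  \<open>(b - a)\<^sup>1\<^sup>+\<^sup>\<sigma>\<^sup>p\<close> against the seminorm; a power mean on the square of area \<open>(b - a)\<^sup>2\<close> lowers the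
  exponent from \<open>p\<close> to \<open>1\<close>.\<close>

lemma mean_oscillation_le:
  fixes w :: "real \<Rightarrow> real"
  assumes ab: "a < b" and int: "set_integrable lborel {a<..<b} w" and [measurable]: "w \<in> borel_measurable borel"
    and p: "1 \<le> p" and \<sigma>: "0 < \<sigma>" and S: "0 \<le> S"
    and seminorm: "(\<integral>\<^sup>+s\<in>{a<..<b}. (\<integral>\<^sup>+t\<in>{a<..<b}.
        ennreal (\<bar>w t - w s\<bar> powr p / \<bar>t - s\<bar> powr (1 + \<sigma> * p)) \<partial>lborel) \<partial>lborel) \<le> ennreal S"
  shows "(LINT r:{a<..<b}|lborel. \<bar>w r - (LINT r:{a<..<b}|lborel. w r) / (b - a)\<bar>) \<le>
    (b - a) powr (1 + \<sigma> - 1 / p) * S powr (1 / p)"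
proof -
  define h where "h = b - a"
  define L :: "real measure" where "L = restrict_space lborel {a<..<b}"
  have h: "0 < h" using ab by (simp add: h_def)
  have emeasure_L: "emeasure L (space L) = ennreal h"
    using ab by (simp add: L_def emeasure_restrict_space space_restrict_space h_def)
  have measure_L: "measure L (space L) = h" using emeasure_L h by (simp add: measure_def)
  interpret L: finite_measure L by (rule finite_measureI) (simp add: emeasure_L)
  interpret LL: pair_sigma_finite L L ..
  have w_L [measurable]: "w \<in> borel_measurable L"
    unfolding L_def by (rule measurable_restrict_space1) simp
  have int_L: "integrable L w"
    using int ab unfolding L_def set_integrable_def by (subst integrable_restrict_space) auto
  have nn_L: "(\<integral>\<^sup>+s\<in>{a<..<b}. f s \<partial>lborel) = (\<integral>\<^sup>+s. f s \<partial>L)" for f :: "real \<Rightarrow> ennreal"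
    unfolding L_def by (simp add: nn_integral_restrict_space)
  have lint_L: "(LINT r:{a<..<b}|lborel. f r) = (\<integral>r. f r \<partial>L)" for f :: "real \<Rightarrow> real"
    unfolding L_def set_lebesgue_integral_def by (subst integral_restrict_space) auto
  \<comment> \<open>The level \<open>l\<close> is chosen such that \<open>h\<^sup>2 l\<^sup>p = h\<^sup>1\<^sup>+\<^sup>\<sigma>\<^sup>p S\<close>.\<close>
  define l where "l = (h powr (\<sigma> * p - 1) * S) powr (1 / p)"
  have l: "0 \<le> l" "l powr p = h powr (\<sigma> * p - 1) * S"
    using p h S by (auto simp: l_def powr_powr)
  have "ennreal (\<bar>w t - w s\<bar> powr p) \<le>
      ennreal (h powr (1 + \<sigma> * p)) * ennreal (\<bar>w t - w s\<bar> powr p / \<bar>t - s\<bar> powr (1 + \<sigma> * p))"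
    if "s \<in> space L" "t \<in> space L" for s t
  proof (cases "s = t")
    case False
    have "\<bar>t - s\<bar> \<le> h" using that by (auto simp: L_def space_restrict_space h_def)
    then have "\<bar>t - s\<bar> powr (1 + \<sigma> * p) \<le> h powr (1 + \<sigma> * p)" using p \<sigma> by (intro powr_mono2) auto
    moreover have "0 < \<bar>t - s\<bar> powr (1 + \<sigma> * p)" using False by simp
    ultimately have "\<bar>w t - w s\<bar> powr p \<le> h powr (1 + \<sigma> * p) * (\<bar>w t - w s\<bar> powr p / \<bar>t - s\<bar> powr (1 + \<sigma> * p))"
      by (simp add: pos_le_divide_eq mult.commute[of "h powr (1 + \<sigma> * p)"] mult_left_mono)
    then show ?thesis by (subst ennreal_mult[symmetric]) (auto intro: ennreal_leI)
  qed (use p in simp)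
  then have "(\<integral>\<^sup>+s. \<integral>\<^sup>+t. ennreal (\<bar>w t - w s\<bar> powr p) \<partial>L \<partial>L) \<le>
      (\<integral>\<^sup>+s. \<integral>\<^sup>+t. ennreal (h powr (1 + \<sigma> * p)) * ennreal (\<bar>w t - w s\<bar> powr p / \<bar>t - s\<bar> powr (1 + \<sigma> * p)) \<partial>L \<partial>L)"
    by (intro nn_integral_mono)
  also have "\<dots> = ennreal (h powr (1 + \<sigma> * p)) *
      (\<integral>\<^sup>+s. \<integral>\<^sup>+t. ennreal (\<bar>w t - w s\<bar> powr p / \<bar>t - s\<bar> powr (1 + \<sigma> * p)) \<partial>L \<partial>L)"
  proof -
    have id[measurable]: "(\<lambda>x. x) \<in> borel_measurable L"
      unfolding L_def by (rule measurable_restrict_space1) simp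
    have "(\<integral>\<^sup>+t. ennreal (h powr (1 + \<sigma> * p)) * ennreal (\<bar>w t - w s\<bar> powr p / \<bar>t - s\<bar> powr (1 + \<sigma> * p)) \<partial>L) =
        ennreal (h powr (1 + \<sigma> * p)) * (\<integral>\<^sup>+t. ennreal (\<bar>w t - w s\<bar> powr p / \<bar>t - s\<bar> powr (1 + \<sigma> * p)) \<partial>L)" for s
      by (rule nn_integral_cmult) measurable
    then show ?thesis by (simp only:) (rule nn_integral_cmult, measurable)
  qed
  also have "\<dots> \<le> ennreal (h powr (1 + \<sigma> * p)) * ennreal S"
    using seminorm unfolding nn_L by (rule mult_left_mono) simp
  also have "\<dots> = ennreal ((h * h) * l powr p)"
  proof -
    have "h powr (1 + \<sigma> * p) = h powr 2 * h powr (\<sigma> * p - 1)"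
      by (simp flip: powr_add)
    also have "h powr 2 = h * h" using h by (simp add: powr_numeral power2_eq_square)
    finally have "h powr (1 + \<sigma> * p) * S = (h * h) * l powr p" by (simp only: l(2) mult.assoc)
    then show ?thesis using S by (subst ennreal_mult[symmetric]) simp_all
  qed
  finally have "(\<integral>\<^sup>+z. ennreal ((case z of (s, t) \<Rightarrow> \<bar>w t - w s\<bar>) powr p) \<partial>(L \<Otimes>\<^sub>M L)) \<le> ennreal ((h * h) * l powr p)"
    by (subst L.nn_integral_fst[symmetric]) (simp_all add: case_prod_unfold)
  then have "(\<integral>\<^sup>+z. ennreal (case z of (s, t) \<Rightarrow> \<bar>w t - w s\<bar>) \<partial>(L \<Otimes>\<^sub>M L)) \<le> ennreal ((h * h) * l)"
  proof (rule nn_integral_power_mean[rotated -1])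
    show "emeasure (L \<Otimes>\<^sub>M L) (space (L \<Otimes>\<^sub>M L)) \<le> ennreal (h * h)"
      using h by (simp add: space_pair_measure L.emeasure_pair_measure_Times emeasure_L ennreal_mult)
  qed (use p h l in \<open>auto simp: case_prod_unfold\<close>)
  then have double: "(\<integral>\<^sup>+s. \<integral>\<^sup>+t. ennreal \<bar>w t - w s\<bar> \<partial>L \<partial>L) \<le> ennreal ((h * h) * l)"
    by (subst (asm) L.nn_integral_fst[symmetric]) (simp_all add: case_prod_unfold)
  have "ennreal (\<integral>r. \<bar>w r - (\<integral>r. w r \<partial>L) / h\<bar> \<partial>L) = (\<integral>\<^sup>+r. ennreal \<bar>w r - (\<integral>r. w r \<partial>L) / h\<bar> \<partial>L)"
    using int_L by (subst nn_integral_eq_integral) auto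
  also have "\<dots> \<le> ennreal (1 / h) * (\<integral>\<^sup>+s. \<integral>\<^sup>+t. ennreal \<bar>w t - w s\<bar> \<partial>L \<partial>L)"
    by (rule L.deviation_from_mean_le[OF int_L h measure_L])
  also have "\<dots> \<le> ennreal (1 / h) * ennreal ((h * h) * l)"
    using double by (rule mult_left_mono) simp
  also have "\<dots> = ennreal (h * l)"
    using h l(1) by (simp add: ennreal_mult[symmetric])
  finally have "(\<integral>r. \<bar>w r - (\<integral>r. w r \<partial>L) / h\<bar> \<partial>L) \<le> h * l"
    using h l(1) by (subst (asm) ennreal_le_iff) auto
  also have "h * l = h powr (1 + \<sigma> - 1 / p) * S powr (1 / p)"
  proof -
    have "l = h powr (\<sigma> - 1 / p) * S powr (1 / p)"
      using h S p by (simp add: l_def powr_mult powr_powr diff_divide_distrib)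
    moreover have "h * h powr (\<sigma> - 1 / p) = h powr (1 + (\<sigma> - 1 / p))"
      using h by (subst powr_add) simp
    ultimately show ?thesis by (simp add: mult.assoc[symmetric] add_diff_eq)
  qed
  finally show ?thesis by (simp add: lint_L h_def)
qed

text \<open>The blocks \<open>I j \<times> I j\<close> are disjoint subsets of \<open>A \<times> A\<close>; the pairs with points in different cells
  are dropped.\<close>

lemma sum_diagonal_blocks_le:
  fixes q :: "real \<Rightarrow> real \<Rightarrow> ennreal"
  assumes q [measurable]: "(\<lambda>(s, t). q s t) \<in> borel_measurable (lborel \<Otimes>\<^sub>M lborel)"
    and J: "finite J" "disjoint_family_on I J" "\<And>j. j \<in> J \<Longrightarrow> I j \<subseteq> A" "\<And>j. j \<in> J \<Longrightarrow> I j \<in> sets borel"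
  shows "(\<Sum>j\<in>J. \<integral>\<^sup>+s\<in>I j. (\<integral>\<^sup>+t\<in>I j. q s t \<partial>lborel) \<partial>lborel) \<le> (\<integral>\<^sup>+s\<in>A. (\<integral>\<^sup>+t\<in>A. q s t \<partial>lborel) \<partial>lborel)"
proof -
  have meas: "(\<lambda>s. (\<integral>\<^sup>+t\<in>I j. q s t \<partial>lborel) * indicator (I j) s) \<in> borel_measurable lborel" if "j \<in> J" for j
  proof -
    have [measurable]: "I j \<in> sets borel" using J(4) that .
    show ?thesis by measurable
  qed
  have "(\<Sum>j\<in>J. \<integral>\<^sup>+s\<in>I j. (\<integral>\<^sup>+t\<in>I j. q s t \<partial>lborel) \<partial>lborel) =
      (\<integral>\<^sup>+s. (\<Sum>j\<in>J. (\<integral>\<^sup>+t\<in>I j. q s t \<partial>lborel) * indicator (I j) s) \<partial>lborel)"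
    by (rule nn_integral_sum[symmetric]) (rule meas)
  also have "\<dots> \<le> (\<integral>\<^sup>+s\<in>A. (\<integral>\<^sup>+t\<in>A. q s t \<partial>lborel) \<partial>lborel)"
  proof (rule nn_integral_mono)
    fix s
    show "(\<Sum>j\<in>J. (\<integral>\<^sup>+t\<in>I j. q s t \<partial>lborel) * indicator (I j) s) \<le> (\<integral>\<^sup>+t\<in>A. q s t \<partial>lborel) * indicator A s"
    proof (cases "\<exists>j\<in>J. s \<in> I j")
      case True
      then obtain k where k: "k \<in> J" "s \<in> I k" by blast
      have "(\<Sum>j\<in>J. (\<integral>\<^sup>+t\<in>I j. q s t \<partial>lborel) * indicator (I j) s) =
          (\<Sum>j\<in>J. if j = k then (\<integral>\<^sup>+t\<in>I k. q s t \<partial>lborel) else 0)"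
        using k J(2) by (intro sum.cong refl) (auto simp: disjoint_family_on_def indicator_def)
      also have "\<dots> = (\<integral>\<^sup>+t\<in>I k. q s t \<partial>lborel)" using k J(1) by simp
      also have "\<dots> \<le> (\<integral>\<^sup>+t\<in>A. q s t \<partial>lborel)"
        using J(3)[OF k(1)] by (intro nn_integral_mono mult_left_mono) (auto simp: indicator_def)
      finally show ?thesis using J(3)[OF k(1)] k(2) by (auto simp: indicator_def)
    next
      case False
      then show ?thesis by (simp add: indicator_def)
    qed
  qed
  finally show ?thesis .
qed

definition cell_error :: "(real \<Rightarrow> real) \<Rightarrow> real \<Rightarrow> real \<Rightarrow> real \<Rightarrow> real \<Rightarrow> real" where
  "cell_error g \<theta> a b x = g x - 1 / 2 * (g (a + \<theta> * (b - a)) + g (a + (1 - \<theta>) * (b - a)))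
     - 1 / (b - a) * (g b - g a) * (x - (a + b) / 2)"

text \<open>The two evaluation points are symmetric about the midpoint, so the error is the average of the
  deviations of \<open>g\<close> from its chord slope between \<open>x\<close> and either point.\<close>

lemma cell_error_le:
  fixes g w :: "real \<Rightarrow> real" and a b x p \<sigma> S :: real
  assumes ab: "a < b" and int: "set_integrable lborel {a<..<b} w" and w: "w \<in> borel_measurable borel"
    and incr: "\<And>x y. a \<le> x \<Longrightarrow> x < y \<Longrightarrow> y \<le> b \<Longrightarrow> g y - g x = (LINT r:{x<..<y}|lborel. w r)"
    and p: "1 \<le> p" and \<sigma>: "0 < \<sigma>" and S: "0 \<le> S"
    and seminorm: "(\<integral>\<^sup>+s\<in>{a<..<b}. (\<integral>\<^sup>+t\<in>{a<..<b}.
        ennreal (\<bar>w t - w s\<bar> powr p / \<bar>t - s\<bar> powr (1 + \<sigma> * p)) \<partial>lborel) \<partial>lborel) \<le> ennreal S"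
    and \<theta>: "\<theta> \<in> {0..1}" and x: "x \<in> {a..b}"
  shows "\<bar>cell_error g \<theta> a b x\<bar> \<le> (b - a) powr (1 + \<sigma> - 1 / p) * S powr (1 / p)"
proof -
  define m where "m = (g b - g a) / (b - a)"
  define y z where "y = a + \<theta> * (b - a)" and "z = a + (1 - \<theta>) * (b - a)"
  have yz: "y \<in> {a..b}" "z \<in> {a..b}" "y + z = a + b"
    using \<theta> ab mult_left_le_one_le[of "b - a" \<theta>] mult_left_le_one_le[of "b - a" "1 - \<theta>"]
    by (auto simp: y_def z_def algebra_simps)
  have m_eq: "m = (LINT r:{a<..<b}|lborel. w r) / (b - a)"
    using incr[of a b] ab by (simp add: m_def)
  have dev: "\<bar>g x - g y - m * (x - y)\<bar> \<le> (b - a) powr (1 + \<sigma> - 1 / p) * S powr (1 / p)"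
    if "y \<in> {a..b}" for y
  proof -
    have "\<bar>g x - g y - m * (x - y)\<bar> \<le> (LINT r:{a<..<b}|lborel. \<bar>w r - m\<bar>)"
      by (rule chord_deviation_le[OF ab int incr x that])
    also have "\<dots> \<le> (b - a) powr (1 + \<sigma> - 1 / p) * S powr (1 / p)"
      unfolding m_eq by (rule mean_oscillation_le[OF ab int w p \<sigma> S seminorm])
    finally show ?thesis .
  qed
  have "cell_error g \<theta> a b x = g x - 1 / 2 * (g y + g z) - m * (x - (y + z) / 2)"
    by (simp add: cell_error_def yz(3) m_def flip: y_def z_def)
  also have "\<dots> = 1 / 2 * ((g x - g y - m * (x - y)) + (g x - g z - m * (x - z)))"
    by (simp add: algebra_simps add_divide_distrib)
  finally have eq: "cell_error g \<theta> a b x = \<dots>" .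
  have average: "\<bar>1 / 2 * (P + Q)\<bar> \<le> K" if "\<bar>P\<bar> \<le> K" "\<bar>Q\<bar> \<le> K" for P Q K :: real
  proof -
    have "\<bar>P + Q\<bar> \<le> K + K" using that abs_triangle_ineq[of P Q] by linarith
    then show ?thesis by (simp add: abs_mult)
  qed
  show ?thesis unfolding eq by (rule average[OF dev[OF yz(1)] dev[OF yz(2)]])
qed

section \<open>Moments of the error of the trapezoidal rule\<close>

lemma sum_lessThan_mult:
  fixes f :: "nat \<Rightarrow> real"
  shows "(\<Sum>l<N * k. f l) = (\<Sum>j<N. \<Sum>i<k. f (j * k + i))"
proof -
  have "(\<Sum>l<N * k. f l) = (\<Sum>j<N. sum f {j * k..<j * k + k})"
    by (rule sum.nat_group[symmetric])
  also have "\<dots> = (\<Sum>j<N. \<Sum>i<k. f (j * k + i))"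
    by (simp add: sum.atLeastLessThan_shift_0[of f] atLeast0LessThan comp_def)
  finally show ?thesis .
qed

lemma node_refine:
  assumes "0 < N" "0 < k"
  shows "node 0 (real N * h) (N * k) (j * k + i) = node (real j * h) (real (Suc j) * h) k i"
  using assms by (simp add: node_def field_simps)

text \<open>The constant and the linear part of the interpolant give the two terms of the trapezoidal rule: the sum
  of the increments telescopes, and the linear part is the Riemann sum of the second integral.\<close>

lemma riemann_sum_cell_error:
  assumes "0 < k"
  shows "riemann_sum W (cell_error g \<theta> a b) a b k \<omega> =
    riemann_sum W g a b k \<omega> - 1 / 2 * (g (a + \<theta> * (b - a)) + g (a + (1 - \<theta>) * (b - a))) * (W b \<omega> - W a \<omega>)
      - 1 / (b - a) * (g b - g a) * riemann_sum W (\<lambda>s. s - (a + b) / 2) a b k \<omega>"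
proof -
  define D where "D i = W (node a b k (Suc i)) \<omega> - W (node a b k i) \<omega>" for i
  define A B where "A = 1 / 2 * (g (a + \<theta> * (b - a)) + g (a + (1 - \<theta>) * (b - a)))"
    and "B = 1 / (b - a) * (g b - g a)"
  have "(\<Sum>i<k. D i) = W b \<omega> - W a \<omega>"
    unfolding D_def using assms by (simp add: sum_lessThan_telescope[of "\<lambda>i. W (node a b k i) \<omega>"])
  moreover have "riemann_sum W (cell_error g \<theta> a b) a b k \<omega> =
      (\<Sum>i<k. g (node a b k i) * D i - A * D i - B * ((node a b k i - (a + b) / 2) * D i))"
    unfolding riemann_sum_def cell_error_def A_def[symmetric] B_def[symmetric] D_def[symmetric]
    by (intro sum.cong refl) (simp add: algebra_simps)
  ultimately show ?thesis
    unfolding A_def[symmetric] B_def[symmetric] riemann_sum_def D_def[symmetric]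
    by (simp add: sum_subtractf flip: sum_distrib_left)
qed

text \<open>A partition of \<open>[0, T]\<close> into \<open>N k\<close> cells restricts on each quadrature cell to a partition into \<open>k\<close>
  cells. The Riemann sums of all Ito integrals in the error therefore combine into a single sum over
  increments, with the values of the cell error as coefficients; its variance is bounded uniformly in \<open>k\<close>.\<close>

lemma (in wiener_process) trapezoidal_error_moment_le:
  fixes B :: "nat \<Rightarrow> real" and p \<theta> h :: real and N :: nat
  fixes g :: "real \<Rightarrow> real"
  assumes T: "0 < T" and N: "1 \<le> N" "T / real N = h" and g: "continuous_on {0..T} g" and p: "2 \<le> p"
    and B: "\<And>j x. j < N \<Longrightarrow> x \<in> {real j * h..real (Suc j) * h} \<Longrightarrow>
      \<bar>cell_error g \<theta> (real j * h) (real (Suc j) * h) x\<bar> \<le> B j"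
  defines "X \<equiv> \<lambda>\<omega>. ito_integral M F W 0 T (\<lambda>t _. g t) \<omega> - trapezoidal_rule M F W T \<theta> N g \<omega>"
  shows "X \<in> borel_measurable M"
    and "(\<integral>\<^sup>+\<omega>. ennreal (\<bar>X \<omega>\<bar> powr p) \<partial>M) \<le> ennreal (((p + 1) * (h * (\<Sum>j<N. (B j)\<^sup>2))) powr (p / 2))"
proof -
  have N_pos: "0 < N" using N by simp
  have h: "0 < h" and T_eq: "T = real N * h" using T N_pos by (simp_all flip: N(2))
  define t where "t j = real j * h" for j
  have t: "0 \<le> t j" "t j < t (Suc j)" "t (Suc j) - t j = h" for j
    using h by (auto simp: t_def algebra_simps)
  have t_le: "t (Suc j) \<le> T" if "j < N" for j
    using that h unfolding t_def T_eq by (intro mult_right_mono) auto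
  define mid where "mid j = (t j + t (Suc j)) / 2" for j
  define avg where "avg j = 1 / 2 * (g (t j + \<theta> * h) + g (t j + (1 - \<theta>) * h))" for j
  define slope where "slope j = 1 / h * (g (t (Suc j)) - g (t j))" for j
  define J where "J j = ito_integral M F W (t j) (t (Suc j)) (\<lambda>s _. s - mid j)" for j
  define I where "I = ito_integral M F W 0 T (\<lambda>t _. g t)"
  have X_eq: "X \<omega> = I \<omega> - ((\<Sum>j<N. avg j * (W (t (Suc j)) \<omega> - W (t j) \<omega>)) + (\<Sum>j<N. slope j * J j \<omega>))" for \<omega>
  proof -
    have "trapezoidal_rule M F W T \<theta> N g \<omega> =
        (\<Sum>j<N. avg j * (W (t (Suc j)) \<omega> - W (t j) \<omega>)) + (\<Sum>j<N. slope j * J j \<omega>)"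
      unfolding trapezoidal_rule_def Let_def N(2) One_nat_def sum.atLeast1_atMost_eq
      by (simp only: avg_def slope_def J_def mid_def t_def diff_Suc_Suc diff_zero)
    then show ?thesis by (simp add: X_def I_def)
  qed
  have J: "J j \<in> borel_measurable M"
      "(\<lambda>m. mean_square M (\<lambda>\<omega>. riemann_sum W (\<lambda>s. s - mid j) (t j) (t (Suc j)) (Suc m) \<omega> - J j \<omega>)) \<longlonglongrightarrow> 0"
    if "j < N" for j
    unfolding J_def using t t_le[OF that]
    by (auto intro!: borel_measurable_ito_integral riemann_sum_tendsto_ito_integral continuous_intros)
  have I: "I \<in> borel_measurable M" and I_lim:
      "(\<lambda>m. mean_square M (\<lambda>\<omega>. riemann_sum W g 0 T (Suc m) \<omega> - I \<omega>)) \<longlonglongrightarrow> 0"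
    unfolding I_def using T g
    by (auto intro!: borel_measurable_ito_integral riemann_sum_tendsto_ito_integral)
  have W_t: "W (t j) \<in> borel_measurable M" "W (t (Suc j)) \<in> borel_measurable M" if "j < N" for j
    using t[of j] t[of "Suc j"] t_le[OF that] by (auto intro!: borel_measurable_W)
  show X_meas: "X \<in> borel_measurable M"
    unfolding X_eq[abs_def]
    by (intro borel_measurable_diff borel_measurable_add borel_measurable_sum borel_measurable_times
        borel_measurable_const I J W_t) auto
  have riemann_meas: "riemann_sum W f a b m \<in> borel_measurable M" if "0 \<le> a" "a \<le> b" "b \<le> T" for f a b m
    unfolding elementary_integral_riemann_integrand[symmetric]
    by (rule borel_measurable_elementary_integral[OF elementary_riemann_integrand]) (use that in auto)
  \<comment> \<open>The error with every Ito integral replaced by its Riemann sum on the common partition.\<close>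
  define E where "E m \<omega> = riemann_sum W g 0 T (N * Suc m) \<omega> -
      ((\<Sum>j<N. avg j * (W (t (Suc j)) \<omega> - W (t j) \<omega>)) +
       (\<Sum>j<N. slope j * riemann_sum W (\<lambda>s. s - mid j) (t j) (t (Suc j)) (Suc m) \<omega>))" for m \<omega>
  have E_meas: "E m \<in> borel_measurable M" for m
    unfolding E_def[abs_def]
    by (intro borel_measurable_diff borel_measurable_add borel_measurable_sum borel_measurable_times
        borel_measurable_const riemann_meas W_t) (use T t t_le in \<open>auto intro: less_imp_le\<close>)
  have E_lim: "(\<lambda>m. mean_square M (\<lambda>\<omega>. E m \<omega> - X \<omega>)) \<longlonglongrightarrow> 0"
  proof -
    have "strict_mono (\<lambda>m. N * Suc m - 1)"
      using N_pos by (intro strict_monoI_Suc) auto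
    from LIMSEQ_subseq_LIMSEQ[OF I_lim this]
    have lim1: "(\<lambda>m. mean_square M (\<lambda>\<omega>. riemann_sum W g 0 T (N * Suc m) \<omega> - I \<omega>)) \<longlonglongrightarrow> 0"
      using N_pos by (simp add: comp_def)
    have lim2: "(\<lambda>m. mean_square M (\<lambda>\<omega>. \<Sum>j<N. - slope j *
        (riemann_sum W (\<lambda>s. s - mid j) (t j) (t (Suc j)) (Suc m) \<omega> - J j \<omega>))) \<longlonglongrightarrow> 0"
      using t t_le by (intro tendsto_mean_square_sum tendsto_mean_square_scale J borel_measurable_times
          borel_measurable_const borel_measurable_diff riemann_meas) (auto intro: less_imp_le)
    have "(\<lambda>m. mean_square M (\<lambda>\<omega>. (riemann_sum W g 0 T (N * Suc m) \<omega> - I \<omega>) + (\<Sum>j<N. - slope j *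
        (riemann_sum W (\<lambda>s. s - mid j) (t j) (t (Suc j)) (Suc m) \<omega> - J j \<omega>)))) \<longlonglongrightarrow> 0"
      using t t_le T
      by (intro tendsto_mean_square_add lim1 lim2 borel_measurable_sum J I borel_measurable_times
          borel_measurable_const borel_measurable_diff riemann_meas) (auto intro: less_imp_le)
    moreover have "(riemann_sum W g 0 T (N * Suc m) \<omega> - I \<omega>) + (\<Sum>j<N. - slope j *
        (riemann_sum W (\<lambda>s. s - mid j) (t j) (t (Suc j)) (Suc m) \<omega> - J j \<omega>)) = E m \<omega> - X \<omega>" for m \<omega>
      by (simp add: E_def X_eq right_diff_distrib sum_subtractf sum_negf)
    ultimately show ?thesis by simp
  qed
  have moment: "(\<integral>\<^sup>+\<omega>. ennreal (\<bar>E m \<omega>\<bar> powr p) \<partial>M) \<le> ennreal (((p + 1) * (h * (\<Sum>j<N. (B j)\<^sup>2))) powr (p / 2))"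
    for m
  proof -
    define k where "k = Suc m"
    define u where "u = node 0 T (N * k)"
    have k: "0 < k" by (simp add: k_def)
    have Nk: "0 < N * k" using k N_pos by simp
    have u_eq: "u (j * k + i) = node (t j) (t (Suc j)) k i" for i j
      unfolding u_def T_eq t_def by (rule node_refine[OF N_pos k])
    have u_step: "u (Suc l) - u l = h / real k" for l
      using N_pos k by (simp add: u_def node_Suc T_eq)
    define c where "c l = cell_error g \<theta> (t (l div k)) (t (Suc (l div k))) (u l)" for l
    have c_eq: "c (j * k + i) = cell_error g \<theta> (t j) (t (Suc j)) (node (t j) (t (Suc j)) k i)" if "i < k" for i j
      using that by (simp add: c_def u_eq)
    have E_eq: "E m \<omega> = (\<Sum>l<N * k. c l * (W (u (Suc l)) \<omega> - W (u l) \<omega>))" for \<omega>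
    proof -
      have u_Suc: "u (Suc (j * k + i)) = node (t j) (t (Suc j)) k (Suc i)" for j i
        using u_eq[of j "Suc i"] by simp
      have "riemann_sum W g 0 T (N * k) \<omega> = (\<Sum>j<N. riemann_sum W g (t j) (t (Suc j)) k \<omega>)"
        unfolding riemann_sum_def u_def[symmetric] sum_lessThan_mult u_eq u_Suc ..
      then have "E m \<omega> = (\<Sum>j<N. riemann_sum W g (t j) (t (Suc j)) k \<omega>
          - avg j * (W (t (Suc j)) \<omega> - W (t j) \<omega>)
          - slope j * riemann_sum W (\<lambda>s. s - mid j) (t j) (t (Suc j)) k \<omega>)"
        unfolding E_def k_def by (simp add: sum_subtractf)
      also have "\<dots> = (\<Sum>j<N. riemann_sum W (cell_error g \<theta> (t j) (t (Suc j))) (t j) (t (Suc j)) k \<omega>)"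
        unfolding riemann_sum_cell_error[OF k] avg_def slope_def mid_def t(3) ..
      also have "\<dots> = (\<Sum>l<N * k. c l * (W (u (Suc l)) \<omega> - W (u l) \<omega>))"
        unfolding riemann_sum_def sum_lessThan_mult u_eq u_Suc by (intro sum.cong refl) (simp add: c_eq)
      finally show ?thesis .
    qed
    have "(\<Sum>l<N * k. (c l)\<^sup>2 * (u (Suc l) - u l)) = (\<Sum>j<N. \<Sum>i<k. (c (j * k + i))\<^sup>2 * (h / real k))"
      unfolding sum_lessThan_mult u_step ..
    also have "\<dots> \<le> (\<Sum>j<N. \<Sum>i<k. (B j)\<^sup>2 * (h / real k))"
    proof (intro sum_mono mult_right_mono)
      fix j i assume "j \<in> {..<N}" "i \<in> {..<k}"
      then have ji: "j < N" "i < k" by auto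
      have "node (t j) (t (Suc j)) k i \<in> {t j..t (Suc j)}"
        using node_bounds[of "t j" "t (Suc j)" i k] t[of j] ji by auto
      then have "\<bar>c (j * k + i)\<bar> \<le> B j"
        using B[OF ji(1)] unfolding c_eq[OF ji(2)] t_def by blast
      then show "(c (j * k + i))\<^sup>2 \<le> (B j)\<^sup>2" by (rule abs_le_square_iff[THEN iffD1, OF order_trans]) simp
    qed (use h in auto)
    also have "\<dots> = h * (\<Sum>j<N. (B j)\<^sup>2)"
      using k by (simp add: sum_distrib_left mult.commute)
    finally have V: "(\<Sum>l<N * k. (c l)\<^sup>2 * (u (Suc l) - u l)) \<le> h * (\<Sum>j<N. (B j)\<^sup>2)" .
    show ?thesis
      unfolding E_eq
    proof (rule increment_sum_moment_le[OF p _ _ _ V])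
      show "u i < u (Suc i)" for i using u_step[of i] h k by (simp add: algebra_simps)
      show "0 \<le> u 0" "u (N * k) \<le> T" using Nk by (auto simp: u_def)
    qed
  qed
  show "(\<integral>\<^sup>+\<omega>. ennreal (\<bar>X \<omega>\<bar> powr p) \<partial>M) \<le> ennreal (((p + 1) * (h * (\<Sum>j<N. (B j)\<^sup>2))) powr (p / 2))"
    by (rule nn_integral_powr_le_of_mean_square_limit[OF E_meas X_meas E_lim moment]) (use p in simp)
qed

section \<open>The error bound\<close>

text \<open>For the constant martingale \<open>1\<close> and \<open>n = 1\<close> both norms in the inequality equal \<open>1\<close>.\<close>

lemma bdg_constant_ge_1:
  assumes "bdg_constant p C" and p: "0 < p"
  shows "1 \<le> C"
proof -
  define M :: "(nat \<Rightarrow> real) measure" where "M = return (count_space UNIV) (\<lambda>_. 0)"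
  define X :: "nat \<Rightarrow> (nat \<Rightarrow> real) \<Rightarrow> real" where "X n \<omega> = 1" for n \<omega>
  interpret prob_space M unfolding M_def by (rule prob_space_return) simp
  have sub: "subalgebra M M" by (simp add: subalgebra_def)
  interpret S: finite_measure_subalgebra M M
    by unfold_locales (rule sub)
  have "discrete_martingale M (\<lambda>_. M) X"
    unfolding discrete_martingale_def filtration_def
    using sub S.real_cond_exp_F_meas[of "\<lambda>_. 1"] by (auto simp: X_def[abs_def])
  with assms prob_space_axioms have "0 < C" and
    "Lp_norm p M (\<lambda>\<omega>. Max ((\<lambda>i. \<bar>X i \<omega>\<bar>) ` {1..1})) \<le> ennreal C * Lp_norm p M (\<lambda>\<omega>. sqrt (quadratic_variation X 1 \<omega>))"
    unfolding bdg_constant_def by blast+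
  then have "1 \<le> ennreal C"
    by (simp add: X_def quadratic_variation_def Lp_norm_def emeasure_space_1 ennreal_root_def)
  then show ?thesis by simp
qed

text \<open>The power mean with exponent \<open>p / 2\<close> for the counting measure.\<close>

lemma sum_powr_le:
  fixes S :: "nat \<Rightarrow> real"
  assumes N: "0 < N" and S: "\<And>j. 0 \<le> S j" "(\<Sum>j<N. S j) \<le> A" and p: "2 \<le> p"
  shows "(\<Sum>j<N. S j powr (2 / p)) \<le> real N * (A / real N) powr (2 / p)"
proof -
  have A: "0 \<le> A" using S by (meson order_trans sum_nonneg)
  have "(\<integral>\<^sup>+j. ennreal (S j powr (2 / p)) \<partial>count_space {..<N}) \<le> ennreal (real N * (A / real N) powr (2 / p))"
  proof (rule nn_integral_power_mean[where q = "p / 2"])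
    have "(\<integral>\<^sup>+j. ennreal ((S j powr (2 / p)) powr (p / 2)) \<partial>count_space {..<N}) = ennreal (\<Sum>j<N. S j)"
      using S p by (simp add: nn_integral_count_space_finite powr_powr)
    also have "\<dots> \<le> ennreal (real N * ((A / real N) powr (2 / p)) powr (p / 2))"
      using S N A p by (intro ennreal_leI) (simp add: powr_powr)
    finally show "(\<integral>\<^sup>+j. ennreal ((S j powr (2 / p)) powr (p / 2)) \<partial>count_space {..<N}) \<le> \<dots>" .
  qed (use p in \<open>simp_all add: ennreal_of_nat_eq_real_of_nat\<close>)
  then show ?thesis by (simp add: nn_integral_count_space_finite sum_nonneg)
qed

lemma integrable_of_powr:
  assumes p: "1 \<le> p" and w: "w \<in> borel_measurable borel"
    and fin: "(\<integral>\<^sup>+t\<in>{0<..<T}. ennreal (\<bar>w t\<bar> powr p) \<partial>lborel) < \<infinity>"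
  shows "set_integrable lborel {0<..<T::real} w"
  unfolding set_integrable_def
proof (rule integrableI_bounded)
  show "(\<lambda>x. indicator {0<..<T} x *\<^sub>R w x) \<in> borel_measurable lborel" using w by simp
  have le: "\<bar>y\<bar> \<le> 1 + \<bar>y\<bar> powr p" for y :: real
  proof (cases "\<bar>y\<bar> \<le> 1")
    case False
    then have "\<bar>y\<bar> powr 1 \<le> \<bar>y\<bar> powr p" using p by (intro powr_mono) auto
    then show ?thesis by simp
  qed (simp add: add_increasing2)
  have "(\<integral>\<^sup>+x. ennreal (norm (indicator {0<..<T} x *\<^sub>R w x)) \<partial>lborel) \<le>
      (\<integral>\<^sup>+x. indicator {0<..<T} x + ennreal (\<bar>w x\<bar> powr p) * indicator {0<..<T} x \<partial>lborel)"
  proof (rule nn_integral_mono)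
    fix x
    show "ennreal (norm (indicator {0<..<T} x *\<^sub>R w x)) \<le>
        indicator {0<..<T} x + ennreal (\<bar>w x\<bar> powr p) * indicator {0<..<T} x"
      using ennreal_leI[OF le[of "w x"]] by (cases "x \<in> {0<..<T}") auto
  qed
  also have "\<dots> = emeasure lborel {0<..<T} + (\<integral>\<^sup>+t\<in>{0<..<T}. ennreal (\<bar>w t\<bar> powr p) \<partial>lborel)"
    using w by (subst nn_integral_add) auto
  also have "\<dots> < \<infinity>"
    using fin emeasure_bounded_finite[of "{0<..<T}"] by (simp add: ennreal_add_eq_top less_top)
  finally show "(\<integral>\<^sup>+x. ennreal (norm (indicator {0<..<T} x *\<^sub>R w x)) \<partial>lborel) < \<infinity>" .
qed

lemma ennreal_root_mono:
  assumes "x \<le> y" "0 < p"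
  shows "ennreal_root p x \<le> ennreal_root p y"
proof (cases "y = \<top>")
  case False
  with assms have "enn2real x \<le> enn2real y" by (intro enn2real_mono) (auto simp: less_top)
  with False assms show ?thesis
    by (auto simp: ennreal_root_def top_unique intro!: ennreal_leI powr_mono2)
qed (simp add: ennreal_root_def)

lemma ennreal_root_ennreal: "0 \<le> x \<Longrightarrow> ennreal_root p (ennreal x) = ennreal (x powr (1 / p))"
  by (simp add: ennreal_root_def)

lemma Lp_norm_fst:
  assumes "prob_space N" and X: "X \<in> borel_measurable M"
  shows "Lp_norm p (M \<Otimes>\<^sub>M N) (\<lambda>\<omega>. X (fst \<omega>)) = Lp_norm p M X"
proof -
  interpret N: prob_space N by fact
  have [measurable]: "X \<in> borel_measurable M" by fact
  have "(\<integral>\<^sup>+\<omega>. ennreal (\<bar>X (fst \<omega>)\<bar> powr p) \<partial>(M \<Otimes>\<^sub>M N)) = (\<integral>\<^sup>+x. \<integral>\<^sup>+y. ennreal (\<bar>X x\<bar> powr p) \<partial>N \<partial>M)"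
    by (subst N.nn_integral_fst[symmetric]) simp_all
  then show ?thesis by (simp add: Lp_norm_def N.emeasure_space_1)
qed

text \<open>The power mean over the cells contributes \<open>N\<^sup>1\<^sup>-\<^sup>2\<^sup>/\<^sup>p\<close>, and \<open>N h = T\<close> turns this and the spare powers of
  \<open>h\<close> into the power of \<open>T\<close>.\<close>

lemma cell_bounds_sum_le:
  fixes S :: "nat \<Rightarrow> real"
  assumes N: "0 < N" and T: "0 < T" "T / real N = h" and p: "2 \<le> p"
    and S: "\<And>j. 0 \<le> S j" "(\<Sum>j<N. S j) \<le> A"
  shows "h * (\<Sum>j<N. (h powr (1 + \<sigma> - 1 / p) * S j powr (1 / p))\<^sup>2) \<le>
    (T powr ((p - 2) / (2 * p)) * h powr (1 + \<sigma>) * A powr (1 / p))\<^sup>2"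
proof -
  have A: "0 \<le> A" using S by (meson order_trans sum_nonneg)
  have h: "0 < h" using T N by (simp flip: T(2))
  have sq: "(x powr a)\<^sup>2 = x powr (2 * a)" for x a :: real
    by (simp add: power2_eq_square flip: powr_add)
  have "h * (\<Sum>j<N. (h powr (1 + \<sigma> - 1 / p) * S j powr (1 / p))\<^sup>2) =
      h * (h powr (1 + \<sigma> - 1 / p))\<^sup>2 * (\<Sum>j<N. S j powr (2 / p))"
    by (simp add: power_mult_distrib sq[of "S _"] sum_distrib_left mult.assoc)
  also have "\<dots> \<le> h * (h powr (1 + \<sigma> - 1 / p))\<^sup>2 * (real N * (A / real N) powr (2 / p))"
    using h N S p by (intro mult_left_mono sum_powr_le) auto
  also have "(A / real N) powr (2 / p) = A powr (2 / p) * (h / T) powr (2 / p)"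
  proof -
    have "A / real N = A * (h / T)" using T by (simp flip: T(2))
    then show ?thesis using A h T by (simp only: powr_mult)
  qed
  also have "h * (h powr (1 + \<sigma> - 1 / p))\<^sup>2 * (real N * (A powr (2 / p) * (h / T) powr (2 / p))) =
      T * (h powr (2 * (1 + \<sigma> - 1 / p)) * (h / T) powr (2 / p)) * A powr (2 / p)"
  proof -
    have "T = h * real N" using N by (simp flip: T(2))
    then show ?thesis unfolding sq by (simp only: mult_ac)
  qed
  also have "h powr (2 * (1 + \<sigma> - 1 / p)) * (h / T) powr (2 / p) = h powr (2 * (1 + \<sigma>)) * T powr (- (2 / p))"
  proof -
    have "h powr (2 * (1 + \<sigma> - 1 / p)) * h powr (2 / p) = h powr (2 * (1 + \<sigma>))"
      by (simp add: algebra_simps flip: powr_add)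
    moreover have "(h / T) powr (2 / p) = h powr (2 / p) * T powr (- (2 / p))"
      using h T by (simp add: powr_divide powr_minus_divide)
    ultimately show ?thesis by (simp only: mult.assoc[symmetric])
  qed
  also have "T * (h powr (2 * (1 + \<sigma>)) * T powr (- (2 / p))) * A powr (2 / p) =
      (T * T powr (- (2 / p))) * h powr (2 * (1 + \<sigma>)) * A powr (2 / p)"
    by (simp only: mult_ac)
  also have "T * T powr (- (2 / p)) = T powr (2 * ((p - 2) / (2 * p)))"
  proof -
    have "1 + (- (2 / p)) = 2 * ((p - 2) / (2 * p))" using p by (simp add: field_simps)
    then show ?thesis using T powr_add[of T 1 "- (2 / p)"] by simp
  qed
  also have "T powr (2 * ((p - 2) / (2 * p))) * h powr (2 * (1 + \<sigma>)) * A powr (2 / p) =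
      (T powr ((p - 2) / (2 * p)) * h powr (1 + \<sigma>) * A powr (1 / p))\<^sup>2"
    by (simp add: power_mult_distrib sq)
  finally show ?thesis .
qed

theorem theorem4p2:
  fixes MW :: "'a measure" and MTheta :: "'b measure"
    and F :: "real \<Rightarrow> 'a measure" and W :: "real \<Rightarrow> 'a \<Rightarrow> real"
    and T p \<sigma> \<theta> h C :: real and g :: "real \<Rightarrow> real" and N :: nat
  assumes "0 < T"
    and "wiener_process MW F T W"
    and "prob_space MTheta"
    and "2 \<le> p" and "0 < \<sigma>" and "\<sigma> < 1"
    and "bdg_constant p C"
    and "g \<in> sobolev_space T \<sigma> p" and "continuous_on {0..T} g"
    and "\<theta> \<in> {0..1}"
    and "1 \<le> N" and "T / real N = h"
  shows "Lp_norm p (MW \<Otimes>\<^sub>M MTheta)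
           (\<lambda>\<omega>. ito_integral MW F W 0 T (\<lambda>t _. g t) (fst \<omega>) - trapezoidal_rule MW F W T \<theta> N g (fst \<omega>))
         \<le> ennreal (C * (2 * p * (p - 1)) powr (1 / 2) * T powr ((p - 2) / (2 * p)) * h powr (1 + \<sigma>))
            * sobolev_norm T \<sigma> p g"
proof -
  interpret wiener_process MW F T W by fact
  note T = \<open>0 < T\<close> and p = \<open>2 \<le> p\<close> and \<sigma> = \<open>0 < \<sigma>\<close> and cont = \<open>continuous_on {0..T} g\<close>
    and N = \<open>1 \<le> N\<close> \<open>T / real N = h\<close>
  have p_pos: "0 < p" using p by linarith
  have N_pos: "0 < N" and h: "0 < h" and T_eq: "T = real N * h" using T N(1) by (simp_all flip: N(2))
  let ?J = "{0<..<T}"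
  \<comment> \<open>Outside the open interval the chosen weak derivative is arbitrary; cutting it off makes it measurable.\<close>
  define w where "w x = indicator ?J x * weak_derivative T g x" for x
  have weak: "has_weak_derivative T g (weak_derivative T g)"
    using \<open>g \<in> sobolev_space T \<sigma> p\<close> unfolding weak_derivative_def sobolev_space_def
    by (intro someI_ex[where P = "has_weak_derivative T g"]) blast
  have w_eq: "w x = weak_derivative T g x" if "x \<in> ?J" for x using that by (simp add: w_def)
  have w [measurable]: "w \<in> borel_measurable borel"
    using weak unfolding has_weak_derivative_def locally_integrable_def set_borel_measurable_def w_def[abs_def] by simp
  define q where "q s t = ennreal (\<bar>w t - w s\<bar> powr p / \<bar>t - s\<bar> powr (1 + \<sigma> * p))" for s t
  define A1 A2 A3 where "A1 = (\<integral>\<^sup>+t\<in>?J. ennreal (\<bar>g t\<bar> powr p) \<partial>lborel)"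
    and "A2 = (\<integral>\<^sup>+t\<in>?J. ennreal (\<bar>w t\<bar> powr p) \<partial>lborel)"
    and "A3 = (\<integral>\<^sup>+s\<in>?J. (\<integral>\<^sup>+t\<in>?J. q s t \<partial>lborel) \<partial>lborel)"
  have norm_eq: "sobolev_norm T \<sigma> p g = ennreal_root p (A1 + A2 + A3)"
  proof -
    have "(\<integral>\<^sup>+t\<in>?J. ennreal (\<bar>weak_derivative T g t\<bar> powr p) \<partial>lborel) = A2"
      unfolding A2_def by (intro nn_integral_cong) (simp add: w_def indicator_def)
    moreover have "(\<integral>\<^sup>+s\<in>?J. (\<integral>\<^sup>+t\<in>?J. ennreal (\<bar>weak_derivative T g t - weak_derivative T g s\<bar> powr p /
        \<bar>t - s\<bar> powr (1 + \<sigma> * p)) \<partial>lborel) \<partial>lborel) = A3"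
      unfolding A3_def
    proof (rule nn_integral_cong)
      fix s
      show "(\<integral>\<^sup>+t\<in>?J. ennreal (\<bar>weak_derivative T g t - weak_derivative T g s\<bar> powr p /
          \<bar>t - s\<bar> powr (1 + \<sigma> * p)) \<partial>lborel) * indicator ?J s = (\<integral>\<^sup>+t\<in>?J. q s t \<partial>lborel) * indicator ?J s"
      proof (cases "s \<in> ?J")
        case True
        then have "(\<integral>\<^sup>+t\<in>?J. ennreal (\<bar>weak_derivative T g t - weak_derivative T g s\<bar> powr p /
            \<bar>t - s\<bar> powr (1 + \<sigma> * p)) \<partial>lborel) = (\<integral>\<^sup>+t\<in>?J. q s t \<partial>lborel)"
          by (intro nn_integral_cong) (auto simp: q_def w_eq indicator_def)
        then show ?thesis by simp
      qed simp
    qed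
    ultimately show ?thesis by (simp add: sobolev_norm_def A1_def)
  qed
  have "sobolev_norm T \<sigma> p g < \<infinity>" using \<open>g \<in> sobolev_space T \<sigma> p\<close> by (simp add: sobolev_space_def)
  then have "A1 + A2 + A3 \<noteq> \<top>" unfolding norm_eq ennreal_root_def by (auto split: if_splits)
  then have fin: "A2 < \<top>" "A3 < \<top>" by (auto simp: less_top)
  define A where "A = enn2real A3"
  have A: "0 \<le> A" "A3 = ennreal A" using fin by (simp_all add: A_def)
  have int: "set_integrable lborel ?J w"
    using p fin(1) by (intro integrable_of_powr[where p = p] w) (auto simp: A2_def)
  have incr: "g t - g s = (LINT x:{s<..<t}|lborel. w x)" if "0 \<le> s" "s < t" "t \<le> T" for s t
  proof -
    have eq: "indicator {s<..<t} x *\<^sub>R w x = indicator {s<..<t} x *\<^sub>R weak_derivative T g x"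
      "indicator ?J x *\<^sub>R w x = indicator ?J x *\<^sub>R weak_derivative T g x" for x
      using that by (auto simp: indicator_def w_def)
    have "set_integrable lborel ?J (weak_derivative T g)"
      using int unfolding set_integrable_def eq(2) .
    from weak_derivative_increment[OF weak cont this that] show ?thesis
      unfolding set_lebesgue_integral_def eq(1) .
  qed
  define a where "a j = real j * h" for j
  define I where "I j = {a j<..<a (Suc j)}" for j
  have a: "0 \<le> a j" "a j < a (Suc j)" "a (Suc j) - a j = h" for j
    using h by (auto simp: a_def algebra_simps)
  have a_le: "a (Suc j) \<le> T" if "j < N" for j
    using that h unfolding a_def T_eq by (intro mult_right_mono) auto
  have a_mono: "a i \<le> a j" if "i \<le> j" for i j
    using that h unfolding a_def by (intro mult_right_mono) auto
  have I_sub: "I j \<subseteq> ?J" if "j < N" for j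
    using a[of j] a_le[OF that] by (auto simp: I_def)
  have I_disj: "disjoint_family_on I {..<N}"
  proof -
    have "I i \<inter> I j = {}" if "i < j" for i j
      using a_mono[of "Suc i" j] that by (auto simp: I_def)
    then show ?thesis unfolding disjoint_family_on_def by (metis Int_commute linorder_neqE_nat)
  qed
  have q_meas: "(\<lambda>(s, t). q s t) \<in> borel_measurable (lborel \<Otimes>\<^sub>M lborel)"
    unfolding q_def by measurable
  define S' where "S' j = (\<integral>\<^sup>+s\<in>I j. (\<integral>\<^sup>+t\<in>I j. q s t \<partial>lborel) \<partial>lborel)" for j
  have S'_sum: "(\<Sum>j<N. S' j) \<le> ennreal A"
    unfolding S'_def A(2)[symmetric] A3_def
    by (rule sum_diagonal_blocks_le[OF q_meas _ I_disj]) (use I_sub in \<open>auto simp: I_def\<close>)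
  define S where "S j = enn2real (S' j)" for j
  have S_nonneg: "0 \<le> S j" for j by (simp add: S_def)
  have S': "S' j = ennreal (S j)" if "j < N" for j
  proof -
    have "S' j \<le> (\<Sum>j<N. S' j)" using that by (intro member_le_sum) auto
    also note S'_sum
    finally have "S' j < \<top>" by (rule le_less_trans) simp
    then show ?thesis by (simp add: S_def)
  qed
  have S_sum: "(\<Sum>j<N. S j) \<le> A"
    using S'_sum S' S_nonneg A(1) by (simp add: sum_nonneg)
  define B where "B j = h powr (1 + \<sigma> - 1 / p) * S j powr (1 / p)" for j
  have B: "\<bar>cell_error g \<theta> (a j) (a (Suc j)) x\<bar> \<le> B j" if j: "j < N" and x: "x \<in> {a j..a (Suc j)}" for j x
    unfolding B_def a(3)[of j, symmetric]
  proof (rule cell_error_le[where w = w])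
    show "set_integrable lborel {a j<..<a (Suc j)} w"
      by (rule set_integrable_subset[OF int]) (use I_sub[OF j] in \<open>auto simp: I_def\<close>)
    show "g y - g x = (LINT r:{x<..<y}|lborel. w r)" if "a j \<le> x" "x < y" "y \<le> a (Suc j)" for x y
      using that a(1)[of j] a_le[OF j] by (intro incr) auto
    show "(\<integral>\<^sup>+s\<in>{a j<..<a (Suc j)}. (\<integral>\<^sup>+t\<in>{a j<..<a (Suc j)}.
        ennreal (\<bar>w t - w s\<bar> powr p / \<bar>t - s\<bar> powr (1 + \<sigma> * p)) \<partial>lborel) \<partial>lborel) \<le> ennreal (S j)"
      using S'[OF j] by (simp add: S'_def I_def q_def)
  qed (use a[of j] p \<sigma> S_nonneg x \<open>\<theta> \<in> {0..1}\<close> w in auto)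
  define X where "X \<omega> = ito_integral MW F W 0 T (\<lambda>t _. g t) \<omega> - trapezoidal_rule MW F W T \<theta> N g \<omega>" for \<omega>
  note err = trapezoidal_error_moment_le[OF T N cont p B[unfolded a_def], folded X_def]
  define K where "K = T powr ((p - 2) / (2 * p)) * h powr (1 + \<sigma>) * A powr (1 / p)"
  have K: "0 \<le> K" using T h by (simp add: K_def)
  have C: "1 \<le> C" using bdg_constant_ge_1[OF \<open>bdg_constant p C\<close>] p by simp
  have "Lp_norm p (MW \<Otimes>\<^sub>M MTheta) (\<lambda>\<omega>. X (fst \<omega>)) = Lp_norm p MW X"
    by (rule Lp_norm_fst[OF \<open>prob_space MTheta\<close> err(1)])
  also have "\<dots> \<le> ennreal_root p (ennreal (((p + 1) * (h * (\<Sum>j<N. (B j)\<^sup>2))) powr (p / 2)))"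
    unfolding Lp_norm_def by (rule ennreal_root_mono[OF err(2) p_pos])
  also have "\<dots> = ennreal (((p + 1) * (h * (\<Sum>j<N. (B j)\<^sup>2))) powr (1 / 2))"
    using p by (simp add: ennreal_root_ennreal powr_powr)
  also have "\<dots> \<le> ennreal ((2 * p * (p - 1) * K\<^sup>2) powr (1 / 2))"
  proof (intro ennreal_leI powr_mono2)
    have "p * (2 * p - 3) \<ge> 2 * 1" using p by (intro mult_mono) auto
    then have "p + 1 \<le> 2 * p * (p - 1)" by (simp add: algebra_simps)
    moreover have "h * (\<Sum>j<N. (B j)\<^sup>2) \<le> K\<^sup>2"
      unfolding B_def K_def by (rule cell_bounds_sum_le[OF N_pos T N(2) p S_nonneg S_sum])
    ultimately show "(p + 1) * (h * (\<Sum>j<N. (B j)\<^sup>2)) \<le> 2 * p * (p - 1) * K\<^sup>2"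
      using p h by (intro mult_mono mult_nonneg_nonneg sum_nonneg) auto
  qed (use p h in \<open>auto intro!: mult_nonneg_nonneg sum_nonneg\<close>)
  also have "(2 * p * (p - 1) * K\<^sup>2) powr (1 / 2) = (2 * p * (p - 1)) powr (1 / 2) * K"
    using p K by (simp add: powr_mult powr_half_sqrt)
  also have "ennreal ((2 * p * (p - 1)) powr (1 / 2) * K) \<le> ennreal (C * ((2 * p * (p - 1)) powr (1 / 2) * K))"
    using C K mult_right_mono[OF C, of "(2 * p * (p - 1)) powr (1 / 2) * K"] by (intro ennreal_leI) simp
  also have "\<dots> = ennreal (C * (2 * p * (p - 1)) powr (1 / 2) * T powr ((p - 2) / (2 * p)) * h powr (1 + \<sigma>)) *
      ennreal (A powr (1 / p))"
    using C by (subst ennreal_mult[symmetric]) (auto simp: K_def mult_ac)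
  also have "\<dots> \<le> ennreal (C * (2 * p * (p - 1)) powr (1 / 2) * T powr ((p - 2) / (2 * p)) * h powr (1 + \<sigma>)) *
      sobolev_norm T \<sigma> p g"
  proof (rule mult_left_mono)
    have "ennreal (A powr (1 / p)) = ennreal_root p A3"
      unfolding A(2) using A(1) by (rule ennreal_root_ennreal[symmetric])
    also have "\<dots> \<le> sobolev_norm T \<sigma> p g"
      unfolding norm_eq using p by (intro ennreal_root_mono) auto
    finally show "ennreal (A powr (1 / p)) \<le> sobolev_norm T \<sigma> p g" .
  qed simp
  finally show ?thesis by (simp add: X_def)
qed

end
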